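(* Let $\mu=\mu'$ be a self-conjugate partition of $n$, and let $\widehat\mu=(2\mu_1-1,\,2\mu_2-3,\,\ldots,\,2\mu_d-2d+1)\vdash n$ be the partition of its principal hook lengths, where $d=\max\{r:\mu_r\ge r\}$. Then for every $\lambda\vdash n$, $$ g(\lambda,\mu,\mu)\ \ge\ \bigl|\chi^\lambda[\widehat\mu]\bigr|, $$ where $\chi^\lambda[\widehat\mu]$ denotes the value of the irreducible character $\chi^\lambda$ of $S_n$ at a permutation of cycle type $\widehat\mu$.
   Context: $\mu'$ denotes the conjugate partition of $\mu$. For partitions $\alpha,\beta,\gamma\vdash n$, the Kronecker coefficient $g(\alpha,\beta,\gamma)$ is the multiplicity of $\chi^\gamma$ in $\chi^\alpha\otimes\chi^\beta$, where $\chi^\alpha$ denotes the character of the irreducible representation of $S_n$ indexed by $\alpha$. *)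

theory Defs
  imports
    Complex_Main
    "HOL-Library.Function_Algebras"
    "HOL-Library.Multiset"
    "HOL-Combinatorics.Permutations"
    "HOL-Combinatorics.Orbits"
begin

section \<open>Partitions\<close>

definition is_partition :: "nat list \<Rightarrow> nat \<Rightarrow> bool" (infix "\<turnstile>" 50) where
  "\<mu> \<turnstile> n \<longleftrightarrow> sorted_wrt (\<ge>) \<mu> \<and> 0 \<notin> set \<mu> \<and> sum_list \<mu> = n"

text \<open>Parts are numbered from 1; the value is 0 beyond the length, and at the dummy index 0.\<close>

definition part :: "nat list \<Rightarrow> nat \<Rightarrow> nat" where
  "part \<mu> i = (if 1 \<le> i \<and> i \<le> length \<mu> then \<mu> ! (i - 1) else 0)"

definition conjugate :: "nat list \<Rightarrow> nat list" where
  "conjugate \<mu> = map (\<lambda>j. card {i. part \<mu> i \<ge> j \<and> i \<ge> 1}) [1..<part \<mu> 1 + 1]"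

text \<open>The index 0 always satisfies the condition, so that the empty partition gets the value 0.\<close>

definition durfee :: "nat list \<Rightarrow> nat" where
  "durfee \<mu> = Max {r. part \<mu> r \<ge> r}"

text \<open>For \<open>1 \<le> i \<le> durfee \<mu>\<close> one has \<open>part \<mu> i \<ge> i\<close>, so the subtraction does not truncate. The
  entries are \<open>2 * \<mu>\<^sub>i - (2 * i - 1)\<close>, the principal hook lengths when \<open>\<mu>\<close> is self-conjugate.\<close>

definition principal_hooks :: "nat list \<Rightarrow> nat list" where
  "principal_hooks \<mu> = map (\<lambda>i. 2 * part \<mu> i - (2 * i - 1)) [1..<durfee \<mu> + 1]"

section \<open>Trace of an operator on a subspace of a function space\<close>

definition fscale :: "complex \<Rightarrow> ('a \<Rightarrow> complex) \<Rightarrow> 'a \<Rightarrow> complex" where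
  "fscale c f = (\<lambda>x. c * f x)"

global_interpretation fun_space: vector_space "fscale :: complex \<Rightarrow> ('a \<Rightarrow> complex) \<Rightarrow> _"
  by unfold_locales (auto simp: fscale_def fun_eq_iff algebra_simps)

text \<open>Meant for a finite-dimensional subspace \<open>V\<close> and a linear \<open>f\<close> that maps \<open>V\<close> to itself; then the
  value does not depend on the chosen basis.\<close>

definition trace_on :: "('a \<Rightarrow> complex) set \<Rightarrow> (('a \<Rightarrow> complex) \<Rightarrow> ('a \<Rightarrow> complex)) \<Rightarrow> complex" where
  "trace_on V f =
    (let B = (SOME B. fun_space.independent B \<and> fun_space.span B = V)
     in \<Sum>b\<in>B. fun_space.representation B (f b) b)"

section \<open>Specht modules and irreducible characters of the symmetric group\<close>

text \<open>The symmetric group on \<open>n\<close> letters consists of the \<open>\<pi>\<close> with \<open>\<pi> permutes {..<n}\<close>. The irreducible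
  complex representation indexed by \<open>\<alpha>\<close> is the Specht module, spanned by the polytabloids inside the
  permutation module on tabloids (James' construction); the partition with a single part gives the
  trivial representation. A tabloid is the list of its row sets, and an element of the permutation
  module is a complex function on tabloids. The cells of a diagram are numbered from 0.\<close>

definition diagram :: "nat list \<Rightarrow> (nat \<times> nat) set" where
  "diagram \<alpha> = {(i, j). i < length \<alpha> \<and> j < \<alpha> ! i}"

definition tableau :: "nat list \<Rightarrow> (nat \<times> nat \<Rightarrow> nat) \<Rightarrow> bool" where
  "tableau \<alpha> t \<longleftrightarrow> bij_betw t (diagram \<alpha>) {..<sum_list \<alpha>}"

definition tabloid :: "nat list \<Rightarrow> (nat \<times> nat \<Rightarrow> nat) \<Rightarrow> nat set list" where
  "tabloid \<alpha> t = map (\<lambda>i. t ` {c \<in> diagram \<alpha>. fst c = i}) [0..<length \<alpha>]"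

definition column_stabilizer :: "nat list \<Rightarrow> (nat \<times> nat \<Rightarrow> nat) \<Rightarrow> (nat \<Rightarrow> nat) set" where
  "column_stabilizer \<alpha> t =
    {\<sigma>. \<sigma> permutes {..<sum_list \<alpha>} \<and>
        (\<forall>j. \<sigma> ` t ` {c \<in> diagram \<alpha>. snd c = j} = t ` {c \<in> diagram \<alpha>. snd c = j})}"

text \<open>The polytabloid of \<open>t\<close> is the signed sum of the tabloids of \<open>\<sigma> \<circ> t\<close>, with \<open>\<sigma>\<close> ranging over the
  column stabilizer.\<close>

definition polytabloid :: "nat list \<Rightarrow> (nat \<times> nat \<Rightarrow> nat) \<Rightarrow> nat set list \<Rightarrow> complex" where
  "polytabloid \<alpha> t =
    (\<lambda>T. \<Sum>\<sigma> \<in> {\<sigma> \<in> column_stabilizer \<alpha> t. tabloid \<alpha> (\<sigma> \<circ> t) = T}. of_int (sign \<sigma>))"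

definition specht :: "nat list \<Rightarrow> (nat set list \<Rightarrow> complex) set" where
  "specht \<alpha> = fun_space.span {polytabloid \<alpha> t | t. tableau \<alpha> t}"

text \<open>\<open>\<pi>\<close> sends the indicator function of a tabloid \<open>T\<close> to that of \<open>\<pi> T\<close>.\<close>

definition perm_action :: "(nat \<Rightarrow> nat) \<Rightarrow> (nat set list \<Rightarrow> complex) \<Rightarrow> nat set list \<Rightarrow> complex" where
  "perm_action \<pi> f = (\<lambda>T. f (map ((`) (inv \<pi>)) T))"

definition irr_char :: "nat list \<Rightarrow> (nat \<Rightarrow> nat) \<Rightarrow> complex" where
  "irr_char \<alpha> \<pi> = trace_on (specht \<alpha>) (perm_action \<pi>)"

section \<open>Kronecker coefficients\<close>

text \<open>The multiplicities of the irreducible characters in a character \<open>\<psi>\<close> are the coefficients of the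
  unique expansion of \<open>\<psi>\<close> as a sum of irreducible characters.\<close>

definition char_mult :: "nat \<Rightarrow> nat list \<Rightarrow> ((nat \<Rightarrow> nat) \<Rightarrow> complex) \<Rightarrow> nat" where
  "char_mult n \<gamma> \<psi> =
    (THE m :: nat list \<Rightarrow> nat.
       (\<forall>\<nu>. \<not> \<nu> \<turnstile> n \<longrightarrow> m \<nu> = 0) \<and>
       (\<forall>\<pi>. \<pi> permutes {..<n} \<longrightarrow> \<psi> \<pi> = (\<Sum>\<nu> | \<nu> \<turnstile> n. of_nat (m \<nu>) * irr_char \<nu> \<pi>))) \<gamma>"

definition kronecker :: "nat \<Rightarrow> nat list \<Rightarrow> nat list \<Rightarrow> nat list \<Rightarrow> nat" where
  "kronecker n \<alpha> \<beta> \<gamma> = char_mult n \<gamma> (\<lambda>\<pi>. irr_char \<alpha> \<pi> * irr_char \<beta> \<pi>)"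

section \<open>Cycle type\<close>

text \<open>The multiset of cycle lengths; fixed points count as cycles of length 1.\<close>

definition cycle_type :: "nat \<Rightarrow> (nat \<Rightarrow> nat) \<Rightarrow> nat multiset" where
  "cycle_type n \<pi> = image_mset card (mset_set (orbit \<pi> ` {..<n}))"

end

(*
  For symmetric mu the Specht module S = S^mu is isomorphic to its sign twist. An explicit isomorphism is the
  operator K on the tabloid module with entries K(v,w) = sign of the tableau with column word v and row word w
  (0 if there is none): its rows are the polytabloids, K g = sgn(g) g K, and K K = +-c E with c > 0 and E the
  projection on S. Put d(g) = tr(K g).

  On the invariants of S^lambda (x) S (x) S, a space of dimension g(lambda,mu,mu), the operator 1 (x) K (x) K
  has square c^2, so its trace (1/n!) sum chi^lambda(g) d(g)^2 is at most c g(lambda,mu,mu) in absolute value.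
  Schur orthogonality gives (1/n!) sum d(g)^2 = c. Hence it suffices that d vanishes outside the cycle type of the
  principal hooks of mu, for then the trace is c chi^lambda[hat mu].

  Since d(h g h^-1) = sgn(h) d(g), the cycles of g have odd and distinct lengths when d(g) /= 0. Moreover, for every
  cycle z of length 2k+1 the trace picks up a positive multiple of itself when z is multiplied by the symmetrizer of
  k of its letters and the antisymmetrizer of the k+1 others, so the product of these operators does not kill the
  polytabloids. As polytabloids are highest weight vectors, removing hooks one by one shows that the cycle type of g
  is lexicographically at most the type of the principal hooks of mu. Symmetric diagrams correspond to cycle types
  with distinct odd parts, and the functions d of different diagrams are orthogonal, so triangularity forces d to
  be supported on a single type.
*)
theory Submission
  imports Defs "HOL-Combinatorics.Cycles"
begin

section \<open>Traces and idempotents\<close>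

text \<open>All modules are treated as real matrices indexed by words, and two facts carry the
  representation theory. First, a function of a column word and a row word that changes by the sign
  under the group is a multiple of \<open>K\<close>: this plays the part of Schur's lemma and yields
  the projection \<open>E\<close>, the orthogonality relations and the norm of d. Second, the trace
  of an idempotent matrix is a natural number that vanishes only for the zero matrix: this yields
  the integrality of multiplicities, the bound for the trace of an involution and, by counting cycle
  types against partitions, the completeness of the characters.

  Two factors K appear because a single K commutes with the group only up to sign, while in K (x) K
  the signs cancel. Hence only the square of d enters, and its support and its norm suffice; the
  values of d are never computed.

  In the support argument, antisymmetry in k+1 letters forces k+1 different rows, so it compares the
  half length of a cycle with an arm of the diagram. This bounds the cycle type on one side only,
  and orthogonality has to supply the other side.\<close>

lemma fun_sum_apply: "(\<Sum>i\<in>I. f i) x = (\<Sum>i\<in>I. f i x)" for f :: "'i \<Rightarrow> 'a \<Rightarrow> complex"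
  by (induction I rule: infinite_finite_induct) (auto simp: zero_fun_def)

text \<open>\<open>V\<close> is the image of the projection with matrix \<open>P\<close>, and every
  vector of \<open>V\<close> is a combination of the columns of \<open>P\<close> with its own values
  as coefficients. Expanding \<open>F b\<close> in this way, and then the columns in the basis
  \<open>B\<close>, leaves the trace of \<open>F\<close> after \<open>P\<close> in
  coordinates.\<close>

lemma trace_on_eq:
  fixes P :: "'s \<Rightarrow> 's \<Rightarrow> complex"
  assumes fin: "finite S" and sub: "fun_space.subspace V"
    and supp: "\<And>f s. f \<in> V \<Longrightarrow> s \<notin> S \<Longrightarrow> f s = 0"
    and fixd: "\<And>f s. f \<in> V \<Longrightarrow> s \<in> S \<Longrightarrow> f s = (\<Sum>s'\<in>S. P s s' * f s')"
    and col: "\<And>s'. s' \<in> S \<Longrightarrow> (\<lambda>s. if s \<in> S then P s s' else 0) \<in> V"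
    and add: "\<And>f g. F (f + g) = F f + F g"
    and scale: "\<And>c f. F (fscale c f) = fscale c (F f)"
    and FV: "\<And>f. f \<in> V \<Longrightarrow> F f \<in> V"
  shows "trace_on V F = (\<Sum>s\<in>S. F (\<lambda>t. if t \<in> S then P t s else 0) s)"
proof -
  define c where "c s = (\<lambda>t. if t \<in> S then P t s else 0)" for s
  define B where "B = (SOME B. fun_space.independent B \<and> fun_space.span B = V)"
  have "\<exists>B. fun_space.independent B \<and> fun_space.span B = V"
    using fun_space.basis_exists[of V] sub
    by (metis fun_space.span_subspace)
  then have B: "fun_space.independent B" "fun_space.span B = V"
    unfolding B_def by (metis (mono_tags, lifting) someI_ex)+
  have expand: "f = (\<Sum>s\<in>S. fscale (f s) (c s))" if "f \<in> V" for f
  proof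
    fix t
    show "f t = (\<Sum>s\<in>S. fscale (f s) (c s)) t"
    proof (cases "t \<in> S")
      case True
      then show ?thesis using fixd[OF that True]
        by (simp add: fun_sum_apply fscale_def c_def mult.commute)
    next
      case False
      then show ?thesis using supp[OF that False]
        by (simp add: fun_sum_apply fscale_def c_def)
    qed
  qed
  have cV: "c s \<in> V" if "s \<in> S" for s using col[OF that] by (simp add: c_def)
  have "B \<subseteq> fun_space.span (c ` S)"
  proof
    fix b assume "b \<in> B"
    then have "b \<in> V" using B(2) fun_space.span_base by blast
    have "(\<Sum>s\<in>S. fscale (b s) (c s)) \<in> fun_space.span (c ` S)"
      by (intro fun_space.span_sum fun_space.span_scale fun_space.span_base) auto
    then show "b \<in> fun_space.span (c ` S)" using expand[OF \<open>b \<in> V\<close>] by simp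
  qed
  then have finB: "finite B"
    using fun_space.independent_span_bound[of "c ` S" B] fin B(1) by auto
  have F0: "F 0 = 0"
    using scale[of 0 0] by (simp add: fscale_def zero_fun_def)
  have Fsum: "F (\<Sum>i\<in>I. fscale (r i) (g i)) = (\<Sum>i\<in>I. fscale (r i) (F (g i)))"
    for I :: "('s \<Rightarrow> complex) set" and r g
  proof (induction I rule: infinite_finite_induct)
    case (insert i I)
    show ?case by (simp only: sum.insert[OF insert(1,2)] add scale insert.IH)
  qed (simp_all only: sum.infinite sum.empty F0 not_False_eq_True)
  have "trace_on V F = (\<Sum>b\<in>B. fun_space.representation B (F b) b)"
    unfolding trace_on_def B_def[symmetric] Let_def by simp
  also have "\<dots> = (\<Sum>b\<in>B. \<Sum>s\<in>S. F b s * fun_space.representation B (c s) b)"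
  proof (rule sum.cong[OF refl])
    fix b assume b: "b \<in> B"
    then have "F b \<in> V" using FV B(2) fun_space.span_base by blast
    then have "fun_space.representation B (F b) b
        = fun_space.representation B (\<Sum>s\<in>S. fscale (F b s) (c s)) b"
      using expand by metis
    also have "\<dots> = (\<Sum>s\<in>S. fun_space.representation B (fscale (F b s) (c s)) b)"
      by (subst fun_space.representation_sum)
        (use B cV fun_space.span_scale in auto)
    also have "\<dots> = (\<Sum>s\<in>S. F b s * fun_space.representation B (c s) b)"
      by (intro sum.cong refl, subst fun_space.representation_scale)
        (use B cV in auto)
    finally show "fun_space.representation B (F b) b
      = (\<Sum>s\<in>S. F b s * fun_space.representation B (c s) b)" .
  qed
  also have "\<dots> = (\<Sum>s\<in>S. \<Sum>b\<in>B. F b s * fun_space.representation B (c s) b)"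
    by (rule sum.swap)
  also have "\<dots> = (\<Sum>s\<in>S. F (c s) s)"
  proof (rule sum.cong[OF refl])
    fix s assume s: "s \<in> S"
    have "c s = (\<Sum>b\<in>B. fscale (fun_space.representation B (c s) b) b)"
      using fun_space.sum_representation_eq[OF B(1), of "c s" B] cV[OF s] finB B(2) by simp
    then have "F (c s) = F (\<Sum>b\<in>B. fscale (fun_space.representation B (c s) b) b)"
      by (rule arg_cong)
    also have "\<dots> = (\<Sum>b\<in>B. fscale (fun_space.representation B (c s) b) (F b))"
      by (rule Fsum)
    finally show "(\<Sum>b\<in>B. F b s * fun_space.representation B (c s) b) = F (c s) s"
      by (simp add: fun_sum_apply fscale_def mult.commute)
  qed
  finally show ?thesis by (simp add: c_def)
qed

definition idem_on :: "'s set \<Rightarrow> ('s \<Rightarrow> 's \<Rightarrow> complex) \<Rightarrow> bool" where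
  "idem_on S P \<longleftrightarrow> (\<forall>s\<in>S. \<forall>t\<in>S. (\<Sum>r\<in>S. P s r * P r t) = P s t)"

text \<open>\<open>P\<close> acts as the identity on its column space, so its trace is the dimension
  of that space; dimension 0 means that all columns vanish.\<close>

lemma idem_trace:
  fixes P :: "'s \<Rightarrow> 's \<Rightarrow> complex"
  assumes fin: "finite S" and idem: "idem_on S P"
  shows "\<exists>k::nat. (\<Sum>s\<in>S. P s s) = of_nat k \<and> (k = 0 \<longrightarrow> (\<forall>s\<in>S. \<forall>t\<in>S. P s t = 0))"
proof -
  define c where "c s = (\<lambda>t. if t \<in> S then P t s else 0)" for s
  define V where "V = fun_space.span (c ` S)"
  have fixed: "(\<forall>s. s \<notin> S \<longrightarrow> f s = 0) \<and> (\<forall>s\<in>S. f s = (\<Sum>s'\<in>S. P s s' * f s'))"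
    if "f \<in> V" for f
    using that unfolding V_def
  proof (induction rule: fun_space.span_induct_alt)
    case base
    then show ?case by simp
  next
    case (step r x y)
    then obtain s where s: "s \<in> S" "x = c s" by auto
    have "x t = (\<Sum>s'\<in>S. P t s' * x s')" if "t \<in> S" for t
      using idem that s unfolding idem_on_def c_def by auto
    then show ?case using step s
      by (auto simp: fscale_def c_def sum.distrib ring_distribs sum_distrib_left mult_ac)
  qed
  have tr: "trace_on V id = (\<Sum>s\<in>S. P s s)"
    by (subst trace_on_eq[OF fin, of V P id])
      (use fixed in \<open>auto simp: V_def c_def intro!: fun_space.span_base\<close>)
  define B where "B = (SOME B. fun_space.independent B \<and> fun_space.span B = V)"
  have "\<exists>B. fun_space.independent B \<and> fun_space.span B = V"
    using fun_space.basis_exists[of V] unfolding V_def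
    by (metis fun_space.span_subspace fun_space.subspace_span)
  then have B: "fun_space.independent B" "fun_space.span B = V"
    unfolding B_def by (metis (mono_tags, lifting) someI_ex)+
  have "trace_on V id = (\<Sum>b\<in>B. fun_space.representation B b b)"
    unfolding trace_on_def B_def[symmetric] Let_def by simp
  also have "\<dots> = (\<Sum>b\<in>B. 1)"
    by (intro sum.cong refl) (simp add: fun_space.representation_basis[OF B(1)])
  finally have k: "(\<Sum>s\<in>S. P s s) = of_nat (card B)" using tr by simp
  have finB: "finite B"
    using fun_space.independent_span_bound[of "c ` S" B] fin B fun_space.span_base unfolding V_def by blast
  have "P s t = 0" if "card B = 0" "s \<in> S" "t \<in> S" for s t
  proof -
    have "V = {0}" using that(1) finB B(2) by auto
    moreover have "c t \<in> V" using that unfolding V_def by (auto intro: fun_space.span_base)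
    ultimately have "c t s = 0" by (simp add: zero_fun_def)
    then show ?thesis using that by (simp add: c_def)
  qed
  then show ?thesis using k by blast
qed

section \<open>Tableaux as pairs of words\<close>

text \<open>A tabloid is encoded by the word that sends each letter to its row; letters outside \<open>X\<close> get
  the value 0. A second word records the columns, and the two words come from a tableau iff the pair is a
  bijection onto the diagram.\<close>

definition words :: "'a set \<Rightarrow> (nat \<Rightarrow> nat) \<Rightarrow> ('a \<Rightarrow> nat) set" where
  "words X c = {w. (\<forall>x. x \<notin> X \<longrightarrow> w x = 0) \<and> (\<forall>i. card {x\<in>X. w x = i} = c i)}"

lemma finite_words: assumes "finite X" shows "finite (words X c)"
proof (cases "words X c = {}")
  case False
  then obtain w0 where w0: "w0 \<in> words X c" by auto
  have "words X c \<subseteq> {f. \<forall>x. (x \<in> X \<longrightarrow> f x \<in> w0 ` X) \<and> (x \<notin> X \<longrightarrow> f x = 0)}"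
  proof clarify
    fix w x assume w: "w \<in> words X c"
    \<comment> \<open>The prescribed fibre sizes force \<open>w\<close> to take only values that the
      fixed word \<open>w0\<close> takes.\<close>
    have "w x \<in> w0 ` X" if x: "x \<in> X"
    proof -
      have "card {y\<in>X. w y = w x} \<noteq> 0" using assms x by auto
      then have "card {y\<in>X. w0 y = w x} \<noteq> 0" using w w0 by (auto simp: words_def)
      then have "{y\<in>X. w0 y = w x} \<noteq> {}" by force
      then show ?thesis by force
    qed
    then show "(x \<in> X \<longrightarrow> w x \<in> w0 ` X) \<and> (x \<notin> X \<longrightarrow> w x = 0)" using w by (auto simp: words_def)
  qed
  then show ?thesis
    using finite_set_of_finite_funs[of X "w0 ` X" 0] assms finite_subset by blast
qed simp

lemma words_comp:
  assumes "g permutes X" "w \<in> words X c" shows "w \<circ> g \<in> words X c"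
proof -
  have "card {x\<in>X. (w \<circ> g) x = i} = card {x\<in>X. w x = i}" for i
  proof -
    have "g ` {x\<in>X. (w \<circ> g) x = i} = {x\<in>X. w x = i}"
    proof (intro equalityI subsetI)
      fix y assume y: "y \<in> {x\<in>X. w x = i}"
      then have "inv g y \<in> X" "g (inv g y) = y"
        using permutes_in_image[OF permutes_inv[OF assms(1)], of y] permutes_inverses(1)[OF assms(1)] by auto
      then show "y \<in> g ` {x\<in>X. (w \<circ> g) x = i}" using y by (auto intro!: image_eqI[of _ _ "inv g y"])
    qed (auto simp: permutes_in_image[OF assms(1)])
    then show ?thesis
      using card_image[OF inj_on_subset[OF permutes_inj[OF assms(1)] subset_UNIV], of "{x\<in>X. (w \<circ> g) x = i}"] by simp
  qed
  then show ?thesis using assms permutes_not_in[OF assms(1)] by (auto simp: words_def)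
qed

lemma sum_words_comp:
  assumes "g permutes X"
  shows "(\<Sum>w\<in>words X c. f (w \<circ> g)) = (\<Sum>w\<in>words X c. f w)"
proof (rule sum.reindex_bij_witness[of _ "\<lambda>w. w \<circ> inv g" "\<lambda>w. w \<circ> g"])
  show "w \<circ> g \<circ> inv g = w" for w :: "'a \<Rightarrow> nat" using permutes_inv_o[OF assms] by (simp add: comp_assoc)
  show "w \<circ> inv g \<circ> g = w" for w :: "'a \<Rightarrow> nat" using permutes_inv_o[OF assms] by (simp add: comp_assoc)
  show "w \<circ> g \<in> words X c" if "w \<in> words X c" for w using words_comp[OF assms that] .
  show "w \<circ> inv g \<in> words X c" if "w \<in> words X c" for w using words_comp[OF permutes_inv[OF assms] that] .
qed simp

section \<open>Ferrers diagrams, dominance and Gale--Ryser\<close>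

definition ferrers :: "(nat \<times> nat) set \<Rightarrow> bool" where
  "ferrers D \<longleftrightarrow> finite D \<and> (\<forall>i j i' j'. (i, j) \<in> D \<longrightarrow> i' \<le> i \<longrightarrow> j' \<le> j \<longrightarrow> (i', j') \<in> D)"

definition rows :: "(nat \<times> nat) set \<Rightarrow> nat \<Rightarrow> nat" where "rows D i = card {j. (i, j) \<in> D}"
definition cols :: "(nat \<times> nat) set \<Rightarrow> nat \<Rightarrow> nat" where "cols D j = card {i. (i, j) \<in> D}"
text \<open>These partial sums define the dominance order.\<close>

definition psum :: "(nat \<times> nat) set \<Rightarrow> nat \<Rightarrow> nat" where "psum D k = card {p\<in>D. fst p < k}"

lemma down_closed_nat:
  fixes S :: "nat set" assumes "finite S" "\<And>i i'. i \<in> S \<Longrightarrow> i' \<le> i \<Longrightarrow> i' \<in> S"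
  shows "S = {..<card S}"
proof -
  have "\<exists>m. S = {..<m}"
  proof (cases "S = {}")
    case False
    then have "S = {..<Suc (Max S)}" using assms(2)[OF Max_in[OF assms(1)]] Max_ge[OF assms(1)]
      by (auto simp: less_Suc_eq_le)
    then show ?thesis by blast
  qed auto
  then show ?thesis by auto
qed

lemma ferrers_finite: "ferrers D \<Longrightarrow> finite D" by (simp add: ferrers_def)

lemma ferrers_finite_row: assumes "ferrers D" shows "finite {j. (i, j) \<in> D}"
proof (rule finite_subset)
  show "{j. (i, j) \<in> D} \<subseteq> snd ` D" by (auto intro: image_eqI[of _ snd "(i, _)"])
qed (simp add: ferrers_finite[OF assms])

lemma ferrers_finite_col: assumes "ferrers D" shows "finite {i. (i, j) \<in> D}"
proof (rule finite_subset)
  show "{i. (i, j) \<in> D} \<subseteq> fst ` D" by (auto intro: image_eqI[of _ fst "(_, j)"])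
qed (simp add: ferrers_finite[OF assms])

lemma ferrers_rows: assumes "ferrers D" shows "(i, j) \<in> D \<longleftrightarrow> j < rows D i"
proof -
  have "j' \<in> {j. (i, j) \<in> D}" if "j \<in> {j. (i, j) \<in> D}" "j' \<le> j" for j j'
    using that assms unfolding ferrers_def by blast
  from down_closed_nat[OF ferrers_finite_row[OF assms] this]
  have "{j. (i, j) \<in> D} = {..<rows D i}" by (simp add: rows_def)
  then show ?thesis by auto
qed

lemma ferrers_cols: assumes "ferrers D" shows "(i, j) \<in> D \<longleftrightarrow> i < cols D j"
proof -
  have "i' \<in> {i. (i, j) \<in> D}" if "i \<in> {i. (i, j) \<in> D}" "i' \<le> i" for i i'
    using that assms unfolding ferrers_def by blast
  from down_closed_nat[OF ferrers_finite_col[OF assms] this]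
  have "{i. (i, j) \<in> D} = {..<cols D j}" by (simp add: cols_def)
  then show ?thesis by auto
qed

lemma psum_rows: assumes "ferrers D" shows "psum D k = (\<Sum>i<k. rows D i)"
proof -
  have "{p\<in>D. fst p < k} = Sigma {..<k} (\<lambda>i. {j. (i, j) \<in> D})" by auto
  then show ?thesis
    unfolding psum_def rows_def using ferrers_finite_row[OF assms] by (simp add: card_SigmaI)
qed

text \<open>Column \<open>j\<close> has \<open>min k (cols D j)\<close> cells in the first
  \<open>k\<close> rows, the largest number that any 0-1 matrix with these column sums can have
  there.\<close>

lemma psum_cols: assumes "ferrers D" shows "psum D k = (\<Sum>j\<in>snd ` D. min k (cols D j))"
proof -
  have "{p\<in>D. fst p < k} = (\<lambda>(j,i). (i,j)) ` Sigma (snd ` D) (\<lambda>j. {..<min k (cols D j)})"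
    using ferrers_cols[OF assms] by (force simp: image_iff)
  moreover have "inj_on (\<lambda>(j,i). (i,j)) (Sigma (snd ` D) (\<lambda>j. {..<min k (cols D j)}))"
    by (auto simp: inj_on_def)
  ultimately show ?thesis
    unfolding psum_def using assms by (simp add: card_image card_SigmaI ferrers_finite)
qed

text \<open>Consecutive partial sums differ by a row length, so dominance in both directions leaves
  only one diagram.\<close>

lemma ferrers_eqI:
  assumes "ferrers D" "ferrers D'" "\<And>k. psum D k = psum D' k" shows "D = D'"
proof -
  have "rows D i = rows D' i" for i
    using assms(3)[of "Suc i"] assms(3)[of i] psum_rows[OF assms(1)] psum_rows[OF assms(2)] by simp
  then show ?thesis using ferrers_rows assms by auto
qed

text \<open>Gale--Ryser: an injective pair of words is a 0-1 matrix, and the row sums of a 0-1 matrix with column sums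
  \<open>cols D\<close> are dominated by \<open>rows D\<close>, with equality only for the matrix of \<open>D\<close> itself.\<close>

lemma gale_ryser_aux:
  assumes "finite X" "ferrers D" "v \<in> words X (cols D)" "inj_on (\<lambda>x. (w x, v x)) X"
  shows "card {x\<in>X. w x < k} = (\<Sum>j\<in>snd ` D. card {x\<in>X. w x < k \<and> v x = j})"
    and "card {x\<in>X. w x < k \<and> v x = j} \<le> min k (cols D j)"
proof -
  have "v x \<in> snd ` D" if "x \<in> X" for x
  proof -
    have "card {y\<in>X. v y = v x} \<noteq> 0" using that assms(1) by auto
    then have "cols D (v x) \<noteq> 0" using assms(3) by (auto simp: words_def)
    then show ?thesis using ferrers_cols[OF assms(2), of 0 "v x"] by force
  qed
  then have "{x\<in>X. w x < k} = (\<Union>j\<in>snd ` D. {x\<in>X. w x < k \<and> v x = j})" by auto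
  also have "card \<dots> = (\<Sum>j\<in>snd ` D. card {x\<in>X. w x < k \<and> v x = j})"
    by (rule card_UN_disjoint) (use assms in \<open>auto simp: ferrers_finite\<close>)
  finally show "card {x\<in>X. w x < k} = (\<Sum>j\<in>snd ` D. card {x\<in>X. w x < k \<and> v x = j})" .
  have "card {x\<in>X. w x < k \<and> v x = j} \<le> card {x\<in>X. v x = j}"
    by (rule card_mono) (use assms in auto)
  moreover have "card {x\<in>X. w x < k \<and> v x = j} \<le> card {..<k}"
    by (rule card_inj_on_le[of w]) (use assms(4) in \<open>auto simp: inj_on_def\<close>)
  ultimately show "card {x\<in>X. w x < k \<and> v x = j} \<le> min k (cols D j)"
    using assms(3) by (auto simp: words_def)
qed

lemma gale_ryser:
  assumes "finite X" "ferrers D" "v \<in> words X (cols D)" "inj_on (\<lambda>x. (w x, v x)) X"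
  shows "card {x\<in>X. w x < k} \<le> psum D k"
  unfolding psum_cols[OF assms(2)] gale_ryser_aux(1)[OF assms]
  by (intro sum_mono gale_ryser_aux(2)[OF assms])

lemma card_words_less:
  assumes "finite X" "w \<in> words X c" shows "card {x\<in>X. w x < k} = (\<Sum>i<k. c i)"
proof -
  have "{x\<in>X. w x < k} = (\<Union>i<k. {x\<in>X. w x = i})" by auto
  also have "card \<dots> = (\<Sum>i<k. card {x\<in>X. w x = i})"
    by (rule card_UN_disjoint) (use assms in auto)
  finally show ?thesis using assms by (simp add: words_def)
qed

lemma gale_ryser_eq:
  assumes "finite X" "ferrers D" "card X = card D" "v \<in> words X (cols D)" "w \<in> words X (rows D)"
    "inj_on (\<lambda>x. (w x, v x)) X"
  shows "bij_betw (\<lambda>x. (w x, v x)) X D"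
proof -
  note aux = gale_ryser_aux[OF assms(1,2,4,6)]
  have "(w x, v x) \<in> D" if x: "x \<in> X" for x
  proof -
    define j where "j = v x"
    \<comment> \<open>With \<open>k\<close> the height of column \<open>j\<close>, the termwise
      bound \<open>min k (cols D j)\<close> is the whole column, so equality of the sums puts every
      entry of the column into the first \<open>k\<close> rows.\<close>
    define k where "k = cols D j"
    have "(\<Sum>j\<in>snd ` D. card {x\<in>X. w x < k \<and> v x = j}) = (\<Sum>j\<in>snd ` D. min k (cols D j))"
      using card_words_less[OF assms(1,5), of k] psum_rows[OF assms(2), of k] psum_cols[OF assms(2), of k] aux(1)
      by simp
    moreover have "card {x\<in>X. v x = j} = cols D j" using assms(4) by (auto simp: words_def)
    moreover have "{y\<in>X. v y = j} \<noteq> {}" "finite {y\<in>X. v y = j}" using x assms(1) by (auto simp: j_def)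
    ultimately have kpos: "k > 0" unfolding k_def by (metis card_gt_0_iff)
    then have "j \<in> snd ` D" using ferrers_cols[OF assms(2), of 0 j] by (force simp: k_def)
    then have "card {x\<in>X. w x < k \<and> v x = j} = min k (cols D j)"
      using sum_mono_inv[OF \<open>(\<Sum>j\<in>snd ` D. _ j) = _\<close> aux(2)] assms(2) by (auto simp: ferrers_finite)
    also have "\<dots> = card {x\<in>X. v x = j}" using assms(4) by (auto simp: words_def k_def)
    finally have "{x\<in>X. w x < k \<and> v x = j} = {x\<in>X. v x = j}"
      by (intro card_subset_eq) (use assms in auto)
    then have "w x < k" using x by (auto simp: j_def)
    then show ?thesis using ferrers_cols[OF assms(2)] by (simp add: k_def j_def)
  qed
  then have "(\<lambda>x. (w x, v x)) ` X \<subseteq> D" by auto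
  moreover have "card ((\<lambda>x. (w x, v x)) ` X) = card D" using assms by (simp add: card_image)
  ultimately show ?thesis using assms(2,6) card_subset_eq[of D] by (auto simp: bij_betw_def ferrers_finite)
qed

section \<open>The signed matrix of fillings and its uniqueness\<close>

definition refb :: "(nat \<times> nat) set \<Rightarrow> 'a set \<Rightarrow> nat \<times> nat \<Rightarrow> 'a" where
  "refb D X = (SOME t. bij_betw t D X)"

definition pairperm :: "(nat \<times> nat) set \<Rightarrow> 'a set \<Rightarrow> ('a \<Rightarrow> nat) \<Rightarrow> ('a \<Rightarrow> nat) \<Rightarrow> 'a \<Rightarrow> 'a" where
  "pairperm D X v w = (\<lambda>x. if x \<in> X then refb D X (w x, v x) else x)"

text \<open>The sign is taken relative to the arbitrary filling \<open>refb D X\<close>. Up to a global sign, \<open>kmat D X v\<close>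
  is the polytabloid of every tableau with column word \<open>v\<close>.\<close>

definition kmat :: "(nat \<times> nat) set \<Rightarrow> 'a set \<Rightarrow> ('a \<Rightarrow> nat) \<Rightarrow> ('a \<Rightarrow> nat) \<Rightarrow> real" where
  "kmat D X v w = (if bij_betw (\<lambda>x. (w x, v x)) X D then of_int (sign (pairperm D X v w)) else 0)"

lemma refb: assumes "bij_betw p X D" shows "bij_betw (refb D X) D X"
  unfolding refb_def by (rule someI[of "\<lambda>t. bij_betw t D X", OF bij_betw_inv_into[OF assms]])

lemma pairperm_permutes:
  assumes "bij_betw (\<lambda>x. (w x, v x)) X D" shows "pairperm D X v w permutes X"
proof (rule bij_imp_permutes)
  have "bij_betw (refb D X \<circ> (\<lambda>x. (w x, v x))) X X"
    by (rule bij_betw_trans[OF assms refb[OF assms]])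
  then show "bij_betw (pairperm D X v w) X X"
    by (rule bij_betw_cong[THEN iffD1, rotated]) (auto simp: pairperm_def)
qed (simp add: pairperm_def)

lemma bij_pair_comp:
  assumes "g permutes X"
  shows "bij_betw (\<lambda>x. ((w \<circ> g) x, (v \<circ> g) x)) X D \<longleftrightarrow> bij_betw (\<lambda>x. (w x, v x)) X D"
  using bij_betw_comp_iff[OF permutes_imp_bij[OF assms], of "\<lambda>x. (w x, v x)" D] by (simp add: comp_def)

text \<open>Such matrices intertwine the permutation module on row words with the sign twist of the
  one on column words.\<close>

definition twisted :: "'a set \<Rightarrow> (('a \<Rightarrow> nat) \<Rightarrow> ('a \<Rightarrow> nat) \<Rightarrow> real) \<Rightarrow> bool" where
  "twisted X F \<longleftrightarrow> (\<forall>g v w. g permutes X \<longrightarrow> F (v \<circ> g) (w \<circ> g) = of_int (sign g) * F v w)"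

lemma twisted_kmat: assumes "finite X" shows "twisted X (kmat D X)"
  unfolding twisted_def
proof (intro allI impI)
  fix g v w assume g: "g permutes X"
  show "kmat D X (v \<circ> g) (w \<circ> g) = of_int (sign g) * kmat D X v w"
  proof (cases "bij_betw (\<lambda>x. (w x, v x)) X D")
    case True
    have eq: "pairperm D X (v \<circ> g) (w \<circ> g) = pairperm D X v w \<circ> g"
      using permutes_in_image[OF g] permutes_not_in[OF g] by (auto simp: pairperm_def fun_eq_iff)
    show ?thesis
      using True bij_pair_comp[OF g, of w v D] sign_compose[of "pairperm D X v w" g]
        permutes_imp_permutation[OF assms g] permutes_imp_permutation[OF assms pairperm_permutes[OF True]]
      by (simp add: kmat_def eq)
  next
    case False
    then show ?thesis using bij_pair_comp[OF g, of w v D] by (simp add: kmat_def)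
  qed
qed

text \<open>Two letters with equal values in both words can be exchanged without changing
  \<open>v\<close> or \<open>w\<close>, but the transposition has sign -1.\<close>

lemma twisted_inj:
  assumes "twisted X F" "F v w \<noteq> 0" shows "inj_on (\<lambda>x. (w x, v x)) X"
proof (rule inj_onI, rule ccontr)
  fix x y assume xy: "x \<in> X" "y \<in> X" "(w x, v x) = (w y, v y)" "x \<noteq> y"
  let ?g = "transpose x y"
  have "w \<circ> ?g = w" "v \<circ> ?g = v" using xy by (auto simp: fun_eq_iff transpose_def)
  moreover have "?g permutes X" using xy by (simp add: permutes_swap_id)
  ultimately have "F v w = of_int (sign ?g) * F v w" using assms(1) unfolding twisted_def by metis
  then show False using assms(2) xy by (simp add: sign_swap_id)
qed

lemma words_of_bij:
  assumes "bij_betw s X D"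
  defines "w \<equiv> \<lambda>x. if x \<in> X then fst (s x) else 0" and "v \<equiv> \<lambda>x. if x \<in> X then snd (s x) else 0"
  shows "w \<in> words X (rows D)" "v \<in> words X (cols D)" "bij_betw (\<lambda>x. (w x, v x)) X D"
proof -
  show b: "bij_betw (\<lambda>x. (w x, v x)) X D"
    using assms(1) by (rule bij_betw_cong[THEN iffD1, rotated]) (auto simp: w_def v_def)
  have "card {x\<in>X. w x = i} = card {j. (i, j) \<in> D}" for i
    by (rule bij_betw_same_card[of v]) (use b in \<open>auto simp: bij_betw_def inj_on_def image_iff\<close>)
  then show "w \<in> words X (rows D)" by (auto simp: words_def rows_def w_def)
  have "card {x\<in>X. v x = i} = card {j. (j, i) \<in> D}" for i
    by (rule bij_betw_same_card[of w]) (use b in \<open>auto simp: bij_betw_def inj_on_def image_iff\<close>)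
  then show "v \<in> words X (cols D)" by (auto simp: words_def cols_def v_def)
qed

lemma kmat_ne0: "bij_betw (\<lambda>x. (w x, v x)) X D \<Longrightarrow> kmat D X v w \<noteq> 0"
  by (simp add: kmat_def)

lemma ex_kmat_ne0:
  assumes "finite X" "finite D" "card X = card D"
  obtains v w where "v \<in> words X (cols D)" "w \<in> words X (rows D)" "bij_betw (\<lambda>x. (w x, v x)) X D"
proof -
  obtain s where "bij_betw s X D" using finite_same_card_bij[OF assms] by blast
  from words_of_bij[OF this] show thesis using that by blast
qed

text \<open>\<open>g\<close> sends a letter to the one that occupies the same cell in the other
  filling; \<open>out\<close> settles the letters outside \<open>X\<close>, which \<open>g\<close>
  fixes.\<close>

lemma pair_transitive:
  assumes b: "bij_betw (\<lambda>x. (w x, v x)) X D" and b0: "bij_betw (\<lambda>x. (w0 x, v0 x)) X D"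
    and out: "\<And>x. x \<notin> X \<Longrightarrow> w x = w0 x \<and> v x = v0 x"
  obtains g where "g permutes X" "w = w0 \<circ> g" "v = v0 \<circ> g"
proof -
  define g where "g = (\<lambda>x. if x \<in> X then inv_into X (\<lambda>x. (w0 x, v0 x)) (w x, v x) else x)"
  have "bij_betw (inv_into X (\<lambda>x. (w0 x, v0 x)) \<circ> (\<lambda>x. (w x, v x))) X X"
    by (rule bij_betw_trans[OF b bij_betw_inv_into[OF b0]])
  then have "bij_betw g X X"
    by (rule bij_betw_cong[THEN iffD1, rotated]) (auto simp: g_def)
  then have g: "g permutes X" by (rule bij_imp_permutes) (simp add: g_def)
  have p: "(w0 (g x), v0 (g x)) = (w x, v x)" if "x \<in> X" for x
    using that f_inv_into_f[of "(w x, v x)" "\<lambda>x. (w0 x, v0 x)" X] b0 b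
    by (auto simp: g_def bij_betw_def)
  have "w = w0 \<circ> g \<and> v = v0 \<circ> g"
    using p out permutes_not_in[OF g] by (auto simp: fun_eq_iff) (metis)+
  then show thesis using that g by blast
qed

text \<open>A nonzero value requires distinct pairs \<open>(w x, v x)\<close>, hence a filling of
  \<open>D\<close> by the equality case of Gale--Ryser. The fillings form a single orbit, so one
  value determines all the others.\<close>

lemma twisted_unique:
  assumes X: "finite X" "card X = card D" and D: "ferrers D" and F: "twisted X F"
  shows "\<exists>a. \<forall>v\<in>words X (cols D). \<forall>w\<in>words X (rows D). F v w = a * kmat D X v w"
proof -
  have "finite D" using D by (simp add: ferrers_def)
  then obtain v0 w0 where 0: "v0 \<in> words X (cols D)" "w0 \<in> words X (rows D)"
      "bij_betw (\<lambda>x. (w0 x, v0 x)) X D"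
    using ex_kmat_ne0[of X D] X by metis
  define a where "a = F v0 w0 / kmat D X v0 w0"
  show ?thesis
  proof (intro exI[of _ a] ballI)
    fix v w assume v: "v \<in> words X (cols D)" and w: "w \<in> words X (rows D)"
    show "F v w = a * kmat D X v w"
    proof (cases "inj_on (\<lambda>x. (w x, v x)) X")
      case False
      then show ?thesis using twisted_inj[OF F] by (auto simp: kmat_def bij_betw_def)
    next
      case True
      have b: "bij_betw (\<lambda>x. (w x, v x)) X D" by (rule gale_ryser_eq[OF X(1) D X(2) v w True])
      obtain g where g: "g permutes X" and "w = w0 \<circ> g" "v = v0 \<circ> g"
        by (rule pair_transitive[OF b 0(3)]) (use v w 0 in \<open>auto simp: words_def\<close>)
      then show ?thesis
        using F twisted_kmat[OF X(1), of D] g kmat_ne0[OF 0(3)] by (simp add: twisted_def a_def)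
    qed
  qed
qed

section \<open>Schur orthogonality\<close>

text \<open>By \<open>twisted_unique\<close> the matrix \<open>Q = K\<^sup>T K\<close> satisfies \<open>Q Q = c Q\<close>, so \<open>E = Q / c\<close> is the
  orthogonal projection of the tabloid module on the Specht module.\<close>

definition qmat :: "(nat \<times> nat) set \<Rightarrow> 'a set \<Rightarrow> ('a \<Rightarrow> nat) \<Rightarrow> ('a \<Rightarrow> nat) \<Rightarrow> real" where
  "qmat D X w w' = (\<Sum>v\<in>words X (cols D). kmat D X v w * kmat D X v w')"

definition kconst :: "(nat \<times> nat) set \<Rightarrow> 'a set \<Rightarrow> real" where
  "kconst D X = (SOME c. \<forall>v\<in>words X (cols D). \<forall>w\<in>words X (rows D).
     (\<Sum>w'\<in>words X (rows D). kmat D X v w' * qmat D X w' w) = c * kmat D X v w)"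

definition emat :: "(nat \<times> nat) set \<Rightarrow> 'a set \<Rightarrow> ('a \<Rightarrow> nat) \<Rightarrow> ('a \<Rightarrow> nat) \<Rightarrow> real" where
  "emat D X w w' = qmat D X w w' / kconst D X"

definition edim :: "(nat \<times> nat) set \<Rightarrow> 'a set \<Rightarrow> real" where
  "edim D X = (\<Sum>w\<in>words X (rows D). emat D X w w)"

locale ferrers_diagram =
  fixes D :: "(nat \<times> nat) set" and X :: "'a set"
  assumes D: "ferrers D" and X: "finite X" and card: "card X = card D"
begin

abbreviation "W \<equiv> words X (rows D)"
abbreviation "V \<equiv> words X (cols D)"
abbreviation "K \<equiv> kmat D X"
abbreviation "Q \<equiv> qmat D X"
abbreviation "E \<equiv> emat D X"

lemma fin[simp]: "finite W" "finite V" using X by (simp_all add: finite_words)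

lemma K_comp: "g permutes X \<Longrightarrow> K (v \<circ> g) (w \<circ> g) = of_int (sign g) * K v w"
  using twisted_kmat[OF X] by (simp add: twisted_def)

lemma Q_comp: assumes "g permutes X" shows "Q (w \<circ> g) (w' \<circ> g) = Q w w'"
proof -
  have "Q (w \<circ> g) (w' \<circ> g) = (\<Sum>v\<in>V. K (v \<circ> g) (w \<circ> g) * K (v \<circ> g) (w' \<circ> g))"
    unfolding qmat_def by (rule sum_words_comp[OF assms, symmetric])
  also have "\<dots> = Q w w'"
    unfolding qmat_def by (intro sum.cong refl) (use sign_idempotent[of g] in
      \<open>simp add: K_comp[OF assms] mult_ac flip: of_int_mult\<close>)
  finally show ?thesis .
qed

lemma Q_sym: "Q w w' = Q w' w" unfolding qmat_def by (simp add: mult.commute)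

text \<open>Multiplying \<open>K\<close> by the invariant matrix \<open>Q\<close> keeps it twisted,
  so \<open>twisted_unique\<close> supplies the constant that \<open>kconst\<close> selects.\<close>

lemma kconst:
  assumes "v \<in> V" "w \<in> W"
  shows "(\<Sum>w'\<in>W. K v w' * Q w' w) = kconst D X * K v w"
proof -
  have "twisted X (\<lambda>v w. \<Sum>w'\<in>W. K v w' * Q w' w)"
    unfolding twisted_def
  proof (intro allI impI)
    fix g v w assume g: "g permutes X"
    have "(\<Sum>w'\<in>W. K (v \<circ> g) w' * Q w' (w \<circ> g)) = (\<Sum>w'\<in>W. K (v \<circ> g) (w' \<circ> g) * Q (w' \<circ> g) (w \<circ> g))"
      by (rule sum_words_comp[OF g, symmetric])
    then show "(\<Sum>w'\<in>W. K (v \<circ> g) w' * Q w' (w \<circ> g)) = of_int (sign g) * (\<Sum>w'\<in>W. K v w' * Q w' w)"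
      by (simp add: K_comp[OF g] Q_comp[OF g] sum_distrib_left mult.assoc)
  qed
  from someI_ex[OF twisted_unique[OF X card D this]] show ?thesis using assms unfolding kconst_def by blast
qed

lemma ex_pair: obtains v w where "v \<in> V" "w \<in> W" "K v w \<noteq> 0"
proof -
  obtain v w where "v \<in> V" "w \<in> W" "bij_betw (\<lambda>x. (w x, v x)) X D"
    by (rule ex_kmat_ne0[OF X ferrers_finite[OF D] card])
  then show thesis using that kmat_ne0 by blast
qed

lemma Q_diag_nonneg: "Q w w \<ge> 0" unfolding qmat_def by (intro sum_nonneg) simp

lemma Q_diag_pos: "v \<in> V \<Longrightarrow> K v w \<noteq> 0 \<Longrightarrow> Q w w > 0"
  unfolding qmat_def by (rule sum_pos2[of _ v]) (auto simp: zero_less_mult_iff linorder_neq_iff)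

lemma trace_Q_pos: "(\<Sum>w\<in>W. Q w w) > 0"
proof -
  obtain v w where "v \<in> V" "w \<in> W" "K v w \<noteq> 0" by (rule ex_pair)
  then show ?thesis by (intro sum_pos2[of _ w]) (auto simp: Q_diag_nonneg Q_diag_pos)
qed

lemma Q_Q: assumes "w \<in> W" "w' \<in> W" shows "(\<Sum>u\<in>W. Q w u * Q u w') = kconst D X * Q w w'"
proof -
  have "(\<Sum>u\<in>W. Q w u * Q u w') = (\<Sum>u\<in>W. \<Sum>v\<in>V. K v w * (K v u * Q u w'))"
    by (subst qmat_def) (simp add: sum_distrib_right mult.assoc)
  also have "\<dots> = (\<Sum>v\<in>V. K v w * (\<Sum>u\<in>W. K v u * Q u w'))"
    by (subst sum.swap) (simp add: sum_distrib_left)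
  also have "\<dots> = kconst D X * Q w w'"
    by (simp add: kconst assms qmat_def[of D X w w'] sum_distrib_left mult_ac)
  finally show ?thesis .
qed

text \<open>A diagonal entry of \<open>Q Q\<close> is a sum of squares. As \<open>Q\<close> has
  trace n!, the constant is n! divided by the dimension, the product of the hook lengths; its
  positivity lets it cancel from the final inequality.\<close>

lemma kconst_pos: "kconst D X > 0"
proof -
  obtain v w where vw: "v \<in> V" "w \<in> W" "K v w \<noteq> 0" by (rule ex_pair)
  have "(\<Sum>u\<in>W. Q w u * Q u w) > 0"
  proof (rule sum_pos2[of _ w])
    show "0 \<le> Q w u * Q u w" for u using Q_sym[of w u] by simp
  qed (use vw Q_diag_pos[OF vw(1,3)] in auto)
  then show ?thesis using Q_Q[OF vw(2,2)] Q_diag_pos[OF vw(1,3)] by (simp add: zero_less_mult_iff)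
qed

lemma E_comp: "g permutes X \<Longrightarrow> E (w \<circ> g) (w' \<circ> g) = E w w'"
  by (simp add: emat_def Q_comp)

lemma E_sym: "E w w' = E w' w" by (simp add: emat_def Q_sym)

lemma E_E: assumes "w \<in> W" "w' \<in> W" shows "(\<Sum>u\<in>W. E w u * E u w') = E w w'"
proof -
  have "(\<Sum>u\<in>W. E w u * E u w') = (\<Sum>u\<in>W. Q w u * Q u w') / (kconst D X * kconst D X)"
    by (simp add: emat_def sum_divide_distrib)
  then show ?thesis using Q_Q[OF assms] kconst_pos by (simp add: emat_def)
qed

lemma K_E: assumes "v \<in> V" "w \<in> W" shows "(\<Sum>u\<in>W. K v u * E u w) = K v w"
proof -
  have "(\<Sum>u\<in>W. K v u * E u w) = (\<Sum>u\<in>W. K v u * Q u w) / kconst D X"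
    by (simp add: emat_def sum_divide_distrib)
  then show ?thesis using kconst[OF assms] kconst_pos by simp
qed

lemma edim_pos: "edim D X > 0"
  using trace_Q_pos kconst_pos by (simp add: edim_def emat_def flip: sum_divide_distrib)

lemma E_E_comp:
  assumes "g permutes X" "w \<in> W" "w' \<in> W" shows "(\<Sum>u\<in>W. E w u * E (u \<circ> g) w') = E (w \<circ> g) w'"
proof -
  have "(\<Sum>u\<in>W. E w u * E (u \<circ> g) w') = (\<Sum>u\<in>W. E (w \<circ> g) (u \<circ> g) * E (u \<circ> g) w')"
    by (simp add: E_comp assms)
  also have "\<dots> = (\<Sum>u\<in>W. E (w \<circ> g) u * E u w')"
    by (rule sum_words_comp[OF assms(1), where f="\<lambda>u. E (w \<circ> g) u * E u w'"])
  finally show ?thesis using E_E[OF words_comp[OF assms(1,2)] assms(3)] by simp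
qed

end

text \<open>As a function of \<open>w1\<close> and \<open>u1\<close> this is an intertwiner of the two Specht modules; multiplying it by
  \<open>K\<close> from either side gives a twisted function, which Gale--Ryser forces to vanish or to be a multiple of \<open>K\<close>.\<close>

definition schur_sum where
  "schur_sum D D' X w1 w2 u1 u2 =
     (\<Sum>g | g permutes X. emat D X (w1 \<circ> g) w2 * emat D' X (u1 \<circ> g) u2)"

lemma sum_perm_comp_left:
  assumes "h permutes X"
  shows "(\<Sum>g | g permutes X. f (h \<circ> g)) = (\<Sum>g | g permutes X. f g)"
proof (rule sum.reindex_bij_witness[of _ "\<lambda>g. inv h \<circ> g" "\<lambda>g. h \<circ> g"])
  show "inv h \<circ> (h \<circ> g) = g" for g using permutes_inv_o[OF assms] by (metis comp_assoc id_comp)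
  show "h \<circ> (inv h \<circ> g) = g" for g using permutes_inv_o[OF assms] by (metis comp_assoc id_comp)
  show "h \<circ> g \<in> {g. g permutes X}" if "g \<in> {g. g permutes X}" for g
    using permutes_compose[of g X h] that assms by simp
  show "inv h \<circ> g \<in> {g. g permutes X}" if "g \<in> {g. g permutes X}" for g
    using permutes_compose[of g X "inv h"] that permutes_inv[OF assms] by simp
qed simp

context
  fixes D D' :: "(nat \<times> nat) set" and X :: "'a set"
  assumes "ferrers_diagram D X" and "ferrers_diagram D' X"
begin

interpretation A: ferrers_diagram D X by fact
interpretation B: ferrers_diagram D' X by fact

lemma schur_sum_comp:
  assumes h: "h permutes X" shows "schur_sum D D' X (w1 \<circ> h) w2 (u1 \<circ> h) u2 = schur_sum D D' X w1 w2 u1 u2"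
  unfolding schur_sum_def
  using sum_perm_comp_left[OF h, of "\<lambda>g. emat D X (w1 \<circ> g) w2 * emat D' X (u1 \<circ> g) u2"]
  by (simp add: comp_assoc)

lemma schur_sum_E:
  assumes "w1 \<in> A.W" "w2 \<in> A.W"
  shows "(\<Sum>w\<in>A.W. A.E w1 w * schur_sum D D' X w w2 u1 u2) = schur_sum D D' X w1 w2 u1 u2"
  unfolding schur_sum_def sum_distrib_left
  by (subst sum.swap) (use assms in \<open>simp add: A.E_E_comp flip: mult.assoc sum_distrib_right\<close>)

text \<open>The sum is fixed by the projection \<open>E\<close> on the left, and \<open>E\<close> is
  \<open>Q / kconst D X\<close>, so the sum can be recovered from its product with
  \<open>K\<close>.\<close>

lemma schur_sum_K:
  assumes "w1 \<in> A.W" "w2 \<in> A.W"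
  shows "schur_sum D D' X w1 w2 u1 u2 =
    (\<Sum>v\<in>A.V. A.K v w1 * (\<Sum>w\<in>A.W. A.K v w * schur_sum D D' X w w2 u1 u2)) / kconst D X"
proof -
  have "schur_sum D D' X w1 w2 u1 u2 = (\<Sum>w\<in>A.W. A.E w1 w * schur_sum D D' X w w2 u1 u2)"
    using schur_sum_E[OF assms] by simp
  also have "\<dots> = (\<Sum>w\<in>A.W. \<Sum>v\<in>A.V. A.K v w1 * (A.K v w * schur_sum D D' X w w2 u1 u2)) / kconst D X"
    by (simp add: emat_def qmat_def sum_distrib_right sum_divide_distrib mult.assoc)
  also have "\<dots> = (\<Sum>v\<in>A.V. A.K v w1 * (\<Sum>w\<in>A.W. A.K v w * schur_sum D D' X w w2 u1 u2)) / kconst D X"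
    by (subst sum.swap) (simp add: sum_distrib_left)
  finally show ?thesis .
qed

lemma schur_sum_twisted:
  "twisted X (\<lambda>v u. \<Sum>w\<in>A.W. A.K v w * schur_sum D D' X w w2 u u2)"
  unfolding twisted_def
proof (intro allI impI)
  fix g v u assume g: "g permutes X"
  have "(\<Sum>w\<in>A.W. A.K (v \<circ> g) w * schur_sum D D' X w w2 (u \<circ> g) u2)
    = (\<Sum>w\<in>A.W. A.K (v \<circ> g) (w \<circ> g) * schur_sum D D' X (w \<circ> g) w2 (u \<circ> g) u2)"
    by (rule sum_words_comp[OF g, symmetric])
  then show "(\<Sum>w\<in>A.W. A.K (v \<circ> g) w * schur_sum D D' X w w2 (u \<circ> g) u2) =
      of_int (sign g) * (\<Sum>w\<in>A.W. A.K v w * schur_sum D D' X w w2 u u2)"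
    by (simp add: schur_sum_comp[OF g] A.K_comp[OF g] sum_distrib_left mult.assoc)
qed

text \<open>If the sum is nonzero then so is its product with \<open>K\<close> for some column word
  \<open>v\<close>. This product is twisted, so \<open>u1\<close> and \<open>v\<close> separate the
  letters, and Gale--Ryser bounds the rows of \<open>D'\<close> by those of
  \<open>D\<close>.\<close>

lemma schur_sum_dominance:
  assumes "w1 \<in> A.W" "w2 \<in> A.W" "u1 \<in> B.W" "schur_sum D D' X w1 w2 u1 u2 \<noteq> 0"
  shows "psum D' k \<le> psum D k"
proof -
  have "\<exists>v\<in>A.V. (\<Sum>w\<in>A.W. A.K v w * schur_sum D D' X w w2 u1 u2) \<noteq> 0"
  proof (rule ccontr)
    assume "\<not> ?thesis"
    then show False using assms(4) schur_sum_K[OF assms(1,2), of u1 u2] by simp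
  qed
  then obtain v where v: "v \<in> A.V" "(\<Sum>w\<in>A.W. A.K v w * schur_sum D D' X w w2 u1 u2) \<noteq> 0" by blast
  have "inj_on (\<lambda>x. (u1 x, v x)) X"
    using twisted_inj[of X "\<lambda>v u. \<Sum>w\<in>A.W. A.K v w * schur_sum D D' X w w2 u u2" v u1] schur_sum_twisted v(2)
    by simp
  then have "card {x\<in>X. u1 x < k} \<le> psum D k"
    using gale_ryser[OF A.X A.D v(1), of u1 k] by simp
  moreover have "card {x\<in>X. u1 x < k} = psum D' k"
    unfolding psum_rows[OF B.D] by (rule card_words_less[OF A.X assms(3)])
  ultimately show ?thesis by simp
qed

end

lemma schur_sum_swap: "schur_sum D D' X w1 w2 u1 u2 = schur_sum D' D X u1 u2 w1 w2"
  by (simp add: schur_sum_def mult.commute)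

text \<open>The sum is symmetric in the two diagrams, so a nonzero value would give dominance in
  both directions.\<close>

theorem schur_sum_ne:
  assumes "ferrers_diagram D X" "ferrers_diagram D' X" "D \<noteq> D'"
    and "w1 \<in> words X (rows D)" "w2 \<in> words X (rows D)" "u1 \<in> words X (rows D')" "u2 \<in> words X (rows D')"
  shows "schur_sum D D' X w1 w2 u1 u2 = 0"
proof (rule ccontr)
  assume ne: "schur_sum D D' X w1 w2 u1 u2 \<noteq> 0"
  have "psum D' k \<le> psum D k" for k using schur_sum_dominance[OF assms(1,2,4-6) ne] .
  moreover have "psum D k \<le> psum D' k" for k
    using schur_sum_dominance[OF assms(2,1,6,7,4)] ne[unfolded schur_sum_swap[of D D']] .
  ultimately have "D = D'"
    using assms(1,2) by (intro ferrers_eqI antisym) (auto simp: ferrers_diagram_def)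
  then show False using assms(3) by simp
qed

context ferrers_diagram
begin

text \<open>For fixed \<open>w2\<close> and \<open>u2\<close> the product with \<open>K\<close> is
  twisted, hence a multiple \<open>a * K\<close>, and the sum itself is \<open>a * E w1 u1\<close>.
  Setting \<open>w1 = u1\<close> and summing determines \<open>a\<close>.\<close>

theorem schur_sum_eq:
  assumes "w1 \<in> W" "w2 \<in> W" "u1 \<in> W" "u2 \<in> W"
  shows "schur_sum D D X w1 w2 u1 u2 = fact (card D) / edim D X * E w1 u1 * E w2 u2"
proof -
  have this': "ferrers_diagram D X" by unfold_locales
  obtain a where a: "\<forall>v\<in>V. \<forall>u\<in>W. (\<Sum>w\<in>W. K v w * schur_sum D D X w w2 u u2) = a * K v u"
    using twisted_unique[OF X card D schur_sum_twisted[OF this' this', of w2 u2]] by (elim exE)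
  have A: "schur_sum D D X w w2 u u2 = a * E w u" if "w \<in> W" "u \<in> W" for w u
    using schur_sum_K[OF this' this' that(1) assms(2), of u u2] that
    by (simp add: a emat_def qmat_def sum_distrib_left mult_ac)
  have "a * edim D X = (\<Sum>w\<in>W. schur_sum D D X w w2 w u2)"
    by (simp add: A edim_def sum_distrib_left)
  also have "\<dots> = (\<Sum>g | g permutes X. \<Sum>w\<in>W. E (w \<circ> g) w2 * E (w \<circ> g) u2)"
    unfolding schur_sum_def by (rule sum.swap)
  also have "\<dots> = (\<Sum>g | g permutes X. \<Sum>w\<in>W. E w w2 * E w u2)"
  proof (rule sum.cong[OF refl])
    fix g assume "g \<in> {g. g permutes X}"
    then show "(\<Sum>w\<in>W. E (w \<circ> g) w2 * E (w \<circ> g) u2) = (\<Sum>w\<in>W. E w w2 * E w u2)"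
      using sum_words_comp[of g X "\<lambda>w. E w w2 * E w u2"] by simp
  qed
  also have "\<dots> = fact (card D) * E w2 u2"
    using E_E[OF assms(2,4)] card_permutations[OF card X] by (simp add: E_sym[of _ w2])
  finally show ?thesis using A[OF assms(1,3)] edim_pos by (simp add: field_simps)
qed

end

text \<open>The trace of \<open>g\<close> composed with the projection \<open>E\<close>, hence the
  character of the Specht module, here as a real number.\<close>

definition chi :: "(nat \<times> nat) set \<Rightarrow> 'a set \<Rightarrow> ('a \<Rightarrow> 'a) \<Rightarrow> real" where
  "chi D X g = (\<Sum>w\<in>words X (rows D). emat D X (w \<circ> g) w)"

text \<open>For symmetric \<open>D\<close> the matrix \<open>K\<close> maps the Specht module to itself and satisfies
  \<open>K g = sgn(g) g K\<close>; this is the trace of \<open>K g\<close>, the difference of the two characters of the alternating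
  group into which the character of the Specht module splits.\<close>

definition twisted_char :: "(nat \<times> nat) set \<Rightarrow> 'a set \<Rightarrow> ('a \<Rightarrow> 'a) \<Rightarrow> real" where
  "twisted_char D X g = (\<Sum>w\<in>words X (rows D). kmat D X (w \<circ> g) w)"

text \<open>This is the double trace of the Schur relations; there is no conjugation because the
  values are real.\<close>

lemma sum_chi_chi:
  assumes "ferrers_diagram D X" "ferrers_diagram D' X"
  shows "(\<Sum>g | g permutes X. chi D X g * chi D' X g) = (if D = D' then fact (card D) else 0)"
proof -
  interpret A: ferrers_diagram D X by fact
  interpret B: ferrers_diagram D' X by fact
  have "(\<Sum>g | g permutes X. chi D X g * chi D' X g) = (\<Sum>w\<in>A.W. \<Sum>u\<in>B.W. schur_sum D D' X w w u u)"
    unfolding chi_def schur_sum_def sum_product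
    by (subst sum.swap, intro sum.cong refl, rule sum.swap)
  also have "\<dots> = (if D = D' then fact (card D) else 0)"
  proof (cases "D = D'")
    case True
    have "(\<Sum>w\<in>A.W. \<Sum>u\<in>A.W. schur_sum D D X w w u u)
       = (\<Sum>w\<in>A.W. fact (card D) / edim D X * (\<Sum>u\<in>A.W. A.E w u * A.E u w))"
      by (simp add: A.schur_sum_eq sum_distrib_left mult.assoc A.E_sym)
    also have "\<dots> = fact (card D) / edim D X * edim D X"
      by (simp add: A.E_E edim_def sum_distrib_left)
    finally show ?thesis using True A.edim_pos by simp
  next
    case False
    then show ?thesis using schur_sum_ne[OF assms] by simp
  qed
  finally show ?thesis .
qed

lemma chi_conj:
  assumes "ferrers_diagram D X" "h permutes X"
  shows "chi D X (h \<circ> g \<circ> inv h) = chi D X g"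
proof -
  interpret ferrers_diagram D X by fact
  have "chi D X (h \<circ> g \<circ> inv h) = (\<Sum>w\<in>W. E (w \<circ> h \<circ> g \<circ> inv h) (w \<circ> h \<circ> inv h))"
    unfolding chi_def using permutes_inv_o[OF assms(2)] by (simp add: comp_assoc)
  also have "\<dots> = (\<Sum>w\<in>W. E (w \<circ> h \<circ> g) (w \<circ> h))"
    by (simp add: E_comp[OF permutes_inv[OF assms(2)]])
  also have "\<dots> = chi D X g"
    unfolding chi_def by (rule sum_words_comp[OF assms(2), where f="\<lambda>w. E (w \<circ> g) w"])
  finally show ?thesis .
qed

lemma twisted_char_conj:
  assumes "ferrers_diagram D X" "h permutes X"
  shows "twisted_char D X (h \<circ> g \<circ> inv h) = of_int (sign h) * twisted_char D X g"
proof -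
  interpret ferrers_diagram D X by fact
  have "twisted_char D X (h \<circ> g \<circ> inv h) = (\<Sum>w\<in>W. K (w \<circ> h \<circ> g \<circ> inv h) (w \<circ> h \<circ> inv h))"
    unfolding twisted_char_def using permutes_inv_o[OF assms(2)] by (simp add: comp_assoc)
  also have "\<dots> = of_int (sign h) * (\<Sum>w\<in>W. K (w \<circ> h \<circ> g) (w \<circ> h))"
    by (simp add: K_comp[OF permutes_inv[OF assms(2)]] sum_distrib_left
        sign_inverse[OF permutes_imp_permutation[OF X assms(2)]])
  also have "(\<Sum>w\<in>W. K (w \<circ> h \<circ> g) (w \<circ> h)) = twisted_char D X g"
    unfolding twisted_char_def by (rule sum_words_comp[OF assms(2), where f="\<lambda>w. K (w \<circ> g) w"])
  finally show ?thesis .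
qed

section \<open>Symmetric diagrams and the intertwiner with the sign twist\<close>

locale sym_diagram = ferrers_diagram +
  assumes sym: "\<And>i j. (i, j) \<in> D \<Longrightarrow> (j, i) \<in> D"
begin

lemma cols_eq_rows: "cols D = rows D"
  unfolding rows_def cols_def using sym by (intro ext arg_cong[where f=card]) auto

text \<open>The sign of the reflection of the reference filling in the diagonal, that is, -1 to the
  number of cells below the diagonal. It decides whether \<open>K\<close> is symmetric or
  antisymmetric.\<close>

definition ksgn :: real where
  "ksgn = of_int (sign (\<lambda>x. if x \<in> X then refb D X (prod.swap (inv_into D (refb D X) x)) else x))"

lemma ksgn: "ksgn = 1 \<or> ksgn = -1" unfolding ksgn_def by (cases rule: sign_cases) auto

lemma bij_swap: "bij_betw prod.swap D D"
  by (rule bij_betwI[of _ _ _ prod.swap]) (use sym in auto)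

lemma K_sym: "K w v = ksgn * K v w"
proof -
  have swap: "bij_betw (\<lambda>x. (v x, w x)) X D \<longleftrightarrow> bij_betw (\<lambda>x. (w x, v x)) X D" for v w
  proof -
    have "bij_betw (\<lambda>x. (v x, w x)) X D" if b: "bij_betw (\<lambda>x. (w x, v x)) X D" for v w
      using bij_betw_trans[OF b bij_swap] by (simp add: comp_def)
    then show ?thesis by blast
  qed
  show ?thesis
  proof (cases "bij_betw (\<lambda>x. (w x, v x)) X D")
    case b: True
    let ?t = "refb D X"
    define s where "s = (\<lambda>x. if x \<in> X then ?t (prod.swap (inv_into D ?t x)) else x)"
    have t: "bij_betw ?t D X" by (rule refb[OF b])
    have "bij_betw (?t \<circ> (prod.swap \<circ> inv_into D ?t)) X X"
      by (rule bij_betw_trans[OF bij_betw_trans[OF bij_betw_inv_into[OF t] bij_swap] t])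
    then have "bij_betw s X X"
      by (rule bij_betw_cong[THEN iffD1, rotated]) (auto simp: s_def)
    then have s: "s permutes X" by (rule bij_imp_permutes) (simp add: s_def)
    have "pairperm D X w v = s \<circ> pairperm D X v w"
    proof
      fix x
      show "pairperm D X w v x = (s \<circ> pairperm D X v w) x"
      proof (cases "x \<in> X")
        case True
        have "(w x, v x) \<in> D" using b True by (auto simp: bij_betw_def)
        moreover from this have "?t (w x, v x) \<in> X" using t by (auto simp: bij_betw_def)
        ultimately show ?thesis using True t
          by (simp add: pairperm_def s_def bij_betw_inv_into_left)
      qed (simp add: pairperm_def s_def)
    qed
    then have "sign (pairperm D X w v) = sign s * sign (pairperm D X v w)"
      using sign_compose permutes_imp_permutation[OF X s] permutes_imp_permutation[OF X pairperm_permutes[OF b]]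
      by metis
    then show ?thesis using b swap[of v w] unfolding kmat_def ksgn_def s_def by simp
  next
    case False
    then show ?thesis using swap[of v w] unfolding kmat_def by simp
  qed
qed

lemma E_K: assumes "v \<in> W" "w \<in> W" shows "(\<Sum>u\<in>W. E v u * K u w) = K v w"
proof -
  have "(\<Sum>u\<in>W. E v u * K u w) = ksgn * (\<Sum>u\<in>W. K w u * E u v)"
    by (simp add: E_sym[of v] K_sym[of _ w] sum_distrib_left mult_ac)
  also have "\<dots> = ksgn * K w v" using K_E assms by (simp add: cols_eq_rows)
  finally show ?thesis by (simp add: K_sym[of v w])
qed

lemma K_K: assumes "v \<in> W" "w \<in> W" shows "(\<Sum>u\<in>W. K v u * K u w) = ksgn * kconst D X * E v w"
proof -
  have "(\<Sum>u\<in>W. K v u * K u w) = ksgn * Q v w"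
    by (simp add: K_sym[of v] qmat_def cols_eq_rows sum_distrib_left mult_ac)
  then show ?thesis using kconst_pos by (simp add: emat_def)
qed

text \<open>Inserting \<open>E\<close> writes the trace as a combination of the matrix entries to
  which Schur orthogonality applies.\<close>

lemma twisted_char_alt:
  assumes "g permutes X"
  shows "twisted_char D X g = (\<Sum>w\<in>W. \<Sum>w'\<in>W. E (w \<circ> g) w' * K w' w)"
  unfolding twisted_char_def by (intro sum.cong refl E_K[symmetric] words_comp assms)

end

text \<open>For \<open>D = D'\<close> Schur orthogonality gives n! / dim times the sum of the
  squares of the entries of \<open>K\<close>. That sum is the trace of \<open>Q\<close>, which is
  \<open>kconst D X\<close> times the dimension.\<close>

lemma sum_twisted_char:
  assumes "sym_diagram D X" "sym_diagram D' X"
  shows "(\<Sum>g | g permutes X. twisted_char D X g * twisted_char D' X g) =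
    (if D = D' then fact (card D) * kconst D X else 0)"
proof -
  interpret A: sym_diagram D X by fact
  interpret B: sym_diagram D' X by fact
  have "(\<Sum>g | g permutes X. twisted_char D X g * twisted_char D' X g) =
    (\<Sum>g | g permutes X. \<Sum>(w,w')\<in>A.W\<times>A.W. \<Sum>(u,u')\<in>B.W\<times>B.W.
       A.K w' w * B.K u' u * (A.E (w \<circ> g) w' * B.E (u \<circ> g) u'))"
    by (intro sum.cong refl)
      (simp add: A.twisted_char_alt B.twisted_char_alt sum.cartesian_product sum_product case_prod_unfold mult_ac)
  also have "\<dots> = (\<Sum>(w,w')\<in>A.W\<times>A.W. \<Sum>(u,u')\<in>B.W\<times>B.W. A.K w' w * B.K u' u * schur_sum D D' X w w' u u')"
    unfolding schur_sum_def sum_distrib_left case_prod_unfold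
    by (subst sum.swap, intro sum.cong refl, rule sum.swap)
  also have "\<dots> = (if D = D' then fact (card D) * kconst D X else 0)"
  proof (cases "D = D'")
    case True
    define r where "r = fact (card D) / edim D X"
    have "(\<Sum>(w,w')\<in>A.W\<times>A.W. \<Sum>(u,u')\<in>A.W\<times>A.W. A.K w' w * A.K u' u * schur_sum D D X w w' u u')
      = (\<Sum>w\<in>A.W. \<Sum>w'\<in>A.W. \<Sum>u\<in>A.W. \<Sum>u'\<in>A.W. A.K w' w * A.K u' u * schur_sum D D X w w' u u')"
      unfolding sum.cartesian_product[symmetric] by (rule refl)
    also have "\<dots> = (\<Sum>w\<in>A.W. \<Sum>w'\<in>A.W. \<Sum>u\<in>A.W. \<Sum>u'\<in>A.W. r * A.K w' w * (A.E w' u' * A.K u' u * A.E u w))"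
      by (intro sum.cong refl) (simp add: A.schur_sum_eq r_def A.E_sym mult_ac)
    also have "\<dots> = (\<Sum>w\<in>A.W. \<Sum>w'\<in>A.W. r * A.K w' w * (\<Sum>u\<in>A.W. (\<Sum>u'\<in>A.W. A.E w' u' * A.K u' u) * A.E u w))"
      by (simp add: sum_distrib_left sum_distrib_right mult.assoc)
    also have "\<dots> = (\<Sum>w\<in>A.W. \<Sum>w'\<in>A.W. r * (A.K w' w * A.K w' w))"
      by (intro sum.cong refl) (simp add: A.E_K A.K_E A.cols_eq_rows)
    also have "\<dots> = r * (\<Sum>w\<in>A.W. A.Q w w)"
      by (simp add: qmat_def A.cols_eq_rows sum_distrib_left)
    also have "\<dots> = r * (kconst D X * edim D X)"
      using A.kconst_pos by (simp add: edim_def emat_def sum_distrib_left)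
    finally show ?thesis using True A.edim_pos by (simp add: r_def)
  next
    case False
    then show ?thesis
      using schur_sum_ne[OF A.ferrers_diagram_axioms B.ferrers_diagram_axioms]
      by (simp add: case_prod_unfold sum.neutral)
  qed
  finally show ?thesis .
qed

section \<open>Invariants and completeness of the characters\<close>

lemma idem_trace_real:
  fixes P :: "'s \<Rightarrow> 's \<Rightarrow> real"
  assumes fin: "finite S" and idem: "\<And>s t. s \<in> S \<Longrightarrow> t \<in> S \<Longrightarrow> (\<Sum>r\<in>S. P s r * P r t) = P s t"
  shows "\<exists>k::nat. (\<Sum>s\<in>S. P s s) = real k \<and> (k = 0 \<longrightarrow> (\<forall>s\<in>S. \<forall>t\<in>S. P s t = 0))"
proof -
  have "idem_on S (\<lambda>s t. complex_of_real (P s t))"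
    unfolding idem_on_def of_real_mult[symmetric] of_real_sum[symmetric] using idem by simp
  from idem_trace[OF fin this] obtain k :: nat where k: "(\<Sum>s\<in>S. complex_of_real (P s s)) = of_nat k"
    and k0: "k = 0 \<longrightarrow> (\<forall>s\<in>S. \<forall>t\<in>S. complex_of_real (P s t) = 0)" by blast
  have "complex_of_real (\<Sum>s\<in>S. P s s) = complex_of_real (real k)"
    using k unfolding of_real_sum by simp
  then show ?thesis using k0 unfolding of_real_eq_iff by auto
qed

text \<open>The action is on the right, as for words composed with permutations.
  \<open>act_sum\<close> says that each group element permutes \<open>S\<close>, in the form in
  which sums get reindexed.\<close>

locale perm_set_action =
  fixes X :: "'a set" and S :: "'s set" and act :: "('a \<Rightarrow> 'a) \<Rightarrow> 's \<Rightarrow> 's"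
  assumes finX: "finite X" and finS: "finite S"
    and act_in: "\<And>g s. g permutes X \<Longrightarrow> s \<in> S \<Longrightarrow> act g s \<in> S"
    and act_sum: "\<And>g (f :: 's \<Rightarrow> real). g permutes X \<Longrightarrow> (\<Sum>s\<in>S. f (act g s)) = (\<Sum>s\<in>S. f s)"
    and act_act: "\<And>g h s. act h (act g s) = act (g \<circ> h) s"
begin

definition equivariant :: "('s \<Rightarrow> 's \<Rightarrow> real) \<Rightarrow> bool" where
  "equivariant N \<longleftrightarrow> (\<forall>g s t. g permutes X \<longrightarrow> N (act g s) (act g t) = N s t)"

text \<open>The product of the averaging projection of the group with \<open>N\<close>. If
  \<open>N\<close> is an equivariant projection, this is the projection on the invariants in its
  image.\<close>

definition avg :: "('s \<Rightarrow> 's \<Rightarrow> real) \<Rightarrow> 's \<Rightarrow> 's \<Rightarrow> real" where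
  "avg N s t = (\<Sum>g | g permutes X. N (act g s) t) / fact (card X)"

lemma card_perms: "card {g. g permutes X} = fact (card X)"
  by (rule card_permutations) (use finX in auto)

text \<open>Equivariance lets the averaging projection pass through \<open>N\<close>, and averaging
  twice is averaging once.\<close>

lemma avg_mult:
  assumes "equivariant N" and prod: "\<And>s t. s \<in> S \<Longrightarrow> t \<in> S \<Longrightarrow> (\<Sum>r\<in>S. N s r * M r t) = L s t"
    and st: "s \<in> S" "t \<in> S"
  shows "(\<Sum>r\<in>S. avg N s r * avg M r t) = avg L s t"
proof -
  let ?G = "{g. g permutes X}"
  have inner: "(\<Sum>r\<in>S. N (act g s) r * M (act h r) t) = L (act (g \<circ> h) s) t"
    if "g permutes X" "h permutes X" for g h
  proof -
    have "(\<Sum>r\<in>S. N (act g s) r * M (act h r) t) = (\<Sum>r\<in>S. N (act (g \<circ> h) s) (act h r) * M (act h r) t)"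
      using assms(1) that(2) act_act unfolding equivariant_def by metis
    also have "\<dots> = (\<Sum>r\<in>S. N (act (g \<circ> h) s) r * M r t)"
      by (rule act_sum[OF that(2)])
    also have "\<dots> = L (act (g \<circ> h) s) t"
      by (intro prod act_in permutes_compose that st)
    finally show ?thesis .
  qed
  have "(\<Sum>r\<in>S. avg N s r * avg M r t) =
     (\<Sum>r\<in>S. \<Sum>g\<in>?G. \<Sum>h\<in>?G. N (act g s) r * M (act h r) t) / (fact (card X) * fact (card X))"
    by (simp add: avg_def sum_product sum_divide_distrib)
  also have "(\<Sum>r\<in>S. \<Sum>g\<in>?G. \<Sum>h\<in>?G. N (act g s) r * M (act h r) t)
      = (\<Sum>g\<in>?G. \<Sum>r\<in>S. \<Sum>h\<in>?G. N (act g s) r * M (act h r) t)"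
    by (rule sum.swap)
  also have "\<dots> = (\<Sum>g\<in>?G. \<Sum>h\<in>?G. \<Sum>r\<in>S. N (act g s) r * M (act h r) t)"
    by (rule sum.cong[OF refl], rule sum.swap)
  also have "\<dots> = (\<Sum>g\<in>?G. \<Sum>h\<in>?G. L (act (g \<circ> h) s) t)"
    by (intro sum.cong refl inner) auto
  also have "\<dots> = (\<Sum>g\<in>?G. \<Sum>h\<in>?G. L (act h s) t)"
  proof (rule sum.cong[OF refl])
    fix g assume "g \<in> ?G"
    then show "(\<Sum>h\<in>?G. L (act (g \<circ> h) s) t) = (\<Sum>h\<in>?G. L (act h s) t)"
      using sum_perm_comp_left[of g X "\<lambda>h. L (act h s) t"] by simp
  qed
  finally show ?thesis by (simp add: avg_def card_perms)
qed

lemma trace_avg: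
  "(\<Sum>s\<in>S. avg N s s) = (\<Sum>g | g permutes X. \<Sum>s\<in>S. N (act g s) s) / fact (card X)"
  unfolding avg_def sum_divide_distrib[symmetric] by (subst sum.swap) (rule refl)

lemma avg_trace_nat:
  assumes "equivariant N" "\<And>s t. s \<in> S \<Longrightarrow> t \<in> S \<Longrightarrow> (\<Sum>r\<in>S. N s r * N r t) = N s t"
  shows "\<exists>k::nat. (\<Sum>s\<in>S. avg N s s) = real k"
  using idem_trace_real[OF finS avg_mult[OF assms(1,2)]] by blast

text \<open>The two operators \<open>(N \<plusminus> Z) / 2\<close> are projections on the fixed space of the group, and the trace of a
  projection is a nonnegative integer.\<close>

lemma avg_involution_bound:
  assumes "equivariant N" "equivariant Z"
    and NN: "\<And>s t. s \<in> S \<Longrightarrow> t \<in> S \<Longrightarrow> (\<Sum>r\<in>S. N s r * N r t) = N s t"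
    and NZ: "\<And>s t. s \<in> S \<Longrightarrow> t \<in> S \<Longrightarrow> (\<Sum>r\<in>S. N s r * Z r t) = Z s t"
    and ZN: "\<And>s t. s \<in> S \<Longrightarrow> t \<in> S \<Longrightarrow> (\<Sum>r\<in>S. Z s r * N r t) = Z s t"
    and ZZ: "\<And>s t. s \<in> S \<Longrightarrow> t \<in> S \<Longrightarrow> (\<Sum>r\<in>S. Z s r * Z r t) = N s t"
  shows "\<bar>\<Sum>s\<in>S. avg Z s s\<bar> \<le> (\<Sum>s\<in>S. avg N s s)"
proof -
  have *: "0 \<le> (\<Sum>s\<in>S. avg N s s) + e * (\<Sum>s\<in>S. avg Z s s)" if e: "e = 1 \<or> e = -1" for e :: real
  proof -
    let ?P = "\<lambda>s t. (avg N s t + e * avg Z s t) / 2"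
    have "(\<Sum>r\<in>S. ?P s r * ?P r t) = ?P s t" if st: "s \<in> S" "t \<in> S" for s t
    proof -
      have "(\<Sum>r\<in>S. ?P s r * ?P r t) = ((\<Sum>r\<in>S. avg N s r * avg N r t) + e * (\<Sum>r\<in>S. avg N s r * avg Z r t)
          + e * (\<Sum>r\<in>S. avg Z s r * avg N r t) + (e * e) * (\<Sum>r\<in>S. avg Z s r * avg Z r t)) / 4"
        by (simp add: sum_distrib_left sum_divide_distrib algebra_simps sum.distrib add_divide_distrib)
      also have "\<dots> = ?P s t"
        using e by (auto simp: avg_mult[OF assms(1) NN st] avg_mult[OF assms(1) NZ st]
          avg_mult[OF assms(2) ZN st] avg_mult[OF assms(2) ZZ st])
      finally show ?thesis .
    qed
    from idem_trace_real[OF finS this] obtain k :: nat where "(\<Sum>s\<in>S. ?P s s) = real k" by blast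
    then have "(\<Sum>s\<in>S. ?P s s) \<ge> 0" by simp
    then show ?thesis
      by (simp add: sum.distrib sum_distrib_left flip: sum_divide_distrib)
  qed
  show ?thesis using *[of 1] *[of "-1"] by simp
qed

end

section \<open>Invariants in triple tensor products\<close>

definition tensor3 where
  "tensor3 A B C = (\<lambda>(a, b, c) (a', b', c'). A a a' * (B b b' * C c c') :: real)"

lemma sum_tensor3:
  "(\<Sum>(a, b, c)\<in>S1 \<times> S2 \<times> S3. f a * (g b * h c)) = sum f S1 * (sum g S2 * (sum h S3 :: real))"
proof -
  have "(\<Sum>(a, b, c)\<in>S1 \<times> S2 \<times> S3. f a * (g b * h c)) = (\<Sum>a\<in>S1. \<Sum>b\<in>S2. \<Sum>c\<in>S3. f a * (g b * h c))"
    unfolding sum.cartesian_product[symmetric] by (rule refl)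
  also have "\<dots> = (\<Sum>a\<in>S1. f a * (\<Sum>b\<in>S2. g b * (\<Sum>c\<in>S3. h c)))"
    by (simp only: sum_distrib_left)
  also have "\<dots> = (\<Sum>a\<in>S1. f a * (sum g S2 * sum h S3))"
    by (simp only: sum_distrib_right)
  finally show ?thesis by (simp only: sum_distrib_right)
qed

lemma tensor3_mult:
  "(\<Sum>r\<in>S1 \<times> S2 \<times> S3. tensor3 A B C (a, b, c) r * tensor3 A' B' C' r (a', b', c')) =
   (\<Sum>x\<in>S1. A a x * A' x a') * ((\<Sum>x\<in>S2. B b x * B' x b') * (\<Sum>x\<in>S3. C c x * C' x c'))"
  unfolding sum_tensor3[symmetric] by (intro sum.cong refl) (auto simp: tensor3_def)

lemma tensor3_trace:
  "(\<Sum>s\<in>S1 \<times> S2 \<times> S3. tensor3 A B C (case s of (a, b, c) \<Rightarrow> (p a, q b, r c)) s) =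
   (\<Sum>a\<in>S1. A (p a) a) * ((\<Sum>b\<in>S2. B (q b) b) * (\<Sum>c\<in>S3. C (r c) c))"
  unfolding sum_tensor3[symmetric] by (intro sum.cong refl) (auto simp: tensor3_def)

lemma perm_set_action_words:
  assumes "finite X"
  shows "perm_set_action X (words X c1 \<times> words X c2 \<times> words X c3) (\<lambda>g (a, b, c). (a \<circ> g, b \<circ> g, c \<circ> g))"
proof
  fix g and f :: "('a \<Rightarrow> nat) \<times> ('a \<Rightarrow> nat) \<times> ('a \<Rightarrow> nat) \<Rightarrow> real"
  assume g: "g permutes X"
  have "(\<Sum>a\<in>words X c1. \<Sum>b\<in>words X c2. \<Sum>c\<in>words X c3. f (a \<circ> g, b \<circ> g, c \<circ> g))
      = (\<Sum>a\<in>words X c1. \<Sum>b\<in>words X c2. \<Sum>c\<in>words X c3. f (a, b, c))"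
    by (simp add: sum_words_comp[OF g, where f="\<lambda>a. \<Sum>b\<in>words X c2. \<Sum>c\<in>words X c3. f (a, b, c)"]
       sum_words_comp[OF g, where f="\<lambda>b. \<Sum>c\<in>words X c3. f (_, b, c)"]
       sum_words_comp[OF g, where f="\<lambda>c. f (_, _, c)"])
  then show "(\<Sum>s\<in>words X c1 \<times> words X c2 \<times> words X c3. f (case s of (a, b, c) \<Rightarrow> (a \<circ> g, b \<circ> g, c \<circ> g)))
    = sum f (words X c1 \<times> words X c2 \<times> words X c3)"
    by (simp add: sum.cartesian_product case_prod_unfold)
qed (use assms in \<open>auto simp: finite_words words_comp comp_assoc\<close>)

text \<open>This is the trace of the projection on the invariants of the tensor product of three
  Specht modules.\<close>

lemma chi_triple_nat:
  assumes "ferrers_diagram D1 X" "ferrers_diagram D2 X" "ferrers_diagram D3 X"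
  shows "\<exists>k::nat. (\<Sum>g | g permutes X. chi D1 X g * chi D2 X g * chi D3 X g) / fact (card X) = real k"
proof -
  interpret A: ferrers_diagram D1 X by fact
  interpret B: ferrers_diagram D2 X by fact
  interpret C: ferrers_diagram D3 X by fact
  interpret P: perm_set_action X "A.W \<times> B.W \<times> C.W" "\<lambda>g (a, b, c). (a \<circ> g, b \<circ> g, c \<circ> g)"
    by (rule perm_set_action_words[OF A.X])
  let ?N = "tensor3 A.E B.E C.E"
  have "P.equivariant ?N"
    by (auto simp: P.equivariant_def tensor3_def A.E_comp B.E_comp C.E_comp)
  moreover have "(\<Sum>r\<in>A.W \<times> B.W \<times> C.W. ?N s r * ?N r t) = ?N s t"
    if "s \<in> A.W \<times> B.W \<times> C.W" "t \<in> A.W \<times> B.W \<times> C.W" for s t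
    using that by (cases s; cases t) (simp add: tensor3_mult A.E_E B.E_E C.E_E, simp add: tensor3_def)
  ultimately obtain k :: nat where "(\<Sum>s\<in>A.W \<times> B.W \<times> C.W. P.avg ?N s s) = real k"
    using P.avg_trace_nat by blast
  then show ?thesis
    unfolding P.trace_avg tensor3_trace chi_def mult.assoc by blast
qed

theorem chi_twisted_char_bound:
  assumes "ferrers_diagram L X" "sym_diagram D X"
  shows "\<bar>\<Sum>g | g permutes X. chi L X g * (twisted_char D X g)\<^sup>2\<bar>
    \<le> kconst D X * (\<Sum>g | g permutes X. chi L X g * chi D X g * chi D X g)"
proof -
  interpret A: ferrers_diagram L X by fact
  interpret B: sym_diagram D X by fact
  interpret P: perm_set_action X "A.W \<times> B.W \<times> B.W" "\<lambda>g (a, b, c). (a \<circ> g, b \<circ> g, c \<circ> g)"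
    by (rule perm_set_action_words[OF A.X])
  let ?c = "kconst D X"
  define N where "N = tensor3 A.E B.E B.E"
  \<comment> \<open>Each factor \<open>K\<close> squares to \<open>kconst D X\<close> times
    \<open>E\<close> up to sign. Dividing only one of the two by the constant makes \<open>Z\<close>
    square to \<open>N\<close> without a square root.\<close>
  define Z where "Z = tensor3 A.E B.K (\<lambda>u v. B.K u v / ?c)"
  have c: "?c > 0" by (rule B.kconst_pos)
  have "P.equivariant N"
    by (auto simp: P.equivariant_def N_def tensor3_def A.E_comp B.E_comp)
  \<comment> \<open>Both factors \<open>K\<close> contribute the sign of \<open>g\<close>, so the
    signs cancel.\<close>
  moreover have "P.equivariant Z"
    unfolding P.equivariant_def
  proof (intro allI impI)
    fix g and s t :: "('a \<Rightarrow> nat) \<times> ('a \<Rightarrow> nat) \<times> ('a \<Rightarrow> nat)"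
    assume g: "g permutes X"
    obtain a b d a' b' d' where eq: "s = (a, b, d)" "t = (a', b', d')" by (cases s; cases t)
    have "Z (case s of (a, b, c) \<Rightarrow> (a \<circ> g, b \<circ> g, c \<circ> g)) (case t of (a, b, c) \<Rightarrow> (a \<circ> g, b \<circ> g, c \<circ> g))
        = (real_of_int (sign g) * real_of_int (sign g)) * Z s t"
      unfolding eq Z_def tensor3_def by (simp only: prod.case A.E_comp[OF g] B.K_comp[OF g]) (simp only: mult_ac divide_inverse)
    moreover have "real_of_int (sign g) * real_of_int (sign g) = 1" by (simp flip: of_int_mult)
    ultimately show "Z (case s of (a, b, c) \<Rightarrow> (a \<circ> g, b \<circ> g, c \<circ> g)) (case t of (a, b, c) \<Rightarrow> (a \<circ> g, b \<circ> g, c \<circ> g)) = Z s t"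
      by simp
  qed
  moreover have "(\<Sum>r\<in>A.W \<times> B.W \<times> B.W. N s r * N r t) = N s t"
      "(\<Sum>r\<in>A.W \<times> B.W \<times> B.W. N s r * Z r t) = Z s t"
      "(\<Sum>r\<in>A.W \<times> B.W \<times> B.W. Z s r * N r t) = Z s t"
      "(\<Sum>r\<in>A.W \<times> B.W \<times> B.W. Z s r * Z r t) = N s t"
    if st: "s \<in> A.W \<times> B.W \<times> B.W" "t \<in> A.W \<times> B.W \<times> B.W" for s t
  proof -
    obtain a b d a' b' d' where eq: "s = (a, b, d)" "t = (a', b', d')" by (cases s; cases t)
    have in': "a \<in> A.W" "b \<in> B.W" "d \<in> B.W" "a' \<in> A.W" "b' \<in> B.W" "d' \<in> B.W" using st eq by auto
    have KE: "(\<Sum>u\<in>B.W. B.K v u * B.E u w) = B.K v w" if "v \<in> B.W" "w \<in> B.W" for v w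
      using B.K_E that by (simp add: B.cols_eq_rows)
    have kk: "B.ksgn * B.ksgn = 1" using B.ksgn by auto
    show "(\<Sum>r\<in>A.W \<times> B.W \<times> B.W. N s r * N r t) = N s t"
      using in' unfolding eq N_def tensor3_mult by (simp add: A.E_E B.E_E tensor3_def)
    show "(\<Sum>r\<in>A.W \<times> B.W \<times> B.W. N s r * Z r t) = Z s t"
      using in' unfolding eq N_def Z_def tensor3_mult
      by (simp add: A.E_E B.E_K tensor3_def flip: sum_divide_distrib)
    show "(\<Sum>r\<in>A.W \<times> B.W \<times> B.W. Z s r * N r t) = Z s t"
      using in' unfolding eq N_def Z_def tensor3_mult
      by (simp add: A.E_E KE tensor3_def flip: sum_divide_distrib)
    have "(\<Sum>r\<in>A.W \<times> B.W \<times> B.W. Z s r * Z r t) =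
       A.E a a' * (B.ksgn * ?c * B.E b b' * (B.ksgn * ?c * B.E d d' / (?c * ?c)))"
      using in' unfolding eq Z_def tensor3_mult
      by (simp add: A.E_E B.K_K flip: sum_divide_distrib)
    also have "\<dots> = (B.ksgn * B.ksgn) * N s t" using c by (simp add: eq N_def tensor3_def field_simps)
    finally show "(\<Sum>r\<in>A.W \<times> B.W \<times> B.W. Z s r * Z r t) = N s t" using kk by simp
  qed
  ultimately have "\<bar>\<Sum>s\<in>A.W \<times> B.W \<times> B.W. P.avg Z s s\<bar> \<le> (\<Sum>s\<in>A.W \<times> B.W \<times> B.W. P.avg N s s)"
    by (rule P.avg_involution_bound)
  then have "\<bar>\<Sum>g | g permutes X. chi L X g * (twisted_char D X g)\<^sup>2 / ?c\<bar>
    \<le> (\<Sum>g | g permutes X. chi L X g * chi D X g * chi D X g)"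
  proof -
    have "(\<Sum>s\<in>A.W \<times> B.W \<times> B.W. P.avg Z s s)
        = (\<Sum>g | g permutes X. chi L X g * (twisted_char D X g)\<^sup>2 / ?c) / fact (card X)"
      unfolding P.trace_avg Z_def tensor3_trace
      by (simp add: power2_eq_square mult.assoc flip: chi_def twisted_char_def sum_divide_distrib)
    moreover have "(\<Sum>s\<in>A.W \<times> B.W \<times> B.W. P.avg N s s)
        = (\<Sum>g | g permutes X. chi L X g * chi D X g * chi D X g) / fact (card X)"
      unfolding P.trace_avg N_def tensor3_trace by (simp add: mult.assoc flip: chi_def)
    moreover assume "\<bar>\<Sum>s\<in>A.W \<times> B.W \<times> B.W. P.avg Z s s\<bar> \<le> (\<Sum>s\<in>A.W \<times> B.W \<times> B.W. P.avg N s s)"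
    ultimately show ?thesis by (simp add: divide_le_cancel)
  qed
  then show ?thesis using c by (simp add: field_simps flip: sum_divide_distrib)
qed

text \<open>The class average \<open>C\<close> minus the orthogonal projection \<open>R\<close> on the span of the characters is a
  projection whose trace is the number of types minus the number of characters.\<close>

theorem chi_complete:
  fixes ct :: "('a \<Rightarrow> 'a) \<Rightarrow> 't" and \<psi> :: "('a \<Rightarrow> 'a) \<Rightarrow> real"
  assumes X: "finite X" and \<D>: "finite \<D>" "\<And>D. D \<in> \<D> \<Longrightarrow> ferrers_diagram D X"
    and conj: "\<And>g h. g permutes X \<Longrightarrow> h permutes X \<Longrightarrow> ct g = ct h \<Longrightarrow> \<exists>k. k permutes X \<and> h = k \<circ> g \<circ> inv k"
    and card: "card (ct ` {g. g permutes X}) \<le> card \<D>"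
    and \<psi>: "\<And>g h. g permutes X \<Longrightarrow> h permutes X \<Longrightarrow> ct g = ct h \<Longrightarrow> \<psi> g = \<psi> h"
    and g: "g permutes X"
  shows "\<psi> g = (\<Sum>D\<in>\<D>. (\<Sum>h | h permutes X. chi D X h * \<psi> h) / fact (card X) * chi D X g)"
proof -
  let ?G = "{g. g permutes X}"
  have finG: "finite ?G" using X by (rule finite_permutations)
  define cl where "cl g = {k\<in>?G. ct k = ct g}" for g
  \<comment> \<open>\<open>C\<close> averages over the fibres of \<open>ct\<close>, so it fixes the
    functions that are constant on them.\<close>
  define C where "C g h = (if ct g = ct h then 1 / real (card (cl g)) else 0)" for g h
  define R where "R g h = (\<Sum>D\<in>\<D>. chi D X g * chi D X h) / fact (card X)" for g h
  have cl_cong: "ct g = ct h \<Longrightarrow> cl g = cl h" for g h by (simp add: cl_def)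
  have cl_pos: "card (cl g) \<noteq> 0" if "g \<in> ?G" for g using that finG by (auto simp: cl_def)
  have C_avg: "(\<Sum>h\<in>?G. C g h * f h) = f g"
    if "g \<in> ?G" "\<And>h. h \<in> ?G \<Longrightarrow> ct g = ct h \<Longrightarrow> f h = f g" for g and f :: "('a \<Rightarrow> 'a) \<Rightarrow> real"
  proof -
    have "(\<Sum>h\<in>?G. C g h * f h) = (\<Sum>h\<in>?G. if ct h = ct g then f g / card (cl g) else 0)"
    proof (rule sum.cong[OF refl])
      fix h assume "h \<in> ?G"
      then show "C g h * f h = (if ct h = ct g then f g / card (cl g) else 0)"
        using that(2)[of h] by (cases "ct g = ct h") (simp_all add: C_def)
    qed
    also have "\<dots> = (\<Sum>h\<in>cl g. f g / card (cl g))"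
      using finG by (simp add: cl_def flip: sum.inter_filter)
    finally show ?thesis using cl_pos[OF that(1)] by simp
  qed
  have C_sym: "C g h = C h g" for g h using cl_cong[of g h] by (simp add: C_def)
  have chi_cl: "chi D X h = chi D X g" if "D \<in> \<D>" "g \<in> ?G" "h \<in> ?G" "ct g = ct h" for D g h
  proof -
    have "g permutes X" "h permutes X" "ct g = ct h" using that by simp_all
    from conj[OF this] obtain k where "k permutes X" "h = k \<circ> g \<circ> inv k" by (elim exE conjE)
    then show ?thesis using chi_conj[OF \<D>(2)[OF that(1)]] by simp
  qed
  have CC: "(\<Sum>h\<in>?G. C g h * C h k) = C g k" if "g \<in> ?G" "k \<in> ?G" for g k
  proof (rule C_avg[OF that(1)])
    show "C h k = C g k" if "ct g = ct h" for h using that cl_cong[OF that] by (simp add: C_def)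
  qed
  have CR: "(\<Sum>h\<in>?G. C g h * R h k) = R g k" if "g \<in> ?G" "k \<in> ?G" for g k
  proof (rule C_avg[OF that(1)])
    show "R h k = R g k" if "h \<in> ?G" "ct g = ct h" for h
      using chi_cl[OF _ \<open>g \<in> ?G\<close> that] by (simp add: R_def)
  qed
  have RC: "(\<Sum>h\<in>?G. R g h * C h k) = R g k" if "g \<in> ?G" "k \<in> ?G" for g k
    using CR[OF that(2,1)] by (simp add: C_sym[of _ k] R_def mult.commute)
  have orth: "(\<Sum>h\<in>?G. chi D X h * chi D' X h) = (if D = D' then fact (card X) else 0)"
    if "D \<in> \<D>" "D' \<in> \<D>" for D D'
    using sum_chi_chi[OF \<D>(2)[OF that(1)] \<D>(2)[OF that(2)]] ferrers_diagram.card[OF \<D>(2)[OF that(1)]] by simp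
  have RR: "(\<Sum>h\<in>?G. R g h * R h k) = R g k" for g k
  proof -
    have "(\<Sum>h\<in>?G. R g h * R h k) = (\<Sum>h\<in>?G. \<Sum>D\<in>\<D>. \<Sum>D'\<in>\<D>.
        chi D X g * chi D' X k * (chi D X h * chi D' X h)) / (fact (card X) * fact (card X))"
      by (simp add: R_def sum_product sum_divide_distrib mult_ac)
    also have "(\<Sum>h\<in>?G. \<Sum>D\<in>\<D>. \<Sum>D'\<in>\<D>. chi D X g * chi D' X k * (chi D X h * chi D' X h))
       = (\<Sum>D\<in>\<D>. \<Sum>D'\<in>\<D>. \<Sum>h\<in>?G. chi D X g * chi D' X k * (chi D X h * chi D' X h))"
      by (subst sum.swap, intro sum.cong refl, rule sum.swap)
    also have "\<dots> = (\<Sum>D\<in>\<D>. \<Sum>D'\<in>\<D>. if D' = D then chi D X g * chi D' X k * fact (card X) else 0)"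
      by (intro sum.cong refl) (auto simp: orth simp flip: sum_distrib_left)
    also have "\<dots> = fact (card X) * (\<Sum>D\<in>\<D>. chi D X g * chi D X k)"
      using \<D>(1) by (simp add: sum_distrib_left mult_ac)
    finally show ?thesis by (simp add: R_def)
  qed
  have "(\<Sum>h\<in>?G. (C g h - R g h) * (C h k - R h k)) = C g k - R g k" if "g \<in> ?G" "k \<in> ?G" for g k
  proof -
    have "(\<Sum>h\<in>?G. (C g h - R g h) * (C h k - R h k)) = (\<Sum>h\<in>?G. C g h * C h k) - (\<Sum>h\<in>?G. C g h * R h k)
        - (\<Sum>h\<in>?G. R g h * C h k) + (\<Sum>h\<in>?G. R g h * R h k)"
      by (simp add: algebra_simps sum_subtractf sum.distrib)
    then show ?thesis unfolding CC[OF that] CR[OF that] RC[OF that] RR by simp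
  qed
  from idem_trace_real[OF finG this] obtain k :: nat where k: "(\<Sum>g\<in>?G. C g g - R g g) = real k"
    and k0: "k = 0 \<longrightarrow> (\<forall>g\<in>?G. \<forall>h\<in>?G. C g h - R g h = 0)" by blast
  have "(\<Sum>g\<in>?G. C g g) - (\<Sum>g\<in>?G. R g g) = real k" using k by (simp add: sum_subtractf)
  moreover have "(\<Sum>g\<in>?G. C g g) = card (ct ` ?G)"
  proof -
    have "(\<Sum>g\<in>?G. C g g) = (\<Sum>t\<in>ct ` ?G. \<Sum>g\<in>{g\<in>?G. ct g = t}. C g g)"
      by (rule sum.image_gen[OF finG])
    also have "\<dots> = (\<Sum>t\<in>ct ` ?G. 1)"
    proof (rule sum.cong[OF refl])
      fix t assume "t \<in> ct ` ?G"
      then obtain g where g: "g \<in> ?G" "t = ct g" by auto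
      have "(\<Sum>g\<in>{g\<in>?G. ct g = t}. C g g) = (\<Sum>h\<in>cl g. 1 / card (cl g))"
      proof (rule sum.cong)
        show "C k k = 1 / card (cl g)" if "k \<in> cl g" for k
          using that cl_cong[of k g] by (simp add: C_def cl_def)
      qed (simp add: cl_def g(2))
      then show "(\<Sum>g\<in>{g\<in>?G. ct g = t}. C g g) = 1" using cl_pos[OF g(1)] by simp
    qed
    finally show ?thesis by simp
  qed
  moreover have "(\<Sum>g\<in>?G. R g g) = card \<D>"
  proof -
    have "(\<Sum>g\<in>?G. R g g) = (\<Sum>D\<in>\<D>. \<Sum>g\<in>?G. chi D X g * chi D X g) / fact (card X)"
      unfolding R_def sum_divide_distrib[symmetric] by (subst sum.swap) (rule refl)
    also have "\<dots> = card \<D>" by (simp add: orth)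
    finally show ?thesis .
  qed
  \<comment> \<open>The trace is the number of types minus the number of diagrams, hence at most 0.
    Being a natural number it is 0, and then the projection \<open>C - R\<close> itself
    vanishes.\<close>
  ultimately have "k = 0" using card by linarith
  then have CeqR: "C g h = R g h" if "h \<in> ?G" for h using k0 that g by simp
  have "\<psi> g = (\<Sum>h\<in>?G. C g h * \<psi> h)"
  proof (rule C_avg[symmetric])
    show "\<psi> h = \<psi> g" if "h \<in> ?G" "ct g = ct h" for h using \<psi>[of g h] g that by simp
  qed (use g in simp)
  also have "\<dots> = (\<Sum>h\<in>?G. R g h * \<psi> h)" using CeqR by simp
  also have "\<dots> = (\<Sum>h\<in>?G. \<Sum>D\<in>\<D>. chi D X g * (chi D X h * \<psi> h) / fact (card X))"
    by (simp add: R_def sum_distrib_left sum_divide_distrib mult_ac)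
  also have "\<dots> = (\<Sum>D\<in>\<D>. \<Sum>h\<in>?G. chi D X g * (chi D X h * \<psi> h) / fact (card X))"
    by (rule sum.swap)
  also have "\<dots> = (\<Sum>D\<in>\<D>. (\<Sum>h\<in>?G. chi D X h * \<psi> h) / fact (card X) * chi D X g)"
    by (simp add: sum_distrib_left sum_divide_distrib mult_ac)
  finally show ?thesis .
qed

section \<open>Specht modules\<close>

lemma diagram_rows:
  "rows (diagram \<alpha>) i = (if i < length \<alpha> then \<alpha> ! i else 0)"
proof -
  have "{j. (i, j) \<in> diagram \<alpha>} = (if i < length \<alpha> then {..<\<alpha> ! i} else {})"
    by (auto simp: diagram_def)
  then show ?thesis by (simp add: rows_def)
qed

lemma finite_diagram: "finite (diagram \<alpha>)"
  by (rule finite_subset[of _ "Sigma {..<length \<alpha>} (\<lambda>i. {..<\<alpha> ! i})"]) (auto simp: diagram_def)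

lemma card_diagram: "card (diagram \<alpha>) = sum_list \<alpha>"
proof -
  have "diagram \<alpha> = Sigma {..<length \<alpha>} (\<lambda>i. {..<\<alpha> ! i})" by (auto simp: diagram_def)
  then have "card (diagram \<alpha>) = (\<Sum>i<length \<alpha>. \<alpha> ! i)" by simp
  then show ?thesis by (simp add: sum_list_sum_nth atLeast0LessThan)
qed

lemma ferrers_diagram_diagram:
  assumes "\<alpha> \<turnstile> n" shows "ferrers_diagram (diagram \<alpha>) {..<n}"
proof
  have mono: "\<alpha> ! i \<le> \<alpha> ! i'" if "i' \<le> i" "i < length \<alpha>" for i i'
  proof (cases "i = i'")
    case False
    then show ?thesis
      using assms that sorted_wrt_nth_less[of "(\<ge>)" \<alpha> i' i] by (simp add: is_partition_def)
  qed simp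
  show "ferrers (diagram \<alpha>)"
    unfolding ferrers_def
  proof (intro conjI allI impI)
    fix i j i' j' assume *: "(i, j) \<in> diagram \<alpha>" "i' \<le> i" "j' \<le> j"
    then show "(i', j') \<in> diagram \<alpha>" using mono[of i' i] by (simp add: diagram_def)
  qed (rule finite_diagram)
  show "card {..<n} = card (diagram \<alpha>)" using assms by (simp add: card_diagram is_partition_def)
qed simp

lemma diagram_inj:
  assumes "\<alpha> \<turnstile> n" "\<beta> \<turnstile> m" "diagram \<alpha> = diagram \<beta>" shows "\<alpha> = \<beta>"
proof -
  have r: "(if i < length \<alpha> then \<alpha> ! i else 0) = (if i < length \<beta> then \<beta> ! i else 0)" for i
    using assms(3) by (simp flip: diagram_rows)
  have pos: "\<alpha> ! i \<noteq> 0" if "i < length \<alpha>" for i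
    using assms(1) nth_mem[OF that] unfolding is_partition_def by metis
  have pos': "\<beta> ! i \<noteq> 0" if "i < length \<beta>" for i
    using assms(2) nth_mem[OF that] unfolding is_partition_def by metis
  have same: "i < length \<alpha> \<longleftrightarrow> i < length \<beta>" for i
    using r[of i] pos[of i] pos'[of i] by metis
  have len: "length \<alpha> = length \<beta>"
    using same[of "length \<alpha>"] same[of "length \<beta>"] by linarith
  show ?thesis
  proof (rule nth_equalityI[OF len])
    fix i assume "i < length \<alpha>" then show "\<alpha> ! i = \<beta> ! i" using r[of i] len by simp
  qed
qed

locale partition_specht =
  fixes \<alpha> :: "nat list" and n :: nat
  assumes part: "\<alpha> \<turnstile> n"
begin

definition "D = diagram \<alpha>"
definition "X = {..<n}"

sublocale ferrers_diagram D X
  unfolding D_def X_def by (rule ferrers_diagram_diagram[OF part])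

lemma sum_list: "sum_list \<alpha> = n" using part by (simp add: is_partition_def)

definition tab :: "(nat \<Rightarrow> nat) \<Rightarrow> nat set list" where
  "tab w = map (\<lambda>i. {x\<in>X. w x = i}) [0..<length \<alpha>]"

lemma word_less: assumes "w \<in> W" "x \<in> X" shows "w x < length \<alpha>"
proof (rule ccontr)
  assume "\<not> ?thesis"
  then have "card {y\<in>X. w y = w x} = 0" using assms by (auto simp: words_def D_def diagram_rows)
  then show False using X assms(2) by auto
qed

lemma inj_tab: "inj_on tab W"
proof (rule inj_onI)
  fix w u assume wu: "w \<in> W" "u \<in> W" "tab w = tab u"
  show "w = u"
  proof
    fix x show "w x = u x"
    proof (cases "x \<in> X")
      case True
      have "{y\<in>X. w y = w x} = {y\<in>X. u y = w x}"
        using arg_cong[OF wu(3), of "\<lambda>T. T ! w x"] word_less[OF wu(1) True] by (simp add: tab_def)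
      moreover have "x \<in> {y\<in>X. w y = w x}" using True by simp
      ultimately have "x \<in> {y\<in>X. u y = w x}" by simp
      then show ?thesis by simp
    qed (use wu in \<open>simp add: words_def\<close>)
  qed
qed

definition colw :: "(nat \<times> nat \<Rightarrow> nat) \<Rightarrow> nat \<Rightarrow> nat" where
  "colw t = (\<lambda>x. if x \<in> X then snd (inv_into D t x) else 0)"
definition roww :: "(nat \<times> nat \<Rightarrow> nat) \<Rightarrow> nat \<Rightarrow> nat" where
  "roww t = (\<lambda>x. if x \<in> X then fst (inv_into D t x) else 0)"

lemma tableau_bij: "tableau \<alpha> t \<longleftrightarrow> bij_betw t D X"
  by (simp add: tableau_def D_def X_def sum_list)

lemma words_tableau:
  assumes "tableau \<alpha> t"
  shows "roww t \<in> W" "colw t \<in> V" "bij_betw (\<lambda>x. (roww t x, colw t x)) X D"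
  using words_of_bij[OF bij_betw_inv_into[OF assms[unfolded tableau_bij]]] by (simp_all add: roww_def colw_def)

lemma tabloid_eq: assumes "tableau \<alpha> t" shows "tabloid \<alpha> t = tab (roww t)"
proof -
  have t: "bij_betw t D X" using assms by (simp add: tableau_bij)
  have "t ` {c \<in> D. fst c = i} = {x \<in> X. roww t x = i}" for i
  proof (intro equalityI subsetI)
    fix x assume "x \<in> t ` {c \<in> D. fst c = i}"
    then show "x \<in> {x \<in> X. roww t x = i}"
      using t by (auto simp: roww_def bij_betw_inv_into_left bij_betwE)
  next
    fix x assume x: "x \<in> {x \<in> X. roww t x = i}"
    then have "inv_into D t x \<in> D" "t (inv_into D t x) = x"
      using bij_betwE[OF bij_betw_inv_into[OF t]] bij_betw_inv_into_right[OF t] by auto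
    then show "x \<in> t ` {c \<in> D. fst c = i}"
      using x by (auto intro!: image_eqI[of _ _ "inv_into D t x"] simp: roww_def)
  qed
  then show ?thesis by (simp add: tabloid_def tab_def D_def)
qed

lemma col_set: assumes "tableau \<alpha> t" shows "t ` {c \<in> D. snd c = i} = {x \<in> X. colw t x = i}"
proof (intro equalityI subsetI)
  have t: "bij_betw t D X" using assms by (simp add: tableau_bij)
  fix x
  show "x \<in> {x \<in> X. colw t x = i}" if "x \<in> t ` {c \<in> D. snd c = i}"
    using that t by (auto simp: colw_def bij_betw_inv_into_left bij_betwE)
  assume x: "x \<in> {x \<in> X. colw t x = i}"
  then have "inv_into D t x \<in> D" "t (inv_into D t x) = x"
    using bij_betwE[OF bij_betw_inv_into[OF t]] bij_betw_inv_into_right[OF t] by auto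
  then show "x \<in> t ` {c \<in> D. snd c = i}"
    using x by (auto intro!: image_eqI[of _ _ "inv_into D t x"] simp: colw_def)
qed

lemma column_stabilizer_eq:
  assumes "tableau \<alpha> t"
  shows "\<sigma> \<in> column_stabilizer \<alpha> t \<longleftrightarrow> \<sigma> permutes X \<and> colw t \<circ> \<sigma> = colw t"
proof -
  have "(\<forall>j. \<sigma> ` {x \<in> X. colw t x = j} = {x \<in> X. colw t x = j}) \<longleftrightarrow> colw t \<circ> \<sigma> = colw t" if s: "\<sigma> permutes X"
  proof
    assume *: "\<forall>j. \<sigma> ` {x \<in> X. colw t x = j} = {x \<in> X. colw t x = j}"
    have "colw t (\<sigma> x) = colw t x" for x
    proof (cases "x \<in> X")
      case True
      then have "\<sigma> x \<in> \<sigma> ` {y \<in> X. colw t y = colw t x}" by auto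
      then show ?thesis using * by auto
    qed (simp add: permutes_not_in[OF s])
    then show "colw t \<circ> \<sigma> = colw t" by auto
  next
    assume *: "colw t \<circ> \<sigma> = colw t"
    then have c: "colw t (\<sigma> x) = colw t x" for x by (metis comp_apply)
    show "\<forall>j. \<sigma> ` {x \<in> X. colw t x = j} = {x \<in> X. colw t x = j}"
    proof (intro allI equalityI subsetI)
      fix j x assume x: "x \<in> {x \<in> X. colw t x = j}"
      have "inv \<sigma> x \<in> X" "\<sigma> (inv \<sigma> x) = x"
        using x permutes_in_image[OF permutes_inv[OF s]] permutes_inverses(1)[OF s] by auto
      then show "x \<in> \<sigma> ` {x \<in> X. colw t x = j}"
        using x c[of "inv \<sigma> x"] by (auto intro!: image_eqI[of _ _ "inv \<sigma> x"])
    qed (use c permutes_in_image[OF s] in auto)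
  qed
  then show ?thesis
    unfolding column_stabilizer_def using col_set[OF assms] by (auto simp: D_def X_def sum_list)
qed

text \<open>A word records the place of each letter, so it is inverse to the filling and transforms
  by \<open>inv \<sigma>\<close>.\<close>

lemma roww_comp:
  assumes "tableau \<alpha> t" "\<sigma> permutes X"
  shows "tableau \<alpha> (\<sigma> \<circ> t)" "roww (\<sigma> \<circ> t) = roww t \<circ> inv \<sigma>"
proof -
  have t: "bij_betw t D X" using assms by (simp add: tableau_bij)
  then have st: "bij_betw (\<sigma> \<circ> t) D X" using permutes_imp_bij[OF assms(2)] by (rule bij_betw_trans)
  then show "tableau \<alpha> (\<sigma> \<circ> t)" by (simp add: tableau_bij)
  have "inv_into D (\<sigma> \<circ> t) x = inv_into D t (inv \<sigma> x)" if "x \<in> X" for x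
  proof (rule inv_into_f_eq)
    have "inv \<sigma> x \<in> X" using that permutes_in_image[OF permutes_inv[OF assms(2)]] by simp
    then show "inv_into D t (inv \<sigma> x) \<in> D" "(\<sigma> \<circ> t) (inv_into D t (inv \<sigma> x)) = x"
      using bij_betwE[OF bij_betw_inv_into[OF t]] bij_betw_inv_into_right[OF t]
        permutes_inverses(1)[OF assms(2)] by auto
    show "inj_on (\<sigma> \<circ> t) D" using st by (simp add: bij_betw_def)
  qed
  then show "roww (\<sigma> \<circ> t) = roww t \<circ> inv \<sigma>"
    using permutes_in_image[OF permutes_inv[OF assms(2)]] by (auto simp: roww_def fun_eq_iff)
qed

text \<open>At most one element of the column stabilizer moves the rows of \<open>t\<close> to
  \<open>w\<close>, since row and column together determine a letter. It exists iff \<open>w\<close>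
  and \<open>colw t\<close> fill the diagram. So the coefficient is 0 or a sign, and the factor
  \<open>K (colw t) (roww t)\<close> makes it 1 at the tabloid of \<open>t\<close>.\<close>

lemma polytabloid_eq:
  assumes t: "tableau \<alpha> t"
  shows "w \<in> W \<Longrightarrow> polytabloid \<alpha> t (tab w) = complex_of_real (K (colw t) w * K (colw t) (roww t))"
    and "T \<notin> tab ` W \<Longrightarrow> polytabloid \<alpha> t T = 0"
proof -
  note tw = words_tableau[OF t]
  have tb: "tabloid \<alpha> (\<sigma> \<circ> t) = tab (roww t \<circ> inv \<sigma>)" "roww t \<circ> inv \<sigma> \<in> W" if "\<sigma> permutes X" for \<sigma>
    using tabloid_eq[OF roww_comp(1)[OF t that]] roww_comp(2)[OF t that]
      words_comp[OF permutes_inv[OF that] tw(1)] by auto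
  show "polytabloid \<alpha> t T = 0" if "T \<notin> tab ` W"
  proof -
    have "{\<sigma> \<in> column_stabilizer \<alpha> t. tabloid \<alpha> (\<sigma> \<circ> t) = T} = {}"
      using that tb column_stabilizer_eq[OF t] by auto
    then show ?thesis unfolding polytabloid_def by (simp only: sum.empty)
  qed
  assume w: "w \<in> W"
  define A where "A = {\<sigma>. \<sigma> permutes X \<and> colw t \<circ> \<sigma> = colw t \<and> roww t \<circ> inv \<sigma> = w}"
  have "{\<sigma> \<in> column_stabilizer \<alpha> t. tabloid \<alpha> (\<sigma> \<circ> t) = tab w} = A"
    using tb inj_tab w column_stabilizer_eq[OF t] by (auto simp: A_def inj_on_eq_iff)
  then have poly: "polytabloid \<alpha> t (tab w) = (\<Sum>\<sigma>\<in>A. of_int (sign \<sigma>))"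
    by (simp add: polytabloid_def)
  show "polytabloid \<alpha> t (tab w) = complex_of_real (K (colw t) w * K (colw t) (roww t))"
  proof (cases "bij_betw (\<lambda>x. (w x, colw t x)) X D")
    case True
    obtain g where g: "g permutes X" "w = roww t \<circ> g" "colw t = colw t \<circ> g"
      by (rule pair_transitive[OF True tw(3)]) (use w tw in \<open>auto simp: words_def\<close>)
    have "A = {inv g}"
    proof (intro equalityI subsetI)
      fix \<sigma> assume "\<sigma> \<in> A"
      then have s: "\<sigma> permutes X" "colw t \<circ> \<sigma> = colw t" "roww t \<circ> inv \<sigma> = w" by (auto simp: A_def)
      have "roww t \<circ> g \<circ> \<sigma> = roww t"
        using s(3) g(2) permutes_inv_o(2)[OF s(1)] by (metis comp_assoc comp_id)
      moreover have "colw t \<circ> g \<circ> \<sigma> = colw t" using s(2) g(3) by simp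
      ultimately have "roww t (g (\<sigma> x)) = roww t x" "colw t (g (\<sigma> x)) = colw t x" for x
        by (metis comp_apply)+
      moreover have "g (\<sigma> x) \<in> X \<longleftrightarrow> x \<in> X" for x
        using permutes_in_image g(1) s(1) by metis
      ultimately have "g (\<sigma> x) = x" for x
        using tw(3) permutes_not_in[OF g(1)] permutes_not_in[OF s(1)]
        by (cases "x \<in> X") (auto simp: bij_betw_def inj_on_def)
      then have "\<sigma> x = inv g x" for x using permutes_inverses(2)[OF g(1)] by metis
      then show "\<sigma> \<in> {inv g}" by auto
    next
      fix \<sigma> assume "\<sigma> \<in> {inv g}"
      moreover have "colw t \<circ> inv g = colw t"
        using g(3) permutes_inv_o(1)[OF g(1)] by (metis comp_assoc comp_id)
      ultimately show "\<sigma> \<in> A"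
        using g permutes_inv[OF g(1)] by (simp add: A_def permutes_inv_inv)
    qed
    moreover have "K (colw t) w = of_int (sign g) * K (colw t) (roww t)"
      using K_comp[OF g(1), of "colw t" "roww t"] g by simp
    moreover have "K (colw t) (roww t) * K (colw t) (roww t) = 1"
      using tw(3) by (simp add: kmat_def flip: of_int_mult)
    ultimately show ?thesis
      using sign_inverse[OF permutes_imp_permutation[OF X g(1)]] poly by (simp add: mult.assoc)
  next
    case False
    have "A = {}"
    proof (rule ccontr)
      assume "A \<noteq> {}"
      then obtain \<sigma> where s: "\<sigma> permutes X" "colw t \<circ> \<sigma> = colw t" "roww t \<circ> inv \<sigma> = w" by (auto simp: A_def)
      have "colw t \<circ> inv \<sigma> = colw t"
        using s(2) permutes_inv_o(1)[OF s(1)] by (metis comp_assoc comp_id)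
      then show False
        using False bij_pair_comp[OF permutes_inv[OF s(1)], of "roww t" "colw t" D] tw(3) s(3) by simp
    qed
    then show ?thesis using poly False by (simp add: kmat_def)
  qed
qed

text \<open>A row of \<open>K\<close> is nonzero only if some \<open>w\<close> completes
  \<open>v\<close> to a filling. The tableau read off from it has column word \<open>v\<close>, and
  its polytabloid is this row up to sign.\<close>

lemma K_row_in_specht:
  assumes "v \<in> V"
  shows "(\<lambda>T. if T \<in> tab ` W then complex_of_real (K v (the_inv_into W tab T)) else 0) \<in> specht \<alpha>" (is "?f \<in> _")
proof (cases "\<exists>w\<in>W. bij_betw (\<lambda>x. (w x, v x)) X D")
  case True
  then obtain w where w: "w \<in> W" "bij_betw (\<lambda>x. (w x, v x)) X D" by blast
  define t where "t = inv_into X (\<lambda>x. (w x, v x))"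
  have t: "tableau \<alpha> t" unfolding tableau_bij t_def by (rule bij_betw_inv_into[OF w(2)])
  have "inv_into D t x = (w x, v x)" if "x \<in> X" for x
    unfolding t_def using inv_into_inv_into_eq[OF w(2) that] .
  then have "colw t = v" using assms by (auto simp: colw_def words_def fun_eq_iff)
  have "?f = fscale (complex_of_real (K v (roww t))) (polytabloid \<alpha> t)"
  proof
    fix T
    show "?f T = fscale (complex_of_real (K v (roww t))) (polytabloid \<alpha> t) T"
    proof (cases "T \<in> tab ` W")
      case True
      then obtain u where u: "u \<in> W" "T = tab u" by blast
      have "K v (roww t) * K v (roww t) = 1"
        using words_tableau(3)[OF t] \<open>colw t = v\<close> by (simp add: kmat_def flip: of_int_mult)
      then have "K v u = K v (roww t) * (K v u * K v (roww t))" by (simp add: mult_ac)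
      then show ?thesis
        using u polytabloid_eq(1)[OF t u(1)] the_inv_into_f_f[OF inj_tab u(1)] \<open>colw t = v\<close>
        by (simp add: fscale_def flip: of_real_mult)
    next
      case False
      then show ?thesis using polytabloid_eq(2)[OF t] by (simp add: fscale_def)
    qed
  qed
  then show ?thesis
    unfolding specht_def using t by (simp only:) (intro fun_space.span_scale fun_space.span_base, blast)
next
  case False
  then have "?f = 0" using the_inv_into_into[OF inj_tab _ order_refl]
    by (auto simp: fun_eq_iff kmat_def zero_fun_def)
  then show ?thesis unfolding specht_def by (simp only: fun_space.span_zero)
qed

abbreviation "ind T \<equiv> the_inv_into W tab T"

lemma ind_tab: "w \<in> W \<Longrightarrow> ind (tab w) = w" by (rule the_inv_into_f_f[OF inj_tab])

text \<open>Polytabloids are rows of \<open>K\<close> up to sign, and \<open>K E = K\<close>. Thus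
  \<open>E\<close> acts as the identity on their span, as \<open>trace_on_eq\<close> demands of its
  projection.\<close>

lemma specht_fixed:
  assumes "f \<in> specht \<alpha>"
  shows "(\<forall>T. T \<notin> tab ` W \<longrightarrow> f T = 0) \<and>
    (\<forall>T\<in>tab ` W. f T = (\<Sum>T'\<in>tab ` W. complex_of_real (E (ind T) (ind T')) * f T'))"
  using assms unfolding specht_def
proof (induction rule: fun_space.span_induct_alt)
  case base
  then show ?case by simp
next
  case (step r x y)
  then obtain t where t: "tableau \<alpha> t" "x = polytabloid \<alpha> t" by auto
  have x0: "x T = 0" if "T \<notin> tab ` W" for T using polytabloid_eq(2)[OF t(1) that] t(2) by simp
  have x: "x T = (\<Sum>T'\<in>tab ` W. complex_of_real (E (ind T) (ind T')) * x T')" if T: "T \<in> tab ` W" for T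
  proof -
    obtain w where w: "w \<in> W" "T = tab w" using T by blast
    have "(\<Sum>T'\<in>tab ` W. complex_of_real (E (ind T) (ind T')) * x T')
       = (\<Sum>u\<in>W. complex_of_real (E w u) * (complex_of_real (K (colw t) u * K (colw t) (roww t))))"
      unfolding sum.reindex[OF inj_tab] comp_def w(2)
      by (intro sum.cong refl) (simp add: ind_tab w t polytabloid_eq(1))
    also have "\<dots> = complex_of_real ((\<Sum>u\<in>W. K (colw t) u * E u w) * K (colw t) (roww t))"
      by (simp add: sum_distrib_left E_sym[of w] mult_ac)
    also have "\<dots> = x T"
      by (simp add: K_E[OF words_tableau(2)[OF t(1)] w(1)] polytabloid_eq(1)[OF t(1) w(1)] t(2) w(2))
    finally show ?thesis by simp
  qed
  show ?case
  proof (intro conjI allI impI ballI)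
    show "(fscale r x + y) T = 0" if "T \<notin> tab ` W" for T
      using x0[OF that] step.IH that by (simp add: fscale_def)
    fix T assume T: "T \<in> tab ` W"
    have "(fscale r x + y) T = r * x T + y T" by (simp add: fscale_def)
    also have "\<dots> = r * (\<Sum>T'\<in>tab ` W. complex_of_real (E (ind T) (ind T')) * x T')
        + (\<Sum>T'\<in>tab ` W. complex_of_real (E (ind T) (ind T')) * y T')"
    proof -
      have "y T = (\<Sum>T'\<in>tab ` W. complex_of_real (E (ind T) (ind T')) * y T')" using step.IH T by blast
      then show ?thesis using x[OF T] by simp
    qed
    also have "\<dots> = (\<Sum>T'\<in>tab ` W. complex_of_real (E (ind T) (ind T')) * (fscale r x + y) T')"
      by (simp add: fscale_def sum_distrib_left sum.distrib ring_distribs mult_ac)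
    finally show "(fscale r x + y) T = (\<Sum>T'\<in>tab ` W. complex_of_real (E (ind T) (ind T')) * (fscale r x + y) T')" .
  qed
qed

definition ecol :: "(nat \<Rightarrow> nat) \<Rightarrow> nat set list \<Rightarrow> complex" where
  "ecol w = (\<lambda>T. if T \<in> tab ` W then complex_of_real (E (ind T) w) else 0)"

lemma ecol_in_specht: "ecol w \<in> specht \<alpha>"
proof -
  have "ecol w = (\<Sum>v\<in>V. fscale (complex_of_real (K v w / kconst D X))
      (\<lambda>T. if T \<in> tab ` W then complex_of_real (K v (ind T)) else 0))"
    by (rule ext) (simp add: fun_sum_apply fscale_def ecol_def emat_def qmat_def sum_divide_distrib mult_ac)
  also have "\<dots> \<in> specht \<alpha>"
    unfolding specht_def
    by (intro fun_space.span_sum fun_space.span_scale, fold specht_def) (rule K_row_in_specht)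
  finally show ?thesis .
qed

lemma map_tab: assumes "\<pi> permutes X" shows "map ((`) (inv \<pi>)) (tab w) = tab (w \<circ> \<pi>)"
proof -
  have "inv \<pi> ` {x\<in>X. w x = i} = {x\<in>X. (w \<circ> \<pi>) x = i}" for i
  proof (intro equalityI subsetI)
    fix x assume "x \<in> {x\<in>X. (w \<circ> \<pi>) x = i}"
    then show "x \<in> inv \<pi> ` {x\<in>X. w x = i}"
      using permutes_in_image[OF assms] permutes_inverses(2)[OF assms]
      by (auto intro!: image_eqI[of _ _ "\<pi> x"])
  qed (use permutes_in_image[OF permutes_inv[OF assms]] permutes_inverses(1)[OF assms] in auto)
  then show ?thesis by (simp add: tab_def)
qed

lemma map_tab_in: assumes "\<pi> permutes X" "length T = length \<alpha>"
  shows "map ((`) (inv \<pi>)) T \<in> tab ` W \<longleftrightarrow> T \<in> tab ` W"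
proof
  assume "T \<in> tab ` W"
  then show "map ((`) (inv \<pi>)) T \<in> tab ` W" using map_tab[OF assms(1)] words_comp[OF assms(1)] by auto
next
  assume "map ((`) (inv \<pi>)) T \<in> tab ` W"
  then obtain w where w: "w \<in> W" "map ((`) (inv \<pi>)) T = tab w" by blast
  have "T = map ((`) \<pi>) (map ((`) (inv \<pi>)) T)"
    using permutes_inv_o(1)[OF assms(1)] by (simp add: comp_def image_comp fun_eq_iff)
  also have "\<dots> = tab (w \<circ> inv \<pi>)"
    using w(2) map_tab[OF permutes_inv[OF assms(1)], of w] by (simp add: permutes_inv_inv[OF assms(1)])
  finally show "T \<in> tab ` W" using words_comp[OF permutes_inv[OF assms(1)] w(1)] by blast
qed

lemma perm_action_ecol:
  assumes "\<pi> permutes X" shows "perm_action \<pi> (ecol w) = ecol (w \<circ> inv \<pi>)"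
proof
  fix T
  have len: "length T = length \<alpha>" if "map ((`) (inv \<pi>)) T \<in> tab ` W \<or> T \<in> tab ` W"
    using that by (auto simp: tab_def dest: arg_cong[of _ _ length])
  show "perm_action \<pi> (ecol w) T = ecol (w \<circ> inv \<pi>) T"
  proof (cases "T \<in> tab ` W")
    case True
    then obtain u where u: "u \<in> W" "T = tab u" by blast
    have "E (u \<circ> \<pi>) w = E u (w \<circ> inv \<pi>)"
      using E_comp[OF assms, of u "w \<circ> inv \<pi>"] permutes_inv_o(2)[OF assms] by (simp add: comp_assoc)
    then show ?thesis
      using u words_comp[OF assms u(1)] by (simp add: perm_action_def ecol_def map_tab[OF assms] ind_tab)
  next
    case False
    then show ?thesis using map_tab_in[OF assms] len by (auto simp: perm_action_def ecol_def)
  qed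
qed

text \<open>\<open>trace_on_eq\<close> with the projection \<open>E\<close> gives the sum of
  \<open>E w (w \<circ> inv \<pi>)\<close>, and invariance of \<open>E\<close> moves
  \<open>\<pi>\<close> to the other argument.\<close>

theorem irr_char_eq_chi:
  assumes "\<pi> permutes X" shows "irr_char \<alpha> \<pi> = complex_of_real (chi D X \<pi>)"
proof -
  have FV: "perm_action \<pi> f \<in> specht \<alpha>" if "f \<in> specht \<alpha>" for f
  proof -
    have "f = (\<Sum>T'\<in>tab ` W. fscale (f T') (ecol (ind T')))"
    proof
      fix T
      show "f T = (\<Sum>T'\<in>tab ` W. fscale (f T') (ecol (ind T'))) T"
      proof (cases "T \<in> tab ` W")
        case True
        then have "f T = (\<Sum>T'\<in>tab ` W. complex_of_real (E (ind T) (ind T')) * f T')"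
          using specht_fixed[OF that] by blast
        then show ?thesis using True by (simp add: fun_sum_apply fscale_def ecol_def mult.commute)
      next
        case False
        then show ?thesis using specht_fixed[OF that] by (simp add: fun_sum_apply fscale_def ecol_def)
      qed
    qed
    then have "perm_action \<pi> f = perm_action \<pi> (\<Sum>T'\<in>tab ` W. fscale (f T') (ecol (ind T')))" by simp
    also have "\<dots> = (\<Sum>T'\<in>tab ` W. fscale (f T') (perm_action \<pi> (ecol (ind T'))))"
      by (simp add: perm_action_def fun_eq_iff fun_sum_apply fscale_def)
    also have "\<dots> \<in> specht \<alpha>"
      unfolding perm_action_ecol[OF assms] specht_def
      by (intro fun_space.span_sum fun_space.span_scale, fold specht_def) (rule ecol_in_specht)
    finally show ?thesis .
  qed
  have "irr_char \<alpha> \<pi> = (\<Sum>T\<in>tab ` W. perm_action \<pi> (\<lambda>T'. if T' \<in> tab ` W then complex_of_real (E (ind T') (ind T)) else 0) T)"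
    unfolding irr_char_def
  proof (rule trace_on_eq)
    show "fun_space.subspace (specht \<alpha>)" by (simp add: specht_def)
    show "(\<lambda>T'. if T' \<in> tab ` W then complex_of_real (E (ind T') (ind T)) else 0) \<in> specht \<alpha>" for T
      using ecol_in_specht[of "ind T"] by (simp add: ecol_def)
  qed (use specht_fixed FV in \<open>auto simp: perm_action_def fscale_def fun_eq_iff\<close>)
  also have "\<dots> = (\<Sum>T\<in>tab ` W. ecol (ind T \<circ> inv \<pi>) T)"
    unfolding ecol_def[symmetric] perm_action_ecol[OF assms] by simp
  also have "\<dots> = (\<Sum>w\<in>W. complex_of_real (E w (w \<circ> inv \<pi>)))"
    unfolding sum.reindex[OF inj_tab] by (simp add: ind_tab ecol_def)
  also have "\<dots> = (\<Sum>w\<in>W. complex_of_real (E (w \<circ> \<pi>) w))"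
  proof (intro sum.cong refl arg_cong[where f=complex_of_real])
    fix w
    show "E w (w \<circ> inv \<pi>) = E (w \<circ> \<pi>) w"
      using E_comp[OF assms, of w "w \<circ> inv \<pi>"] permutes_inv_o(2)[OF assms] by (simp add: comp_assoc)
  qed
  finally show ?thesis by (simp add: chi_def)
qed

end

section \<open>Cycles and twisted class functions\<close>

definition cyc_prod :: "'a list list \<Rightarrow> 'a \<Rightarrow> 'a" where
  "cyc_prod L = foldr (\<lambda>cs p. cycle_of_list cs \<circ> p) L id"

lemma cyc_prod_simps [simp]: "cyc_prod [] = id" "cyc_prod (cs # L) = cycle_of_list cs \<circ> cyc_prod L"
  by (simp_all add: cyc_prod_def)

lemma cyc_prod_permutes: "cyc_prod L permutes set (concat L)"
proof (induction L)
  case (Cons cs L)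
  have "cyc_prod L permutes set (concat (cs # L))"
    using Cons by (rule permutes_subset) auto
  moreover have "cycle_of_list cs permutes set (concat (cs # L))"
    using cycle_permutes by (rule permutes_subset) auto
  ultimately show ?case unfolding cyc_prod_simps by (rule permutes_compose)
qed (simp only: cyc_prod_simps permutes_id)

lemma cyc_prod_apply:
  assumes "distinct (concat L)" "cs \<in> set L" "x \<in> set cs"
  shows "cyc_prod L x = cycle_of_list cs x"
  using assms
proof (induction L)
  case (Cons ds L)
  show ?case
  proof (cases "cs \<in> set L")
    case True
    then have "cyc_prod L x = cycle_of_list cs x" using Cons by simp
    moreover have "cycle_of_list cs x \<in> set cs" using permutes_in_image[OF cycle_permutes] Cons.prems(3) by metis
    then have "cycle_of_list cs x \<notin> set ds" using True Cons.prems(1) by auto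
    ultimately show ?thesis by (simp add: id_outside_supp)
  next
    case False
    then have [simp]: "ds = cs" using Cons.prems by simp
    have "x \<notin> set (concat L)" using Cons.prems by auto
    then have "cyc_prod L x = x" by (rule permutes_not_in[OF cyc_prod_permutes])
    then show ?thesis by simp
  qed
qed simp

lemma cyc_prod_cong:
  assumes "mset L = mset L'" "distinct (concat L)" "distinct (concat L')"
  shows "cyc_prod L = cyc_prod L'"
proof
  fix x
  have set: "set L = set L'" using arg_cong[OF assms(1), of set_mset] by simp
  show "cyc_prod L x = cyc_prod L' x"
  proof (cases "x \<in> set (concat L)")
    case True
    then obtain cs where "cs \<in> set L" "x \<in> set cs" by auto
    then show ?thesis using cyc_prod_apply assms set by metis
  next
    case False
    then have "x \<notin> set (concat L')" using set by simp
    then show ?thesis using False permutes_not_in[OF cyc_prod_permutes] by metis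
  qed
qed

lemma distinct_concat_mset:
  assumes "mset L = mset L'" "distinct (concat L)" shows "distinct (concat L')"
proof -
  have "mset (concat M) = \<Sum>\<^sub># (image_mset mset (mset M))" for M :: "'a list list"
    by (simp add: mset_concat flip: sum_mset_sum_list)
  then have "mset (concat L) = mset (concat L')" using assms(1) by simp
  then show ?thesis using assms(2) mset_eq_imp_distinct_iff by blast
qed


text \<open>The lists cover \<open>X\<close>, so fixed points appear as lists of length 1 and the
  lengths form the full cycle type.\<close>

definition cycles_of :: "'a set \<Rightarrow> ('a \<Rightarrow> 'a) \<Rightarrow> 'a list list \<Rightarrow> bool" where
  "cycles_of X p L \<longleftrightarrow> distinct (concat L) \<and> set (concat L) = X \<and> [] \<notin> set L \<and> p = cyc_prod L"

lemma ex_cycles_of: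
  assumes "p permutes X" "finite X" obtains L where "cycles_of X p L"
proof -
  have "cycle_decomp X p" using assms by (rule cycle_decomposition)
  then have "\<exists>L. cycles_of X p L"
  proof induction
    case empty
    then show ?case by (auto simp: cycles_of_def intro!: exI[of _ "[]"])
  next
    case (comp I p cs)
    then obtain L where L: "cycles_of I p L" by blast
    show ?case
    proof (cases "cs = []")
      case False
      then have "cycles_of (set cs \<union> I) (cycle_of_list cs \<circ> p) (cs # L)"
        using L comp by (auto simp: cycles_of_def)
      then show ?thesis by blast
    qed (use L in auto)
  qed
  then show thesis using that by blast
qed

lemma cycles_of_mset: "cycles_of X p L \<Longrightarrow> mset L = mset L' \<Longrightarrow> cycles_of X p L'"
proof -
  assume L: "cycles_of X p L" and m: "mset L = mset L'"
  have "set L = set L'" using arg_cong[OF m, of set_mset] by simp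
  moreover have d: "distinct (concat L')" using distinct_concat_mset[OF m] L by (simp add: cycles_of_def)
  moreover have "cyc_prod L = cyc_prod L'" using cyc_prod_cong[OF m _ d] L by (simp add: cycles_of_def)
  ultimately show ?thesis using L by (simp add: cycles_of_def)
qed

lemma cycle_of_list_nth:
  assumes "distinct cs" "i < length cs"
  shows "cycle_of_list cs (cs ! i) = cs ! (Suc i mod length cs)"
proof -
  have "map (cycle_of_list cs) cs ! i = rotate 1 cs ! i"
    using cyclic_rotation[OF assms(1), of 1] by simp
  then show ?thesis using assms(2) nth_rotate[of i cs 1] by simp
qed

lemma cycle_of_list_pow:
  assumes "distinct cs" "i < length cs"
  shows "(cycle_of_list cs ^^ m) (cs ! i) = cs ! ((i + m) mod length cs)"
proof -
  have "map (cycle_of_list cs ^^ m) cs ! i = rotate m cs ! i"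
    using cyclic_rotation[OF assms(1), of m] by simp
  then show ?thesis using assms(2) nth_rotate[of i cs m] by (simp add: add.commute)
qed

lemma orbit_cycle:
  assumes "cycles_of X p L" "cs \<in> set L" "x \<in> set cs" shows "orbit p x = set cs"
proof -
  have d: "distinct cs" using assms by (auto simp: cycles_of_def distinct_concat_iff)
  obtain i where i: "i < length cs" "x = cs ! i" using assms(3) by (auto simp: in_set_conv_nth)
  have pow: "(p ^^ m) x = (cycle_of_list cs ^^ m) x" for m
  proof (induction m)
    case (Suc m)
    have "(i + m) mod length cs < length cs" using i(1) by (intro mod_less_divisor) auto
    then have "(cycle_of_list cs ^^ m) x \<in> set cs" using cycle_of_list_pow[OF d i(1)] i by simp
    then show ?case using Suc cyc_prod_apply assms by (auto simp: cycles_of_def)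
  qed simp
  have "orbit p x = {cs ! ((i + m) mod length cs) | m. 0 < m}"
    unfolding orbit_altdef pow unfolding i(2) cycle_of_list_pow[OF d i(1)] ..
  also have "\<dots> = set cs"
  proof (intro equalityI subsetI)
    fix y assume "y \<in> set cs"
    then obtain j where j: "j < length cs" "y = cs ! j" by (auto simp: in_set_conv_nth)
    have "(i + (length cs - i + j + length cs)) mod length cs = j"
      using i(1) j(1) by (simp add: mod_add_right_eq)
    then show "y \<in> {cs ! ((i + m) mod length cs) | m. 0 < m}"
      using j i(1) by (intro CollectI exI[of _ "length cs - i + j + length cs"]) auto
  next
    fix y assume "y \<in> {cs ! ((i + m) mod length cs) | m. 0 < m}"
    then show "y \<in> set cs" using i(1) by (auto intro!: nth_mem mod_less_divisor)
  qed
  finally show ?thesis .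
qed

lemma cycle_type_eq:
  assumes "cycles_of {..<n} p L" shows "cycle_type n p = mset (map length L)"
proof -
  have ne: "cs \<noteq> []" if "cs \<in> set L" for cs using assms that by (auto simp: cycles_of_def)
  have "orbit p ` {..<n} = set ` set L"
  proof (intro equalityI subsetI)
    fix A assume "A \<in> orbit p ` {..<n}"
    then obtain x where x: "x \<in> {..<n}" "A = orbit p x" by blast
    then obtain cs where cs: "cs \<in> set L" "x \<in> set cs" using assms by (auto simp: cycles_of_def)
    then show "A \<in> set ` set L" using orbit_cycle[OF assms cs] x by simp
  next
    fix A assume "A \<in> set ` set L"
    then obtain cs where cs: "cs \<in> set L" "A = set cs" by blast
    then have "hd cs \<in> set cs" using ne by simp
    moreover from this have "hd cs \<in> {..<n}" using assms cs by (auto simp: cycles_of_def)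
    ultimately show "A \<in> orbit p ` {..<n}" using orbit_cycle[OF assms cs(1)] cs(2) by blast
  qed
  moreover have "distinct (map set L)"
  proof -
    have L: "distinct L" "\<And>cs ds. cs \<in> set L \<Longrightarrow> ds \<in> set L \<Longrightarrow> cs \<noteq> ds \<Longrightarrow> set cs \<inter> set ds = {}"
      using assms ne by (auto simp: cycles_of_def distinct_concat_iff distinct_removeAll removeAll_id)
    show ?thesis
      unfolding distinct_map using L ne by (auto simp: inj_on_def) (metis inf.idem set_empty)+
  qed
  ultimately have "cycle_type n p = image_mset card (mset (map set L))"
    unfolding cycle_type_def by (metis list.set_map mset_set_set)
  also have "\<dots> = mset (map length L)"
  proof -
    have "map (card \<circ> set) L = map length L"
      using assms by (auto simp: cycles_of_def distinct_concat_iff distinct_card)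
    then show ?thesis by (simp only: mset_map[symmetric] map_map)
  qed
  finally show ?thesis .
qed

lemma conj_cyc_prod:
  assumes "bij h" "\<And>cs. cs \<in> set L \<Longrightarrow> distinct cs"
  shows "h \<circ> cyc_prod L \<circ> inv h = cyc_prod (map (map h) L)"
  using assms(2)
proof (induction L)
  case Nil
  then show ?case by (simp add: fun_eq_iff surj_f_inv_f[OF bij_is_surj[OF assms(1)]])
next
  case (Cons cs L)
  have "h \<circ> cyc_prod (cs # L) \<circ> inv h = (h \<circ> cycle_of_list cs \<circ> inv h) \<circ> (h \<circ> cyc_prod L \<circ> inv h)"
    using assms(1) by (simp add: fun_eq_iff bij_is_inj)
  moreover have "h \<circ> cycle_of_list cs \<circ> inv h = cycle_of_list (map h cs)"
    using Cons.prems by (intro conjugation_of_cycle assms(1)) simp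
  moreover have "h \<circ> cyc_prod L \<circ> inv h = cyc_prod (map (map h) L)"
    using Cons.prems by (intro Cons.IH) simp
  ultimately show ?case by (simp only: list.map cyc_prod_simps)
qed

lemma ex_perm_map:
  assumes "distinct A" "distinct B" "length A = length B" "set A = X" "set B = X"
  obtains h where "h permutes X" "map h A = B"
proof -
  define h where "h = (\<lambda>x. if x \<in> X then the (map_of (zip A B) x) else x)"
  have nth: "h (A ! i) = B ! i" if "i < length A" for i
    using assms that map_of_zip_nth[of A B i] nth_mem[OF that] by (simp add: h_def)
  then have m: "map h A = B" using assms(3) by (simp add: list_eq_iff_nth_eq)
  have "inj_on h X" using m assms by (metis distinct_map)
  moreover have "h ` X = X" using m assms by (metis set_map)
  ultimately have "h permutes X" by (intro bij_imp_permutes) (auto simp: bij_betw_def h_def)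
  then show thesis using m that by blast
qed

text \<open>With the cycles sorted by length, writing one concatenation under the other defines
  \<open>h\<close>; equal lengths keep the cycle boundaries aligned.\<close>

lemma same_lengths_conj:
  assumes L: "cycles_of X p L" and L': "cycles_of X q L'" and len: "mset (map length L) = mset (map length L')"
  obtains h where "h permutes X" "q = h \<circ> p \<circ> inv h"
proof -
  let ?M = "sort_key length L" and ?M' = "sort_key length L'"
  have M: "cycles_of X p ?M" "cycles_of X q ?M'"
    using cycles_of_mset[OF L, of ?M] cycles_of_mset[OF L', of ?M'] by auto
  have "mset (map length ?M) = mset (map length ?M')" using len by simp
  then have lens: "map length ?M = map length ?M'"
    by (metis properties_for_sort sorted_sort_key mset_sort)
  have "length (concat ?M) = length (concat ?M')"
    unfolding length_concat lens ..
  then obtain h where h: "h permutes X" "map h (concat ?M) = concat ?M'"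
    using ex_perm_map[of "concat ?M" "concat ?M'" X] M by (auto simp: cycles_of_def)
  have "map (map h) ?M = ?M'"
  proof (rule concat_injective)
    show "concat (map (map h) ?M) = concat ?M'" using h(2) by (simp add: map_concat)
    show "length (map (map h) ?M) = length ?M'" using lens by (metis length_map)
    show "\<forall>(x, y)\<in>set (zip (map (map h) ?M) ?M'). length x = length y"
    proof clarify
      fix x y assume "(x, y) \<in> set (zip (map (map h) ?M) ?M')"
      then obtain i where i: "i < length ?M" "i < length ?M'" "x = map h (?M ! i)" "y = ?M' ! i"
        by (auto simp: in_set_zip)
      then show "length x = length y"
        using arg_cong[OF lens, of "\<lambda>l. l ! i"] by (simp add: nth_map)
    qed
  qed
  moreover have "h \<circ> cyc_prod ?M \<circ> inv h = cyc_prod (map (map h) ?M)"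
    by (rule conj_cyc_prod) (use M h in \<open>auto simp: cycles_of_def permutes_bij distinct_concat_iff\<close>)
  ultimately show thesis using that[OF h(1)] M by (simp add: cycles_of_def)
qed

lemma same_cycle_type_conj:
  assumes "p permutes {..<n}" "q permutes {..<n}" "cycle_type n p = cycle_type n q"
  shows "\<exists>h. h permutes {..<n} \<and> q = h \<circ> p \<circ> inv h"
proof -
  obtain L where L: "cycles_of {..<n} p L" by (rule ex_cycles_of[OF assms(1) finite_lessThan])
  obtain L' where L': "cycles_of {..<n} q L'" by (rule ex_cycles_of[OF assms(2) finite_lessThan])
  have "mset (map length L) = mset (map length L')"
    using assms(3) cycle_type_eq[OF L] cycle_type_eq[OF L'] by simp
  then obtain h where "h permutes {..<n}" "q = h \<circ> p \<circ> inv h" by (rule same_lengths_conj[OF L L'])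
  then show ?thesis by blast
qed

lemma sign_cycle_of_list: "cs \<noteq> [] \<Longrightarrow> distinct cs \<Longrightarrow> sign (cycle_of_list cs) = (-1) ^ (length cs - 1)"
proof (induction cs rule: cycle_of_list.induct)
  case (1 i j cs)
  have eq: "sign (cycle_of_list (i # j # cs)) = sign (transpose i j) * sign (cycle_of_list (j # cs))"
    unfolding cycle_of_list.simps(1) by (rule sign_compose[OF permutation_swap_id permutation_of_cycle])
  have IH: "sign (cycle_of_list (j # cs)) = (-1) ^ (length (j # cs) - 1)" using 1 by (intro "1.IH") auto
  show ?case unfolding eq IH sign_swap_id using "1.prems" by simp
qed auto

lemma disjoint_permutes_commute:
  assumes "p permutes A" "q permutes B" "A \<inter> B = {}" shows "p \<circ> q = q \<circ> p"
proof
  fix x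
  show "(p \<circ> q) x = (q \<circ> p) x"
  proof (cases "x \<in> A")
    case True
    then have "p x \<in> A" using permutes_in_image[OF assms(1)] by simp
    then have "q (p x) = p x" "q x = x" using True assms(3) permutes_not_in[OF assms(2)] by auto
    then show ?thesis by simp
  next
    case False
    then have px: "p x = x" using permutes_not_in[OF assms(1)] by simp
    have "q x \<notin> A"
    proof (cases "x \<in> B")
      case True then show ?thesis using permutes_in_image[OF assms(2)] assms(3) by auto
    next
      case False then show ?thesis using permutes_not_in[OF assms(2)] \<open>x \<notin> A\<close> by simp
    qed
    then show ?thesis using px permutes_not_in[OF assms(1)] by simp
  qed
qed

section \<open>Functions that change by the sign under conjugation\<close>

definition twisted_class :: "'a set \<Rightarrow> (('a \<Rightarrow> 'a) \<Rightarrow> real) \<Rightarrow> bool" where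
  "twisted_class X \<delta> \<longleftrightarrow> (\<forall>g h. h permutes X \<longrightarrow> \<delta> (h \<circ> g \<circ> inv h) = of_int (sign h) * \<delta> g)"

text \<open>A cycle of even length is an odd permutation; conjugation by it fixes \<open>g\<close>
  but reverses the sign of the value.\<close>

lemma twisted_class_even:
  assumes "twisted_class X \<delta>" "distinct cs" "cs \<noteq> []" "set cs \<subseteq> X" "even (length cs)"
    and comm: "g \<circ> cycle_of_list cs = cycle_of_list cs \<circ> g"
  shows "\<delta> g = 0"
proof -
  let ?c = "cycle_of_list cs"
  have c: "?c permutes X" using cycle_permutes assms(4) by (rule permutes_subset)
  have "?c \<circ> g \<circ> inv ?c = g"
    unfolding comm[symmetric] comp_assoc permutes_inv_o[OF c] by simp
  then have "\<delta> g = of_int (sign ?c) * \<delta> g" using assms(1) c unfolding twisted_class_def by metis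
  moreover have "sign ?c = -1" using sign_cycle_of_list[OF assms(3,2)] assms(3,5)
    by (cases "length cs") auto
  ultimately show ?thesis by simp
qed

text \<open>A cycle of even length would itself be an odd element of the centralizer. The factor
  \<open>h\<close> on a disjoint set leaves room for other cycles about which nothing is
  assumed.\<close>

lemma twisted_class_odd:
  assumes "twisted_class X \<delta>" "cycles_of Y q L" "h permutes Z" "Y \<inter> Z = {}" "Y \<subseteq> X" "Z \<subseteq> X"
    and nz: "\<delta> (h \<circ> q) \<noteq> 0" and cs: "cs \<in> set L"
  shows "odd (length cs)"
proof (rule ccontr)
  assume "\<not> odd (length cs)"
  define L1 where "L1 = remove1 cs L"
  have "mset L = mset (cs # L1)" using cs by (simp add: L1_def)
  then have L: "cycles_of Y q (cs # L1)" by (rule cycles_of_mset[OF assms(2)])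
  let ?c = "cycle_of_list cs"
  have q: "q = ?c \<circ> cyc_prod L1" using L by (simp add: cycles_of_def)
  have d: "distinct cs" "cs \<noteq> []" "set cs \<subseteq> Y" "set cs \<inter> set (concat L1) = {}" using L by (auto simp: cycles_of_def)
  have 1: "?c \<circ> cyc_prod L1 = cyc_prod L1 \<circ> ?c"
    by (rule disjoint_permutes_commute[OF cycle_permutes cyc_prod_permutes d(4)])
  have 2: "?c \<circ> h = h \<circ> ?c"
    by (rule disjoint_permutes_commute[OF cycle_permutes assms(3)]) (use d assms in auto)
  have "h \<circ> q \<circ> ?c = ?c \<circ> (h \<circ> q)"
    unfolding q comp_assoc 1[symmetric] unfolding comp_assoc[symmetric] 2 ..
  then show False
    using twisted_class_even[OF assms(1) d(1,2)] d(3) assms(5) nz \<open>\<not> odd (length cs)\<close> by auto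
qed

text \<open>For two cycles \<open>c\<close>, \<open>d\<close> of the same length, interleaving them gives a cycle \<open>z\<close> of even length
  with \<open>z \<circ> z = c \<circ> d\<close>, so \<open>z\<close> is an odd element of the centralizer.\<close>

lemma twisted_class_distinct:
  assumes tc: "twisted_class X \<delta>" and L: "cycles_of X g L" and nz: "\<delta> g \<noteq> 0"
  shows "distinct (map length L)"
proof (rule ccontr)
  assume "\<not> distinct (map length L)"
  then obtain i j where ij: "i < j" "j < length L" "length (L ! i) = length (L ! j)"
  proof -
    assume *: "\<And>i j. i < j \<Longrightarrow> j < length L \<Longrightarrow> length (L ! i) = length (L ! j) \<Longrightarrow> thesis"
    obtain i j where "i < length L" "j < length L" "i \<noteq> j" "length (L ! i) = length (L ! j)"
      using \<open>\<not> distinct (map length L)\<close> unfolding distinct_conv_nth by auto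
    then show thesis using *[of i j] *[of j i] by (cases "i < j") auto
  qed
  define cs where "cs = L ! i"
  define ds where "ds = L ! j"
  define k where "k = length cs"
  define L1 where "L1 = remove1 ds (remove1 cs L)"
  have cL: "cs \<in> set L" and dL: "ds \<in> set L" using ij by (simp_all add: cs_def ds_def)
  have "cs \<noteq> ds"
  proof
    assume "cs = ds"
    moreover have "distinct L \<or> [] \<in> set L"
      using L by (auto simp: cycles_of_def distinct_concat_iff distinct_removeAll removeAll_id)
    ultimately show False using ij L by (auto simp: cs_def ds_def nth_eq_iff_index_eq cycles_of_def)
  qed
  then have in': "ds \<in> set (remove1 cs L)" using dL by (simp add: in_set_remove1)
  have rem: "mset M = mset (x # remove1 x M)" if "x \<in> set M" for x :: "'a list" and M using that by simp
  have "mset L = mset (cs # remove1 cs L)" using cL by (rule rem)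
  moreover have "mset (remove1 cs L) = mset (ds # L1)" unfolding L1_def using in' by (rule rem)
  ultimately have "mset L = mset (cs # ds # L1)" by (simp only: mset.simps)
  then have L1: "cycles_of X g (cs # ds # L1)" by (rule cycles_of_mset[OF L])
  then have d: "distinct cs" "distinct ds" "set cs \<inter> set ds = {}" "cs \<noteq> []" "ds \<noteq> []"
    "(set cs \<union> set ds) \<inter> set (concat L1) = {}" "set cs \<subseteq> X" "set ds \<subseteq> X"
    by (auto simp: cycles_of_def)
  have k: "length ds = k" "k > 0" using ij d by (auto simp: cs_def ds_def k_def)
  define zs where "zs = map (\<lambda>m. if even m then cs ! (m div 2) else ds ! (m div 2)) [0..<2 * k]"
  have len: "length zs = 2 * k" by (simp add: zs_def)
  have even_nth: "zs ! (2 * m) = cs ! m" and odd_nth: "zs ! (2 * m + 1) = ds ! m" if "m < k" for m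
    using that by (simp_all add: zs_def)
  have zset: "set zs = set cs \<union> set ds"
  proof (intro equalityI subsetI)
    fix x assume "x \<in> set cs \<union> set ds"
    then obtain m where "m < k" "x = cs ! m \<or> x = ds ! m"
      by (auto simp: in_set_conv_nth k_def) (use k in \<open>auto simp: k_def\<close>)
    then show "x \<in> set zs"
      using even_nth[of m] odd_nth[of m] len nth_mem[of "2 * m" zs] nth_mem[of "2 * m + 1" zs] by auto
  next
    fix x assume "x \<in> set zs"
    then obtain m where "m < 2 * k" "x = (if even m then cs ! (m div 2) else ds ! (m div 2))"
      by (auto simp: zs_def)
    then show "x \<in> set cs \<union> set ds" using k nth_mem[of "m div 2" cs] nth_mem[of "m div 2" ds] by (auto simp: k_def)
  qed
  have "card (set zs) = length zs"
    unfolding zset using d k by (simp add: card_Un_disjoint distinct_card len k_def)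
  then have dz: "distinct zs" by (rule card_distinct)
  let ?z = "cycle_of_list zs"
  have zz: "?z (?z (zs ! m)) = zs ! (Suc (Suc m) mod (2 * k))" if "m < 2 * k" for m
    using that k(2) cycle_of_list_nth[OF dz] by (simp add: len mod_Suc_eq)
  have sq: "?z \<circ> ?z = cycle_of_list cs \<circ> cycle_of_list ds"
  proof
    fix x
    consider (c) m where "m < k" "x = cs ! m" | (d) m where "m < k" "x = ds ! m" | (o) "x \<notin> set zs"
      unfolding zset using k by (auto simp: in_set_conv_nth k_def)
    then show "(?z \<circ> ?z) x = (cycle_of_list cs \<circ> cycle_of_list ds) x"
    proof cases
      case c
      have "Suc (Suc (2 * m)) mod (2 * k) = 2 * (Suc m mod k)" by (simp add: mult_mod_right)
      then have "?z (?z x) = cs ! (Suc m mod k)"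
        using zz[of "2 * m"] c even_nth[of m] even_nth[of "Suc m mod k"] k(2) by simp
      moreover have "x \<in> set cs" using c by (simp add: k_def)
      then have "x \<notin> set ds" using d(3) by blast
      ultimately show ?thesis
        using c cycle_of_list_nth[OF d(1), of m] by (simp add: id_outside_supp k_def)
    next
      case d': d
      have "Suc (Suc (2 * m + 1)) mod (2 * k) = 2 * (Suc m mod k) + 1"
      proof -
        have "Suc (Suc (2 * m + 1)) mod (2 * k) = (2 * Suc m + 1) mod (2 * k)" by simp
        also have "\<dots> = 2 * (Suc m mod k) + 1" using k(2) \<open>m < k\<close>
          by (cases "Suc m = k") (simp_all add: mod_if)
        finally show ?thesis .
      qed
      then have "?z (?z x) = ds ! (Suc m mod k)"
        using zz[of "2 * m + 1"] d' odd_nth[of m] odd_nth[of "Suc m mod k"] k(2) by simp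
      moreover have "ds ! (Suc m mod k) \<notin> set cs" using d(3) k nth_mem[of "Suc m mod k" ds] by auto
      ultimately show ?thesis
        using d' cycle_of_list_nth[OF d(2), of m] k by (simp add: id_outside_supp)
    next
      case o
      then have "x \<notin> set cs" "x \<notin> set ds" using zset by auto
      then show ?thesis using o by (simp add: id_outside_supp)
    qed
  qed
  have g: "g = (?z \<circ> ?z) \<circ> cyc_prod L1" using L1 unfolding sq by (simp add: cycles_of_def comp_assoc)
  have comm: "?z \<circ> cyc_prod L1 = cyc_prod L1 \<circ> ?z"
    by (rule disjoint_permutes_commute[OF cycle_permutes cyc_prod_permutes]) (use d zset in auto)
  have "g \<circ> ?z = ?z \<circ> g" unfolding g comp_assoc comm[symmetric] ..
  moreover have "zs \<noteq> []" using len k(2) by (cases zs) auto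
  ultimately show False
    using twisted_class_even[OF tc dz _ _ _ \<open>g \<circ> ?z = ?z \<circ> g\<close>] nz zset d k(2) len by auto
qed

section \<open>Highest weight vectors\<close>

text \<open>The second condition says that \<open>f\<close> is killed by the raising operators \<open>E\<^sub>i\<^sub>j\<close> (\<open>i < j\<close>) of the
  general linear group.\<close>

definition highest_weight :: "'a set \<Rightarrow> (nat \<Rightarrow> nat) \<Rightarrow> (('a \<Rightarrow> nat) \<Rightarrow> real) \<Rightarrow> bool" where
  "highest_weight X c f \<longleftrightarrow> (\<forall>u. f u \<noteq> 0 \<longrightarrow> u \<in> words X c) \<and>
     (\<forall>i j u. i < j \<longrightarrow> (\<Sum>x\<in>{x\<in>X. u x = i}. f (u(x := j))) = 0)"

lemma upd_comp:
  assumes "g permutes X" shows "(u \<circ> g)(x := j) = (u(g x := j)) \<circ> g"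
  using permutes_inj[OF assms] by (auto simp: fun_eq_iff inj_eq)

lemma sum_fibre_comp:
  assumes "g permutes X"
  shows "(\<Sum>x\<in>{x\<in>X. (u \<circ> g) x = i}. \<phi> (g x)) = (\<Sum>x\<in>{x\<in>X. u x = i}. \<phi> x)"
proof (rule sum.reindex_bij_witness[of _ "inv g" g])
  show "inv g y \<in> {x\<in>X. (u \<circ> g) x = i}" if "y \<in> {x\<in>X. u x = i}" for y
    using that permutes_in_image[OF permutes_inv[OF assms]] permutes_inverses[OF assms] by simp
qed (use permutes_in_image[OF assms] permutes_inverses[OF assms] in auto)

text \<open>Permuting letters commutes with changing the values at letters, as in Schur--Weyl
  duality.\<close>

lemma highest_weight_comp:
  assumes "g permutes X" "highest_weight X c f" shows "highest_weight X c (\<lambda>w. f (w \<circ> g))"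
  unfolding highest_weight_def
proof (intro conjI allI impI)
  fix u assume "f (u \<circ> g) \<noteq> 0"
  then have "u \<circ> g \<in> words X c" using assms(2) by (simp add: highest_weight_def)
  then have "u \<circ> g \<circ> inv g \<in> words X c" by (rule words_comp[OF permutes_inv[OF assms(1)]])
  then show "u \<in> words X c" by (simp add: comp_assoc permutes_inv_o[OF assms(1)])
next
  fix i j :: nat and u assume "i < j"
  have "(\<Sum>x\<in>{x\<in>X. u x = i}. f (u(x := j) \<circ> g)) = (\<Sum>x\<in>{x\<in>X. (u \<circ> g) x = i}. f (u(g x := j) \<circ> g))"
    by (rule sum_fibre_comp[OF assms(1), symmetric])
  also have "\<dots> = (\<Sum>x\<in>{x\<in>X. (u \<circ> g) x = i}. f ((u \<circ> g)(x := j)))"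
    by (simp only: upd_comp[OF assms(1)])
  also have "\<dots> = 0" using assms(2) \<open>i < j\<close> unfolding highest_weight_def by blast
  finally show "(\<Sum>x\<in>{x\<in>X. u x = i}. f (u(x := j) \<circ> g)) = 0" .
qed

lemma highest_weight_sum:
  assumes "\<And>i. i \<in> I \<Longrightarrow> highest_weight X c (f i)" shows "highest_weight X c (\<lambda>w. \<Sum>i\<in>I. a i * f i w)"
  unfolding highest_weight_def
proof (intro conjI allI impI)
  fix u assume "(\<Sum>i\<in>I. a i * f i u) \<noteq> 0"
  then obtain i where "i \<in> I" "a i * f i u \<noteq> 0" by (rule sum.not_neutral_contains_not_neutral)
  then show "u \<in> words X c" using assms[of i] by (simp add: highest_weight_def)
next
  fix p q :: nat and u assume pq: "p < q"
  have "(\<Sum>x\<in>{x\<in>X. u x = p}. \<Sum>i\<in>I. a i * f i (u(x := q)))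
     = (\<Sum>i\<in>I. a i * (\<Sum>x\<in>{x\<in>X. u x = p}. f i (u(x := q))))"
    by (subst sum.swap) (simp add: sum_distrib_left)
  also have "\<dots> = 0"
  proof (rule sum.neutral, rule ballI)
    fix i assume "i \<in> I"
    then have "(\<Sum>x\<in>{x\<in>X. u x = p}. f i (u(x := q))) = 0" using assms pq unfolding highest_weight_def by blast
    then show "a i * (\<Sum>x\<in>{x\<in>X. u x = p}. f i (u(x := q))) = 0" by simp
  qed
  finally show "(\<Sum>x\<in>{x\<in>X. u x = p}. \<Sum>i\<in>I. a i * f i (u(x := q))) = 0" .
qed

text \<open>Raising a word makes its row sums violate Gale--Ryser, hence polytabloids are highest weight vectors.\<close>

lemma highest_weight_kmat:
  assumes X: "finite X" and D: "ferrers D" and v: "v \<in> words X (cols D)"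
  shows "highest_weight X (rows D) (\<lambda>w. if w \<in> words X (rows D) then kmat D X v w else 0)" (is "highest_weight _ _ ?f")
  unfolding highest_weight_def
proof (intro conjI allI impI)
  show "u \<in> words X (rows D)" if "?f u \<noteq> 0" for u using that by (auto split: if_splits)
next
  fix i j :: nat and u assume ij: "i < j"
  show "(\<Sum>x\<in>{x\<in>X. u x = i}. ?f (u(x := j))) = 0"
  proof (rule ccontr)
    assume nz: "(\<Sum>x\<in>{x\<in>X. u x = i}. ?f (u(x := j))) \<noteq> 0"
    then obtain x where x: "x \<in> {x\<in>X. u x = i}" "?f (u(x := j)) \<noteq> 0"
      by (rule sum.not_neutral_contains_not_neutral)
    then have w: "u(x := j) \<in> words X (rows D)" by (auto split: if_splits)
    have "u(y := j) \<in> words X (rows D)" if y: "y \<in> {x\<in>X. u x = i}" for y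
    proof -
      have "u(y := j) = u(x := j) \<circ> transpose x y"
        using x(1) y by (auto simp: fun_eq_iff transpose_def)
      moreover have "transpose x y permutes X" using x(1) y by (simp add: permutes_swap_id)
      ultimately show ?thesis using words_comp w by metis
    qed
    then have eq: "(\<Sum>x\<in>{x\<in>X. u x = i}. ?f (u(x := j))) = (\<Sum>x\<in>{x\<in>X. u x = i}. kmat D X v (u(x := j)))"
      by (intro sum.cong refl) simp
    define F where "F v u = (\<Sum>x\<in>{x\<in>X. u x = i}. kmat D X v (u(x := j)))" for v u :: "'a \<Rightarrow> nat"
    have "twisted X F"
      unfolding twisted_def
    proof (intro allI impI)
      fix g v u assume g: "g permutes X"
      have "F (v \<circ> g) (u \<circ> g) = (\<Sum>x\<in>{x\<in>X. (u \<circ> g) x = i}. kmat D X (v \<circ> g) (u(g x := j) \<circ> g))"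
        unfolding F_def by (simp only: upd_comp[OF g])
      also have "\<dots> = (\<Sum>x\<in>{x\<in>X. u x = i}. kmat D X (v \<circ> g) (u(x := j) \<circ> g))"
        by (rule sum_fibre_comp[OF g])
      also have "\<dots> = of_int (sign g) * F v u"
        using twisted_kmat[OF X, of D] g unfolding twisted_def F_def by (simp add: sum_distrib_left)
      finally show "F (v \<circ> g) (u \<circ> g) = of_int (sign g) * F v u" .
    qed
    moreover have "F v u \<noteq> 0" using nz eq by (simp add: F_def)
    ultimately have "inj_on (\<lambda>x. (u x, v x)) X" using twisted_inj[of X F v u] by simp
    then have "card {y\<in>X. u y < Suc i} \<le> psum D (Suc i)" using gale_ryser[OF X D v, of u "Suc i"] by simp
    moreover have "card {y\<in>X. (u(x := j)) y < Suc i} = psum D (Suc i)"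
      using card_words_less[OF X w] psum_rows[OF D] by simp
    \<comment> \<open>Lowering \<open>x\<close> back from row \<open>j\<close> to row
      \<open>i\<close> puts one letter too many into the first \<open>i + 1\<close> rows.\<close>
    moreover have "{y\<in>X. u y < Suc i} = insert x {y\<in>X. (u(x := j)) y < Suc i}"
      using x(1) ij by auto
    moreover have "x \<notin> {y\<in>X. (u(x := j)) y < Suc i}" using ij by simp
    ultimately show False using X by simp
  qed
qed

text \<open>The symmetrizer of \<open>A\<close> and the antisymmetrizer of \<open>B\<close> acting
  on letters; for disjoint sets they commute, so the result is symmetric in \<open>A\<close> and
  antisymmetric in \<open>B\<close>.\<close>

definition hook_op :: "'a set \<Rightarrow> 'a set \<Rightarrow> (('a \<Rightarrow> nat) \<Rightarrow> real) \<Rightarrow> ('a \<Rightarrow> nat) \<Rightarrow> real" where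
  "hook_op A B f w = (\<Sum>r | r permutes A. \<Sum>c | c permutes B. of_int (sign c) * f (w \<circ> r \<circ> c))"

fun hook_ops :: "('a set \<times> 'a set) list \<Rightarrow> (('a \<Rightarrow> nat) \<Rightarrow> real) \<Rightarrow> ('a \<Rightarrow> nat) \<Rightarrow> real" where
  "hook_ops [] f = f"
| "hook_ops ((A, B) # bs) f = hook_op A B (hook_ops bs f)"

lemma highest_weight_hook_op:
  assumes "A \<subseteq> X" "B \<subseteq> X" "highest_weight X c f" shows "highest_weight X c (hook_op A B f)"
proof -
  have "highest_weight X c (\<lambda>w. f (w \<circ> r \<circ> c'))" if "r permutes A" "c' permutes B" for r c'
  proof -
    have "r \<circ> c' permutes X"
      using permutes_compose permutes_subset[OF that(1) assms(1)] permutes_subset[OF that(2) assms(2)] by blast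
    from highest_weight_comp[OF this assms(3)] show ?thesis by (simp add: comp_assoc)
  qed
  then have "highest_weight X c (\<lambda>w. \<Sum>c' | c' permutes B. of_int (sign c') * f (w \<circ> r \<circ> c'))" if "r permutes A" for r
    by (rule highest_weight_sum) (use that in simp_all)
  then have "highest_weight X c (\<lambda>w. \<Sum>r | r permutes A. 1 * (\<Sum>c' | c' permutes B. of_int (sign c') * f (w \<circ> r \<circ> c')))"
    by (rule highest_weight_sum) simp
  then show ?thesis unfolding hook_op_def by simp
qed

lemma highest_weight_hook_ops:
  assumes "\<And>A B. (A, B) \<in> set bs \<Longrightarrow> A \<subseteq> X \<and> B \<subseteq> X" "highest_weight X c f" shows "highest_weight X c (hook_ops bs f)"
  using assms(1)
proof (induction bs)
  case (Cons b bs)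
  obtain A B where b: "b = (A, B)" by (cases b)
  have "A \<subseteq> X" "B \<subseteq> X" using Cons.prems[of A B] b by auto
  moreover have "highest_weight X c (hook_ops bs f)" by (rule Cons.IH) (use Cons.prems in auto)
  ultimately show ?case by (simp add: b highest_weight_hook_op)
qed (simp add: assms(2))

lemma hook_op_sym:
  assumes "r permutes A" shows "hook_op A B f (w \<circ> r) = hook_op A B f w"
  unfolding hook_op_def
  using sum_perm_comp_left[OF assms, of "\<lambda>r. \<Sum>c | c permutes B. of_int (sign c) * f (w \<circ> r \<circ> c)"]
  by (simp only: comp_assoc)

lemma hook_op_antisym:
  assumes "finite B" "A \<inter> B = {}" and c: "c permutes B"
  shows "hook_op A B f (w \<circ> c) = of_int (sign c) * hook_op A B f w"
proof -
  have "(\<Sum>c' | c' permutes B. of_int (sign c') * f (w \<circ> c \<circ> r \<circ> c'))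
      = of_int (sign c) * (\<Sum>c' | c' permutes B. of_int (sign c') * f (w \<circ> r \<circ> c'))"
    if r: "r permutes A" for r
  proof -
    have "(\<Sum>c' | c' permutes B. of_int (sign c') * f (w \<circ> c \<circ> r \<circ> c'))
       = (\<Sum>c' | c' permutes B. of_int (sign c) * (of_int (sign (c \<circ> c')) * f (w \<circ> r \<circ> (c \<circ> c'))))"
    proof (intro sum.cong refl)
      fix c' assume "c' \<in> {c'. c' permutes B}"
      then have s: "sign (c \<circ> c') = sign c * sign c'"
        using permutes_imp_permutation[OF assms(1)] c by (simp add: sign_compose)
      have "real_of_int (sign c) * real_of_int (sign c) = 1" by (simp flip: of_int_mult)
      then have "real_of_int (sign c') = real_of_int (sign c) * real_of_int (sign (c \<circ> c'))"
        by (simp add: s flip: mult.assoc)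
      moreover have "w \<circ> c \<circ> r \<circ> c' = w \<circ> r \<circ> (c \<circ> c')"
        using disjoint_permutes_commute[OF r c assms(2)] by (metis comp_assoc)
      ultimately show "of_int (sign c') * f (w \<circ> c \<circ> r \<circ> c')
          = of_int (sign c) * (of_int (sign (c \<circ> c')) * f (w \<circ> r \<circ> (c \<circ> c')))" by simp
    qed
    also have "\<dots> = of_int (sign c) * (\<Sum>c' | c' permutes B. of_int (sign (c \<circ> c')) * f (w \<circ> r \<circ> (c \<circ> c')))"
      by (simp only: sum_distrib_left)
    also have "\<dots> = of_int (sign c) * (\<Sum>c' | c' permutes B. of_int (sign c') * f (w \<circ> r \<circ> c'))"
      using sum_perm_comp_left[OF c, of "\<lambda>c'. of_int (sign c') * f (w \<circ> r \<circ> c')"] by simp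
    finally show ?thesis .
  qed
  then show ?thesis unfolding hook_op_def sum_distrib_left by simp
qed

lemma antisym_zero:
  assumes "\<And>c. c permutes B \<Longrightarrow> F (w \<circ> c) = of_int (sign c) * F w" "x \<in> B" "y \<in> B" "x \<noteq> y" "w x = w y"
  shows "F w = (0::real)"
proof -
  have "w \<circ> transpose x y = w" using assms(5) by (auto simp: fun_eq_iff transpose_def)
  then have "F w = of_int (sign (transpose x y)) * F w"
    using assms(1)[of "transpose x y"] assms(2,3) by (simp add: permutes_swap_id)
  then show ?thesis using assms(4) by (simp add: sign_swap_id)
qed

section \<open>Removal of the first principal hook\<close>

definition inner :: "(nat \<times> nat) set \<Rightarrow> (nat \<times> nat) set" where
  "inner D = {(i, j). (Suc i, Suc j) \<in> D}"

text \<open>For \<open>p\<close> below the Durfee size this is the arm of the \<open>p\<close>-th principal hook including the corner, and 0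
  beyond it (truncated subtraction); for symmetric \<open>D\<close> the hook length is \<open>2 * arm D p - 1\<close>.\<close>

definition arm :: "(nat \<times> nat) set \<Rightarrow> nat \<Rightarrow> nat" where "arm D p = rows D p - p"

lemma inner_ferrers: "ferrers D \<Longrightarrow> ferrers (inner D)"
  unfolding ferrers_def inner_def
proof (intro conjI allI impI; elim conjE)
  assume "finite D"
  then have "finite ((\<lambda>(i, j). (i - 1, j - 1)) ` D)" by simp
  then show "finite {(i, j). (Suc i, Suc j) \<in> D}"
    by (rule rev_finite_subset) force
next
  fix i j i' j'
  assume "(i, j) \<in> {(i, j). (Suc i, Suc j) \<in> D}" "i' \<le> i" "j' \<le> j"
    and *: "\<forall>i j i' j'. (i, j) \<in> D \<longrightarrow> i' \<le> i \<longrightarrow> j' \<le> j \<longrightarrow> (i', j') \<in> D"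
  then have "(Suc i, Suc j) \<in> D" "Suc i' \<le> Suc i" "Suc j' \<le> Suc j" by auto
  then show "(i', j') \<in> {(i, j). (Suc i, Suc j) \<in> D}" using * by blast
qed

lemma rows_inner: assumes "ferrers D" shows "rows (inner D) i = rows D (Suc i) - 1"
proof -
  have "j < rows (inner D) i \<longleftrightarrow> j < rows D (Suc i) - 1" for j
    using ferrers_rows[OF inner_ferrers[OF assms], of i j] ferrers_rows[OF assms, of "Suc i" "Suc j"]
    by (auto simp: inner_def)
  from this[of "rows (inner D) i"] this[of "rows D (Suc i) - 1"] show ?thesis by linarith
qed

lemma arm_inner: "ferrers D \<Longrightarrow> arm (inner D) p = arm D (Suc p)"
  by (simp add: arm_def rows_inner)

text \<open>If \<open>F\<close> is antisymmetric in as many letters \<open>B\<close> as there are rows, then it is determined by the words in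
  which \<open>B\<close> meets every row once, in the order \<open>\<beta>\<close>; if it is also symmetric in \<open>A\<close> then the raising relations
  determine it by the words in which \<open>A\<close> fills up the first row. Restricting to these words removes the
  first principal hook.\<close>

locale hook_removal =
  fixes X A B :: "'a set" and D :: "(nat \<times> nat) set" and \<beta> :: "'a \<Rightarrow> nat"
  assumes X: "finite X" and AB: "A \<subseteq> X" "B \<subseteq> X" "A \<inter> B = {}"
    and D: "ferrers D" and sym: "\<And>i j. (i, j) \<in> D \<Longrightarrow> (j, i) \<in> D"
    and \<beta>: "bij_betw \<beta> B {..<rows D 0}" and cardA: "Suc (card A) = rows D 0"
begin

definition "X' = X - A - B"

text \<open>The default 0 puts the letters of \<open>A\<close> into row 0 and also serves the
  letters outside \<open>X\<close>, where words vanish.\<close>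

definition merge :: "('a \<Rightarrow> nat) \<Rightarrow> 'a \<Rightarrow> nat" where
  "merge u = (\<lambda>x. if x \<in> B then \<beta> x else if x \<in> X' then Suc (u x) else 0)"

text \<open>\<open>merge\<close> ignores \<open>u\<close> off \<open>X'\<close>, while words on
  \<open>X'\<close> vanish there; the guard keeps the support of \<open>restr F\<close> among such
  words.\<close>

definition restr :: "(('a \<Rightarrow> nat) \<Rightarrow> real) \<Rightarrow> ('a \<Rightarrow> nat) \<Rightarrow> real" where
  "restr F u = (if \<forall>x. x \<notin> X' \<longrightarrow> u x = 0 then F (merge u) else 0)"

text \<open>By symmetry the first column is as long as the first row.\<close>

lemma rows_pos: "rows D i > 0 \<longleftrightarrow> i < rows D 0"
  using ferrers_rows[OF D, of i 0] ferrers_rows[OF D, of 0 i] sym by blast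

lemma finB: "finite B" and finA: "finite A"
  using finite_subset[OF AB(2) X] finite_subset[OF AB(1) X] by simp_all

lemma X'_disj: "x \<in> X' \<Longrightarrow> x \<in> X \<and> x \<notin> A \<and> x \<notin> B" by (simp add: X'_def)

text \<open>Raising from \<open>i\<close> to \<open>j\<close> in \<open>u\<close> is raising from
  \<open>Suc i\<close> to \<open>Suc j\<close> in \<open>merge u\<close>, where the only extra term
  raises the letter of \<open>B\<close> in row \<open>Suc i\<close>. That term vanishes: either
  \<open>B\<close> then has two letters in row \<open>Suc j\<close>, or that row of \<open>D\<close>
  is empty.\<close>

lemma highest_weight_restr:
  assumes F: "highest_weight X (rows D) F" and anti: "\<And>c w. c permutes B \<Longrightarrow> F (w \<circ> c) = of_int (sign c) * F w"
  shows "highest_weight X' (rows (inner D)) (restr F)"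
  unfolding highest_weight_def
proof (intro conjI allI impI)
  fix u assume nz: "restr F u \<noteq> 0"
  then have u: "\<forall>x. x \<notin> X' \<longrightarrow> u x = 0" and "F (merge u) \<noteq> 0" by (auto simp: restr_def split: if_splits)
  then have w: "merge u \<in> words X (rows D)" using F by (simp add: highest_weight_def)
  have "card {x\<in>X'. u x = i} = rows (inner D) i" for i
  proof -
    have eq: "{x\<in>X. merge u x = Suc i} = {x\<in>X'. u x = i} \<union> {b\<in>B. \<beta> b = Suc i}"
      using AB by (auto simp: merge_def X'_def)
    have "card {x\<in>X. merge u x = Suc i} = card {x\<in>X'. u x = i} + card {b\<in>B. \<beta> b = Suc i}"
      unfolding eq by (rule card_Un_disjoint) (use X finB in \<open>auto simp: X'_def\<close>)
    moreover have "card {b\<in>B. \<beta> b = Suc i} = (if Suc i < rows D 0 then 1 else 0)"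
    proof (cases "Suc i < rows D 0")
      case True
      then obtain b where b: "b \<in> B" "\<beta> b = Suc i" using \<beta> by (metis bij_betw_iff_bijections lessThan_iff)
      then have "{b\<in>B. \<beta> b = Suc i} = {b}" using \<beta> by (auto simp: bij_betw_def inj_on_def)
      then show ?thesis using True by simp
    next
      case False
      then have "{b\<in>B. \<beta> b = Suc i} = {}" using bij_betwE[OF \<beta>] by force
      then show ?thesis using False by (simp only: card.empty if_False)
    qed
    ultimately show ?thesis
      using w rows_pos[of "Suc i"] by (auto simp: words_def rows_inner[OF D])
  qed
  then show "u \<in> words X' (rows (inner D))" using u by (simp add: words_def)
next
  fix i j :: nat and u assume ij: "i < j"
  show "(\<Sum>x\<in>{x\<in>X'. u x = i}. restr F (u(x := j))) = 0"
  proof (cases "\<forall>x. x \<notin> X' \<longrightarrow> u x = 0")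
    case True
    have "restr F (u(x := j)) = F ((merge u)(x := Suc j))" if "x \<in> {x\<in>X'. u x = i}" for x
    proof -
      have "merge (u(x := j)) = (merge u)(x := Suc j)" using that by (auto simp: merge_def X'_def)
      then show ?thesis using that True by (auto simp: restr_def)
    qed
    then have "(\<Sum>x\<in>{x\<in>X'. u x = i}. restr F (u(x := j)))
        = (\<Sum>x\<in>{x\<in>X'. u x = i}. F ((merge u)(x := Suc j)))" by simp
    also have "\<dots> = (\<Sum>x\<in>{x\<in>X. merge u x = Suc i}. F ((merge u)(x := Suc j)))"
    proof (rule sum.mono_neutral_left)
      show "finite {x \<in> X. merge u x = Suc i}" using X by simp
      show "{x \<in> X'. u x = i} \<subseteq> {x \<in> X. merge u x = Suc i}" by (auto simp: merge_def X'_def)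
      show "\<forall>x\<in>{x \<in> X. merge u x = Suc i} - {x \<in> X'. u x = i}. F ((merge u)(x := Suc j)) = 0"
      proof
        fix b assume "b \<in> {x \<in> X. merge u x = Suc i} - {x \<in> X'. u x = i}"
        then have b: "b \<in> B" "\<beta> b = Suc i" by (auto simp: merge_def split: if_splits)
        show "F ((merge u)(b := Suc j)) = 0"
        proof (cases "Suc j < rows D 0")
          case True
          then obtain b' where b': "b' \<in> B" "\<beta> b' = Suc j" using \<beta> by (metis bij_betw_iff_bijections lessThan_iff)
          show ?thesis
            by (rule antisym_zero[OF anti b(1) b'(1)]) (use b b' ij in \<open>auto simp: merge_def\<close>)
        next
          case False
          then have "rows D (Suc j) = 0" using rows_pos[of "Suc j"] by simp
          moreover define S where "S = {x\<in>X. ((merge u)(b := Suc j)) x = Suc j}"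
          have "b \<in> S" using b AB by (auto simp: S_def)
          moreover have "finite S" using X by (simp add: S_def)
          ultimately have "card S \<noteq> rows D (Suc j)" by auto
          moreover have "card S = rows D (Suc j)" if "(merge u)(b := Suc j) \<in> words X (rows D)"
            using that unfolding words_def S_def by blast
          ultimately have "(merge u)(b := Suc j) \<notin> words X (rows D)" by blast
          then show ?thesis using F unfolding highest_weight_def by blast
        qed
      qed
    qed
    also have "\<dots> = 0" using F ij unfolding highest_weight_def by (meson Suc_less_eq)
    finally show ?thesis .
  next
    case False
    then obtain y where "y \<notin> X'" "u y \<noteq> 0" by blast
    then have "restr F (u(x := j)) = 0" if "x \<in> X'" for x using that by (auto simp: restr_def)
    then show ?thesis by simp
  qed
qed

text \<open>The relation for raising a letter \<open>a \<in> A\<close> from row \<open>i\<close> to row 0 has \<open>F w\<close> with a positive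
  coefficient, and in all other nonzero terms one letter outside \<open>A \<union> B\<close> has been traded for \<open>a\<close> in row 0.\<close>

lemma restr_ne0:
  assumes F: "highest_weight X (rows D) F" and anti: "\<And>c w. c permutes B \<Longrightarrow> F (w \<circ> c) = of_int (sign c) * F w"
    and symm: "\<And>r w. r permutes A \<Longrightarrow> F (w \<circ> r) = F w" and nz: "F w \<noteq> 0"
  shows "\<exists>u. restr F u \<noteq> 0"
proof -
  have supp: "w \<in> words X (rows D)" if "F w \<noteq> 0" for w using F that by (simp add: highest_weight_def)
  have lt: "w x < rows D 0" if "F w \<noteq> 0" "x \<in> X" for w x
  proof -
    have "card {y\<in>X. w y = w x} \<noteq> 0" using X that(2) by auto
    then show ?thesis using supp[OF that(1)] rows_pos[of "w x"] by (simp add: words_def)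
  qed
  have injB: "inj_on w B" if "F w \<noteq> 0" for w
  proof (rule inj_onI, rule ccontr)
    fix x y assume "x \<in> B" "y \<in> B" "w x = w y" "x \<noteq> y"
    then show False using antisym_zero[OF anti] that by blast
  qed
  have cardB: "card B = rows D 0" using bij_betw_same_card[OF \<beta>] by simp
  have bijB: "bij_betw w B {..<rows D 0}" if "F w \<noteq> 0" for w
  proof -
    have "w ` B \<subseteq> {..<rows D 0}" using lt[OF that] AB by blast
    moreover have "card (w ` B) = card {..<rows D 0}" using card_image[OF injB[OF that]] cardB by simp
    ultimately have "w ` B = {..<rows D 0}" by (intro card_subset_eq) simp_all
    then show ?thesis using injB[OF that] by (simp add: bij_betw_def)
  qed
  \<comment> \<open>A permutation of \<open>B\<close> brings its letters into the order
    \<open>\<beta>\<close>; by antisymmetry this changes \<open>F\<close> only by a sign.\<close>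
  have "\<exists>w1. F w1 \<noteq> 0 \<and> (\<forall>b\<in>B. w1 b = \<beta> b)"
  proof -
    define c where "c = (\<lambda>x. if x \<in> B then inv_into B w (\<beta> x) else x)"
    have "bij_betw (inv_into B w \<circ> \<beta>) B B"
      by (rule bij_betw_trans[OF \<beta> bij_betw_inv_into[OF bijB[OF nz]]])
    then have "bij_betw c B B" by (rule bij_betw_cong[THEN iffD1, rotated]) (auto simp: c_def)
    then have c: "c permutes B" by (rule bij_imp_permutes) (simp add: c_def)
    have "(w \<circ> c) b = \<beta> b" if "b \<in> B" for b
      using that bij_betw_inv_into_right[OF bijB[OF nz], of "\<beta> b"] \<beta> by (auto simp: c_def bij_betw_def)
    moreover have "F (w \<circ> c) \<noteq> 0" using anti[OF c, of w] nz by simp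
    ultimately show ?thesis by blast
  qed
  then obtain w1 where w1: "F w1 \<noteq> 0" "\<forall>b\<in>B. w1 b = \<beta> b" by blast
  obtain b0 where b0: "b0 \<in> B" "\<beta> b0 = 0"
    using \<beta> cardA by (metis bij_betw_iff_bijections lessThan_iff zero_less_Suc)
  have "\<exists>w2. F w2 \<noteq> 0 \<and> (\<forall>b\<in>B. w2 b = \<beta> b) \<and> (\<forall>a\<in>A. w2 a = 0)" using w1
  proof (induction "card {a\<in>A. w1 a \<noteq> 0}" arbitrary: w1 rule: less_induct)
    case less
    show ?case
    proof (cases "\<forall>a\<in>A. w1 a = 0")
      case False
      then obtain a where a: "a \<in> A" "w1 a \<noteq> 0" by blast
      define i where "i = w1 a"
      define u where "u = w1(a := 0)"
      have aX: "a \<in> X" "a \<notin> B" using a AB by auto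
      have i: "0 < i" "i < rows D 0" using a lt[OF less.prems(1) aX(1)] by (auto simp: i_def)
      let ?R = "{x\<in>X. u x = 0}"
      have sum0: "(\<Sum>x\<in>?R. F (u(x := i))) = 0" using F i(1) unfolding highest_weight_def by blast
      have same: "F (u(x := i)) = F w1" if "x \<in> ?R \<inter> A" for x
      proof -
        have "u(x := i) = w1 \<circ> transpose a x"
          using that by (auto simp: u_def i_def fun_eq_iff transpose_def)
        then show ?thesis using symm[of "transpose a x" w1] a that by (simp add: permutes_swap_id)
      qed
      \<comment> \<open>The letter \<open>x\<close> would join the letter of \<open>B\<close> that
        already lies in row \<open>i\<close>.\<close>
      have zero: "F (u(x := i)) = 0" if "x \<in> B" "u x = 0" for x
      proof -
        obtain b where b: "b \<in> B" "\<beta> b = i" using \<beta> i(2) by (metis bij_betw_iff_bijections lessThan_iff)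
        have "u b = i" using b less.prems(2) aX by (auto simp: u_def)
        then have "b \<noteq> x" using that i(1) by auto
        show ?thesis
          by (rule antisym_zero[OF anti that(1) b(1)]) (use \<open>b \<noteq> x\<close> \<open>u b = i\<close> in auto)
      qed
      have "\<exists>x\<in>?R - A - B. F (u(x := i)) \<noteq> 0"
      proof (rule ccontr)
        assume no: "\<not> ?thesis"
        have "(\<Sum>x\<in>?R. F (u(x := i))) = (\<Sum>x\<in>?R \<inter> A. F (u(x := i)))"
          by (rule sum.mono_neutral_right) (use X no zero in auto)
        also have "\<dots> = real (card (?R \<inter> A)) * F w1" using same by simp
        finally have "card (?R \<inter> A) = 0" using sum0 less.prems(1) by simp
        moreover have "a \<in> ?R \<inter> A" using a aX by (simp add: u_def)
        ultimately show False using X by auto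
      qed
      then obtain x where x: "x \<in> ?R - A - B" "F (u(x := i)) \<noteq> 0" by blast
      have "{a\<in>A. (u(x := i)) a \<noteq> 0} \<subset> {a\<in>A. w1 a \<noteq> 0}"
        using a x(1) by (auto simp: u_def)
      then have "card {a\<in>A. (u(x := i)) a \<noteq> 0} < card {a\<in>A. w1 a \<noteq> 0}"
        using finA by (intro psubset_card_mono) auto
      moreover have "\<forall>b\<in>B. (u(x := i)) b = \<beta> b" using less.prems(2) x(1) aX by (auto simp: u_def)
      ultimately show ?thesis using less.hyps x(2) by blast
    qed (use less.prems in blast)
  qed
  then obtain w2 where w2: "F w2 \<noteq> 0" "\<forall>b\<in>B. w2 b = \<beta> b" "\<forall>a\<in>A. w2 a = 0" by blast
  have words2: "w2 \<in> words X (rows D)" using supp[OF w2(1)] .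
  \<comment> \<open>By cardinality \<open>A\<close> and \<open>b0\<close> fill row 0, so all letters
    of \<open>X'\<close> lie in later rows and can be shifted down by one.\<close>
  have row0: "{x\<in>X. w2 x = 0} = insert b0 A"
  proof (rule card_subset_eq[symmetric])
    show "insert b0 A \<subseteq> {x\<in>X. w2 x = 0}" using w2 b0 AB by auto
    show "card (insert b0 A) = card {x\<in>X. w2 x = 0}"
      using words2 b0 AB finA cardA by (subst card_insert_disjoint) (auto simp: words_def)
  qed (use X in simp)
  define u where "u = (\<lambda>x. if x \<in> X' then w2 x - 1 else 0)"
  have "merge u = w2"
  proof
    fix x
    show "merge u x = w2 x"
    proof (cases "x \<in> X'")
      case True
      then have "x \<in> X" "x \<notin> insert b0 A" using b0 X'_disj[OF True] by auto
      then have "w2 x \<noteq> 0" unfolding row0[symmetric] by simp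
      then show ?thesis using True X'_disj[OF True] by (simp add: merge_def u_def)
    next
      case False
      then show ?thesis using w2 words2 by (auto simp: merge_def X'_def words_def)
    qed
  qed
  then have "restr F u \<noteq> 0" using w2(1) by (simp add: restr_def u_def)
  then show ?thesis by blast
qed

lemma restr_hook_op:
  assumes "A2 \<subseteq> X'" "B2 \<subseteq> X'"
  shows "restr (hook_op A2 B2 F) = hook_op A2 B2 (restr F)"
proof
  fix u :: "'a \<Rightarrow> nat"
  have p: "r \<circ> c permutes X'" if "r permutes A2" "c permutes B2" for r c
    using permutes_compose permutes_subset[OF that(1) assms(1)] permutes_subset[OF that(2) assms(2)] by blast
  have good: "(\<forall>x. x \<notin> X' \<longrightarrow> (u \<circ> g) x = 0) \<longleftrightarrow> (\<forall>x. x \<notin> X' \<longrightarrow> u x = 0)" if "g permutes X'" for g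
    using permutes_not_in[OF that] by (auto simp: comp_def)
  have mg: "merge (u \<circ> g) = merge u \<circ> g" if "g permutes X'" for g :: "'a \<Rightarrow> 'a"
  proof
    fix x show "merge (u \<circ> g) x = (merge u \<circ> g) x"
      using permutes_in_image[OF that, of x] permutes_not_in[OF that, of x] X'_disj[of x] X'_disj[of "g x"]
      by (cases "x \<in> X'") (auto simp: merge_def)
  qed
  define P where "P = (\<forall>x. x \<notin> X' \<longrightarrow> u x = 0)"
  have "restr F (u \<circ> r \<circ> c) = (if P then F (merge u \<circ> r \<circ> c) else 0)"
    if "r permutes A2" "c permutes B2" for r c
    unfolding restr_def comp_assoc mg[OF p[OF that]] good[OF p[OF that]] P_def ..
  then have "hook_op A2 B2 (restr F) u = (\<Sum>r | r permutes A2. \<Sum>c | c permutes B2.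
      of_int (sign c) * (if P then F (merge u \<circ> r \<circ> c) else 0))"
    unfolding hook_op_def by simp
  also have "\<dots> = restr (hook_op A2 B2 F) u"
    unfolding restr_def P_def[symmetric] hook_op_def by (cases P) simp_all
  finally show "restr (hook_op A2 B2 F) u = hook_op A2 B2 (restr F) u" ..
qed

lemma restr_hook_ops:
  assumes "\<And>A B. (A, B) \<in> set bs \<Longrightarrow> A \<subseteq> X' \<and> B \<subseteq> X'"
  shows "restr (hook_ops bs F) = hook_ops bs (restr F)"
  using assms
proof (induction bs)
  case (Cons b bs)
  obtain A2 B2 where b: "b = (A2, B2)" by (cases b)
  have "A2 \<subseteq> X'" "B2 \<subseteq> X'" using Cons.prems[of A2 B2] b by auto
  moreover have "restr (hook_ops bs F) = hook_ops bs (restr F)" by (rule Cons.IH) (use Cons.prems in auto)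
  ultimately show ?case by (simp add: b restr_hook_op)
qed simp

end

lemma hook_op_comm:
  assumes "A \<union> B \<subseteq> Y" "A2 \<union> B2 \<subseteq> Z" "Y \<inter> Z = {}"
  shows "hook_op A B (hook_op A2 B2 f) = hook_op A2 B2 (hook_op A B f)"
proof
  fix w
  have "hook_op A B (hook_op A2 B2 f) w = (\<Sum>r | r permutes A. \<Sum>c | c permutes B. \<Sum>r2 | r2 permutes A2. \<Sum>c2 | c2 permutes B2.
     of_int (sign c) * (of_int (sign c2) * f (w \<circ> r \<circ> c \<circ> r2 \<circ> c2)))"
    by (simp add: hook_op_def sum_distrib_left)
  also have "\<dots> = (\<Sum>r | r permutes A. \<Sum>c | c permutes B. \<Sum>r2 | r2 permutes A2. \<Sum>c2 | c2 permutes B2.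
     of_int (sign c2) * (of_int (sign c) * f (w \<circ> r2 \<circ> c2 \<circ> r \<circ> c)))"
  proof (intro sum.cong refl)
    fix r c r2 c2 assume "r \<in> {r. r permutes A}" "c \<in> {c. c permutes B}" "r2 \<in> {r. r permutes A2}" "c2 \<in> {c. c permutes B2}"
    then have "r \<circ> c permutes Y" "r2 \<circ> c2 permutes Z"
      using assms by (auto intro!: permutes_compose elim: permutes_subset)
    then have "(r \<circ> c) \<circ> (r2 \<circ> c2) = (r2 \<circ> c2) \<circ> (r \<circ> c)" by (rule disjoint_permutes_commute[OF _ _ assms(3)])
    then have "w \<circ> r \<circ> c \<circ> r2 \<circ> c2 = w \<circ> r2 \<circ> c2 \<circ> r \<circ> c" by (metis comp_assoc)
    then show "of_int (sign c) * (of_int (sign c2) * f (w \<circ> r \<circ> c \<circ> r2 \<circ> c2))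
       = of_int (sign c2) * (of_int (sign c) * f (w \<circ> r2 \<circ> c2 \<circ> r \<circ> c))" by simp
  qed
  also have "\<dots> = (\<Sum>r2 | r2 permutes A2. \<Sum>c2 | c2 permutes B2. \<Sum>r | r permutes A. \<Sum>c | c permutes B.
     of_int (sign c2) * (of_int (sign c) * f (w \<circ> r2 \<circ> c2 \<circ> r \<circ> c)))"
    unfolding sum.cartesian_product by (rule sum.reindex_bij_witness[of _ "\<lambda>(a,b,c,d). (c,d,a,b)" "\<lambda>(a,b,c,d). (c,d,a,b)"]) auto
  also have "\<dots> = hook_op A2 B2 (hook_op A B f) w"
    by (simp add: hook_op_def sum_distrib_left)
  finally show "hook_op A B (hook_op A2 B2 f) w = hook_op A2 B2 (hook_op A B f) w" .
qed

text \<open>A block stands for a cycle of odd length, cut into two halves whose sizes differ by 1;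
  the blocks exhaust \<open>X\<close>.\<close>

fun blocks :: "'a set \<Rightarrow> ('a set \<times> 'a set) list \<Rightarrow> bool" where
  "blocks X [] \<longleftrightarrow> X = {}"
| "blocks X ((A, B) # bs) \<longleftrightarrow> A \<inter> B = {} \<and> A \<subseteq> X \<and> B \<subseteq> X \<and> card B = Suc (card A) \<and> blocks (X - A - B) bs"

lemma blocks_subset: "blocks X bs \<Longrightarrow> (A, B) \<in> set bs \<Longrightarrow> A \<subseteq> X \<and> B \<subseteq> X"
  by (induction X bs rule: blocks.induct) auto

lemma hook_ops_comm:
  assumes "\<And>A2 B2. (A2, B2) \<in> set bs \<Longrightarrow> A2 \<union> B2 \<subseteq> Z" "(A \<union> B) \<inter> Z = {}"
  shows "hook_op A B (hook_ops bs f) = hook_ops bs (hook_op A B f)"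
  using assms(1)
proof (induction bs)
  case (Cons b bs)
  obtain A2 B2 where b: "b = (A2, B2)" by (cases b)
  have "hook_op A B (hook_op A2 B2 (hook_ops bs f)) = hook_op A2 B2 (hook_op A B (hook_ops bs f))"
    by (rule hook_op_comm[OF order_refl _ assms(2)]) (use Cons.prems b in auto)
  moreover have "hook_op A B (hook_ops bs f) = hook_ops bs (hook_op A B f)" by (rule Cons.IH) (use Cons.prems in auto)
  ultimately show ?case by (simp add: b)
qed simp

text \<open>Padding with zeros makes a list comparable with \<open>arm D\<close>, which is 0 beyond
  the Durfee size.\<close>

definition nth_or_0 :: "nat list \<Rightarrow> nat \<Rightarrow> nat" where "nth_or_0 l p = (if p < length l then l ! p else 0)"

text \<open>Antisymmetry in the \<open>B\<close> of the first block needs \<open>card B\<close>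
  different rows, and a symmetric diagram has \<open>rows D 0 = arm D 0\<close> of them. If
  \<open>card B\<close> reaches this number, the hook can be removed and the later blocks are
  compared with \<open>inner D\<close>.\<close>

theorem lex_bound:
  assumes "finite X" "blocks X bs" "ferrers D" "\<And>i j. (i, j) \<in> D \<Longrightarrow> (j, i) \<in> D"
    and "highest_weight X (rows D) f" "hook_ops bs f w \<noteq> 0"
  shows "(\<forall>p. nth_or_0 (map (card \<circ> snd) bs) p = arm D p) \<or>
    (\<exists>p. (\<forall>q<p. nth_or_0 (map (card \<circ> snd) bs) q = arm D q) \<and> nth_or_0 (map (card \<circ> snd) bs) p < arm D p)"
  using assms
proof (induction bs arbitrary: X D f w)
  case Nil
  then have "w \<in> words X (rows D)" "X = {}" by (auto simp: highest_weight_def)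
  then have "rows D p = 0" for p by (auto simp: words_def)
  then show ?case by (simp add: nth_or_0_def arm_def)
next
  case (Cons b bs)
  obtain A B where b: "b = (A, B)" by (cases b)
  have bl: "A \<inter> B = {}" "A \<subseteq> X" "B \<subseteq> X" "card B = Suc (card A)" "blocks (X - A - B) bs"
    using Cons.prems(2) b by auto
  have finB: "finite B" using bl(3) Cons.prems(1) finite_subset by blast
  define F where "F = hook_ops (b # bs) f"
  have F: "F = hook_op A B (hook_ops bs f)" by (simp add: F_def b)
  \<comment> \<open>The blocks are disjoint, so the first operator may stand outside, which shows
    the symmetries of \<open>F\<close>, or inside, which presents \<open>F\<close> as the later
    operators applied to a highest weight vector.\<close>
  have F': "F = hook_ops bs (hook_op A B f)"
    unfolding F by (rule hook_ops_comm[where Z="X - A - B"]) (use blocks_subset[OF bl(5)] in auto)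
  have hwf: "highest_weight X (rows D) (hook_op A B f)" by (rule highest_weight_hook_op[OF bl(2,3) Cons.prems(5)])
  have hwF: "highest_weight X (rows D) F"
    unfolding F' by (rule highest_weight_hook_ops[OF _ hwf]) (use blocks_subset[OF bl(5)] in blast)
  have anti: "F (w \<circ> c) = of_int (sign c) * F w" if "c permutes B" for c w
    unfolding F by (rule hook_op_antisym[OF finB bl(1) that])
  have symm: "F (w \<circ> r) = F w" if "r permutes A" for r w unfolding F by (rule hook_op_sym[OF that])
  have nz: "F w \<noteq> 0" using Cons.prems(6) by (simp add: F_def)
  have arm0: "arm D 0 = rows D 0" by (simp add: arm_def)
  have "card B \<le> rows D 0"
  proof -
    have "inj_on w B"
    proof (rule inj_onI, rule ccontr)
      fix x y assume "x \<in> B" "y \<in> B" "w x = w y" "x \<noteq> y"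
      then show False using antisym_zero[OF anti, where w=w] nz by blast
    qed
    moreover have "w ` B \<subseteq> {..<rows D 0}"
    proof
      fix i assume "i \<in> w ` B"
      then obtain x where x: "x \<in> X" "w x = i" using bl by auto
      then have "card {y\<in>X. w y = i} \<noteq> 0" using Cons.prems(1) by auto
      then have "rows D i \<noteq> 0" using hwF nz by (auto simp: highest_weight_def words_def)
      then show "i \<in> {..<rows D 0}"
        using ferrers_rows[OF Cons.prems(3), of i 0] ferrers_rows[OF Cons.prems(3), of 0 i] Cons.prems(4) by blast
    qed
    ultimately show ?thesis using card_inj_on_le[of w B "{..<rows D 0}"] by simp
  qed
  then consider "card B < rows D 0" | "card B = rows D 0" by linarith
  then show ?case
  proof cases
    case 1
    then show ?thesis by (intro disjI2 exI[of _ 0]) (simp add: nth_or_0_def b arm0)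
  next
    case 2
    then obtain \<beta> where \<beta>: "bij_betw \<beta> B {..<rows D 0}"
      using finite_same_card_bij[OF finB, of "{..<rows D 0}"] by auto
    interpret hook_removal X A B D \<beta>
      by unfold_locales (use Cons.prems bl \<beta> 2 in auto)
    obtain u where u: "restr F u \<noteq> 0" using restr_ne0[OF hwF anti symm nz] by blast
    have "restr F = hook_ops bs (restr (hook_op A B f))"
      unfolding F' by (rule restr_hook_ops) (use blocks_subset[OF bl(5)] in \<open>simp add: X'_def\<close>)
    then have "hook_ops bs (restr (hook_op A B f)) u \<noteq> 0" using u by simp
    moreover have "highest_weight X' (rows (inner D)) (restr (hook_op A B f))"
      by (rule highest_weight_restr[OF hwf hook_op_antisym[OF finB bl(1)]])
    moreover have "(j, i) \<in> inner D" if "(i, j) \<in> inner D" for i j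
      using that Cons.prems(4) by (auto simp: inner_def)
    moreover have "finite X'" "blocks X' bs" "ferrers (inner D)"
      using Cons.prems(1) bl(5) inner_ferrers[OF Cons.prems(3)] by (simp_all add: X'_def)
    ultimately have IH: "(\<forall>p. nth_or_0 (map (card \<circ> snd) bs) p = arm (inner D) p) \<or>
      (\<exists>p. (\<forall>q<p. nth_or_0 (map (card \<circ> snd) bs) q = arm (inner D) q) \<and> nth_or_0 (map (card \<circ> snd) bs) p < arm (inner D) p)"
      by (intro Cons.IH)
    have s: "nth_or_0 (map (card \<circ> snd) (b # bs)) (Suc p) = nth_or_0 (map (card \<circ> snd) bs) p" for p
      by (simp add: nth_or_0_def)
    have z: "nth_or_0 (map (card \<circ> snd) (b # bs)) 0 = arm D 0" using 2 by (simp add: nth_or_0_def b arm0)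
    from IH show ?thesis
    proof (elim disjE exE conjE)
      assume *: "\<forall>p. nth_or_0 (map (card \<circ> snd) bs) p = arm (inner D) p"
      have "nth_or_0 (map (card \<circ> snd) (b # bs)) p = arm D p" for p
        using * z s arm_inner[OF Cons.prems(3)] by (cases p) auto
      then show ?thesis by blast
    next
      fix p assume *: "\<forall>q<p. nth_or_0 (map (card \<circ> snd) bs) q = arm (inner D) q"
        "nth_or_0 (map (card \<circ> snd) bs) p < arm (inner D) p"
      have "nth_or_0 (map (card \<circ> snd) (b # bs)) q = arm D q" if "q < Suc p" for q
        using * z s arm_inner[OF Cons.prems(3)] that by (cases q) auto
      moreover have "nth_or_0 (map (card \<circ> snd) (b # bs)) (Suc p) < arm D (Suc p)"
        using * s arm_inner[OF Cons.prems(3)] by simp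
      ultimately show ?thesis by blast
    qed
  qed
qed

section \<open>The support of the twisted characters\<close>

text \<open>In a cycle of length 2k+1 the k+1 letters at even positions get antisymmetrized and the
  k letters at odd positions symmetrized.\<close>

definition evens :: "'a list \<Rightarrow> 'a set" where "evens cs = {cs ! i | i. i < length cs \<and> even i}"
definition odds :: "'a list \<Rightarrow> 'a set" where "odds cs = {cs ! i | i. i < length cs \<and> odd i}"

lemma evens_odds: "evens cs \<union> odds cs = set cs"
  by (auto simp: evens_def odds_def set_conv_nth)

lemma evens_odds_disjoint: "distinct cs \<Longrightarrow> odds cs \<inter> evens cs = {}"
  by (auto simp: evens_def odds_def nth_eq_iff_index_eq)

lemma card_evens_odds:
  assumes "distinct cs" "odd (length cs)"
  shows "card (evens cs) = Suc (length cs) div 2" "card (evens cs) = Suc (card (odds cs))"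
proof -
  obtain a where a: "length cs = 2 * a + 1" using assms(2) by (elim oddE)
  have inj: "inj_on ((!) cs) {..<length cs}" using assms(1) by (auto simp: inj_on_def nth_eq_iff_index_eq)
  have e: "evens cs = (!) cs ` ((\<lambda>m. 2 * m) ` {..a})"
    unfolding evens_def image_image a by (auto elim!: evenE)
  have o: "odds cs = (!) cs ` ((\<lambda>m. 2 * m + 1) ` {..<a})"
    unfolding odds_def image_image a by (auto elim!: oddE)
  have "card (evens cs) = card ((\<lambda>m::nat. 2 * m) ` {..a})"
    unfolding e by (rule card_image[OF inj_on_subset[OF inj]]) (auto simp: a)
  then have ce: "card (evens cs) = Suc a" by (simp add: card_image inj_on_def)
  have "card (odds cs) = card ((\<lambda>m::nat. 2 * m + 1) ` {..<a})"
    unfolding o by (rule card_image[OF inj_on_subset[OF inj]]) (auto simp: a)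
  then have co: "card (odds cs) = a" by (simp add: card_image inj_on_def)
  show "card (evens cs) = Suc (length cs) div 2" "card (evens cs) = Suc (card (odds cs))"
    using a ce co by simp_all
qed

text \<open>If \<open>z \<circ> r \<circ> c\<close> is a single cycle then it alternates between the odd and the even positions of \<open>cs\<close>
  except for one step, so it is conjugate to \<open>z\<close> under a permutation that respects the two halves;
  otherwise it has an even cycle.\<close>

lemma block_term:
  assumes tc: "twisted_class X \<delta>" and cs: "distinct cs" "odd (length cs)" "set cs \<subseteq> X"
    and h: "h permutes Z" "Z \<subseteq> X" "set cs \<inter> Z = {}"
    and r: "r permutes odds cs" and c: "c permutes evens cs"
    and nz: "\<delta> (h \<circ> (cycle_of_list cs \<circ> r \<circ> c)) \<noteq> 0"
  shows "of_int (sign c) * \<delta> (h \<circ> (cycle_of_list cs \<circ> r \<circ> c)) = \<delta> (h \<circ> cycle_of_list cs)"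
proof -
  define A where "A = odds cs"
  define B where "B = evens cs"
  define z where "z = cycle_of_list cs"
  define z' where "z' = z \<circ> r \<circ> c"
  define k where "k = length cs"
  define x0 where "x0 = cs ! 0"
  have AB: "A \<inter> B = {}" "B \<union> A = set cs"
    using evens_odds_disjoint[OF cs(1)] evens_odds[of cs] by (auto simp: A_def B_def)
  have k: "odd k" "k > 0" using cs(2) by (auto simp: k_def intro: Nat.gr0I)
  have rA: "r permutes A" and cB: "c permutes B" using r c by (auto simp: A_def B_def)
  have x0B: "x0 \<in> B" using k by (auto simp: B_def evens_def x0_def k_def)
  have zA: "z x \<in> B" if xA: "x \<in> A" for x
  proof -
    obtain i where i: "x = cs ! i" "i < k" "odd i" using xA by (auto simp: A_def odds_def k_def)
    then have "Suc i \<noteq> k" using k(1) by auto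
    then have "Suc i < k" using i(2) by simp
    then show ?thesis using cycle_of_list_nth[OF cs(1), of i] i by (auto simp: z_def B_def evens_def k_def)
  qed
  \<comment> \<open>The exception is the step from the last position to the first: both are even
    because the length is odd.\<close>
  have zB: "z x \<in> A \<or> z x = x0" if xB: "x \<in> B" for x
  proof -
    obtain i where i: "x = cs ! i" "i < k" "even i" using xB by (auto simp: B_def evens_def k_def)
    show ?thesis
    proof (cases "Suc i < k")
      case True
      then show ?thesis using cycle_of_list_nth[OF cs(1), of i] i by (auto simp: z_def A_def odds_def k_def)
    next
      case False
      then have "Suc i = k" using i(2) by simp
      then have "Suc i mod k = 0" by simp
      then show ?thesis using cycle_of_list_nth[OF cs(1), of i] i by (simp add: z_def x0_def k_def)
    qed
  qed
  have rc: "r (c x) = r x" "r x \<in> A" if "x \<in> A" for x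
  proof -
    have "x \<notin> B" using that AB(1) by blast
    then show "r (c x) = r x" "r x \<in> A"
      using that permutes_not_in[OF cB] permutes_in_image[OF rA] by simp_all
  qed
  have cr: "r (c x) = c x" "c x \<in> B" if "x \<in> B" for x
  proof -
    show cx: "c x \<in> B" using that permutes_in_image[OF cB] by simp
    then have "c x \<notin> A" using AB(1) by blast
    then show "r (c x) = c x" by (rule permutes_not_in[OF rA])
  qed
  have z'A: "z' x \<in> B" if "x \<in> A" for x using zA rc[OF that] by (simp add: z'_def)
  have z'B: "z' x \<in> A \<or> z' x = x0" if "x \<in> B" for x using zB cr[OF that] by (simp add: z'_def)
  have zp: "z permutes set cs" unfolding z_def by (rule cycle_permutes)
  have rp: "r permutes set cs" using rA by (rule permutes_subset) (use AB in auto)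
  have cp: "c permutes set cs" using cB by (rule permutes_subset) (use AB in auto)
  have z'p: "z' permutes set cs"
    unfolding z'_def by (rule permutes_compose[OF cp permutes_compose[OF rp zp]])
  obtain L where L: "cycles_of (set cs) z' L" by (rule ex_cycles_of[OF z'p finite_set])
  have nz': "\<delta> (h \<circ> z') \<noteq> 0" using nz by (simp add: z'_def z_def)
  have oddL: "odd (length ds)" if "ds \<in> set L" for ds
    by (rule twisted_class_odd[OF tc L h(1) h(3) cs(3) h(2) nz' that])
  have Lp: "distinct (concat L)" "set (concat L) = set cs" "z' = cyc_prod L" using L by (auto simp: cycles_of_def)
  have dsd: "distinct ds" "set ds \<subseteq> set cs" if "ds \<in> set L" for ds
    using Lp(1) that Lp(2) by (auto simp: distinct_concat_iff)
  have step: "z' (ds ! i) = ds ! (Suc i mod length ds)" if "ds \<in> set L" "i < length ds" for ds i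
    using cyc_prod_apply[OF Lp(1) that(1), of "ds ! i"] cycle_of_list_nth[OF dsd(1)[OF that(1)] that(2)] that(2) Lp(3)
    by simp
  have flip: "z' x \<in> B \<longleftrightarrow> x \<notin> B" if "x \<in> set cs" "z' x \<noteq> x0" for x
    using z'A[of x] z'B[of x] that AB by blast
  \<comment> \<open>A cycle of \<open>z'\<close> that avoids \<open>x0\<close> would alternate
    between the halves and have even length. So every cycle contains \<open>x0\<close>, and there is
    only one.\<close>
  have x0_in: "x0 \<in> set ds" if ds: "ds \<in> set L" for ds
  proof (rule ccontr)
    assume no: "x0 \<notin> set ds"
    have ne: "ds ! i \<noteq> x0" if "i < length ds" for i using no that nth_mem by metis
    have len: "length ds > 0" using oddL[OF ds] by (auto intro: Nat.gr0I)
    have alt: "ds ! i \<in> B \<longleftrightarrow> (ds ! 0 \<in> B \<longleftrightarrow> even i)" if "i < length ds" for i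
      using that
    proof (induction i)
      case (Suc i)
      then have "z' (ds ! i) = ds ! Suc i" using step[OF ds, of i] by simp
      moreover have "ds ! i \<in> set cs" using dsd(2)[OF ds] Suc.prems nth_mem[of i ds] by auto
      ultimately have "ds ! Suc i \<in> B \<longleftrightarrow> ds ! i \<notin> B"
        using flip[of "ds ! i"] ne[OF Suc.prems] by simp
      then show ?case using Suc by auto
    qed simp
    let ?l = "length ds - 1"
    have l: "?l < length ds" "even ?l" using len oddL[OF ds] by auto
    have "z' (ds ! ?l) = ds ! 0" using step[OF ds l(1)] len by simp
    moreover have "ds ! ?l \<in> set cs" using dsd(2)[OF ds] l(1) nth_mem[of ?l ds] by auto
    ultimately have "ds ! 0 \<in> B \<longleftrightarrow> ds ! ?l \<notin> B" using flip[of "ds ! ?l"] ne[OF len] by simp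
    then show False using alt[OF l(1)] l(2) by auto
  qed
  have "L \<noteq> []" using Lp(2) x0B AB(2) by auto
  then obtain ds L1 where L1: "L = ds # L1" by (cases L) auto
  have "L1 = []"
  proof (cases L1)
    case (Cons d2 L2)
    then have "x0 \<in> set ds" "x0 \<in> set d2" using x0_in L1 by auto
    then show ?thesis using Lp(1) L1 Cons by auto
  qed
  then have z'ds: "z' = cycle_of_list ds" and dsset: "set ds = set cs" and dsd: "distinct ds" and dsx: "x0 \<in> set ds"
    using Lp L1 x0_in by auto
  have dslen: "length ds = k" using dsset dsd cs(1) by (metis distinct_card k_def)
  obtain i0 where i0: "i0 < length ds" "ds ! i0 = x0" using dsx by (auto simp: in_set_conv_nth)
  \<comment> \<open>Started at \<open>x0\<close>, the new cycle passes through the halves in the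
    same pattern as \<open>cs\<close>, so the permutation \<open>h0\<close> carrying
    \<open>cs\<close> to \<open>es\<close> preserves \<open>A\<close> and \<open>B\<close>.\<close>
  define es where "es = rotate i0 ds"
  have es: "distinct es" "set es = set cs" "length es = k" "z' = cycle_of_list es"
    using dsd dsset dslen cycle_of_list_rotate_independent[OF dsd, of i0] z'ds by (auto simp: es_def)
  have es0: "es ! 0 = x0" using nth_rotate[of 0 ds i0] i0 k dslen by (simp add: es_def)
  obtain h0 where h0: "h0 permutes set cs" "map h0 cs = es"
    by (rule ex_perm_map[OF cs(1) es(1) _ refl es(2)]) (use es(3) in \<open>simp_all add: k_def\<close>)
  have h0n: "h0 (cs ! i) = es ! i" if "i < k" for i using h0(2) that by (auto simp: k_def)
  have esB: "es ! i \<in> B \<longleftrightarrow> even i" if "i < k" for i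
    using that
  proof (induction i)
    case 0
    then show ?case using es0 x0B by simp
  next
    case (Suc i)
    then have "z' (es ! i) = es ! Suc i" using cycle_of_list_nth[OF es(1), of i] es by simp
    moreover have "es ! Suc i \<noteq> x0"
      using nth_eq_iff_index_eq[OF es(1), of "Suc i" 0] es0 es(3) Suc.prems k(2) by simp
    moreover have "es ! i \<in> set cs" using es(2,3) Suc.prems nth_mem[of i es] by auto
    ultimately have "es ! Suc i \<in> B \<longleftrightarrow> es ! i \<notin> B" using flip[of "es ! i"] by simp
    then show ?case using Suc by auto
  qed
  have h0B: "h0 x \<in> B" if "x \<in> B" for x
    using that esB h0n by (auto simp: B_def evens_def k_def)
  have h0A: "h0 x \<in> A" if xA: "x \<in> A" for x
  proof -
    obtain i where i: "x = cs ! i" "i < k" "odd i" using xA by (auto simp: A_def odds_def k_def)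
    then have "h0 x \<notin> B" using esB h0n by simp
    moreover have "h0 x \<in> set cs" using permutes_in_image[OF h0(1)] xA AB(2) by auto
    ultimately show ?thesis using AB(2) by auto
  qed
  have h0x0: "h0 x0 = x0" using h0n[of 0] es0 k(2) by (simp add: x0_def)
  define hA where "hA = (\<lambda>x. if x \<in> A then h0 x else x)"
  define hB where "hB = (\<lambda>x. if x \<in> B then h0 x else x)"
  have perm_restr: "(\<lambda>x. if x \<in> S then h0 x else x) permutes S" if "finite S" "\<And>x. x \<in> S \<Longrightarrow> h0 x \<in> S" for S
  proof (rule bij_imp_permutes)
    have "inj_on h0 S" using permutes_inj[OF h0(1)] by (rule inj_on_subset) simp
    moreover have "h0 ` S = S" using endo_inj_surj[OF that(1) _ \<open>inj_on h0 S\<close>] that(2) by blast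
    ultimately show "bij_betw (\<lambda>x. if x \<in> S then h0 x else x) S S"
      by (simp add: bij_betw_def cong: inj_on_cong image_cong)
  qed simp
  have fin: "finite A" "finite B" using AB(2) finite_set[of cs] by (metis finite_Un)+
  have hAp: "hA permutes A" unfolding hA_def by (rule perm_restr[OF fin(1) h0A])
  have hBp: "hB permutes B" unfolding hB_def by (rule perm_restr[OF fin(2) h0B])
  have h0eq: "h0 = hA \<circ> hB"
  proof
    fix x
    show "h0 x = (hA \<circ> hB) x"
      using AB h0B[of x] permutes_not_in[OF h0(1), of x]
      by (cases "x \<in> A"; cases "x \<in> B") (auto simp: hA_def hB_def)
  qed
  have conj: "h0 \<circ> z \<circ> inv h0 = z'"
    unfolding z_def using conjugation_of_cycle[OF cs(1) permutes_bij[OF h0(1)]] h0(2) es(4) by simp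
  then have conj': "z' (h0 x) = h0 (z x)" for x
    using permutes_inverses(2)[OF h0(1), of x] by (metis comp_apply)
  \<comment> \<open>Taking signs gives \<open>sign c = sign hA * sign hB = sign h0\<close>, so the
    sign in the term cancels the sign produced by conjugation with \<open>h0\<close>.\<close>
  have key: "z \<circ> (c \<circ> hB) = hA \<circ> z"
  proof
    fix x
    consider "x \<in> B" | "x \<in> A" | "x \<notin> set cs" using AB(2) by blast
    then show "(z \<circ> (c \<circ> hB)) x = (hA \<circ> z) x"
    proof cases
      case 1
      then have "z (c (hB x)) = z' (h0 x)" using cr[OF h0B[OF 1]] by (simp add: hB_def z'_def)
      also have "\<dots> = hA (z x)"
        using zB[OF 1] conj' h0x0 AB(1) x0B by (auto simp: hA_def)
      finally show ?thesis by simp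
    next
      case 2
      then have "hB x = x" "c x = x" using AB(1) permutes_not_in[OF cB, of x] by (auto simp: hB_def)
      moreover have "hA (z x) = z x" using zA[OF 2] AB(1) by (auto simp: hA_def)
      ultimately show ?thesis by simp
    next
      case 3
      then have "z x = x" "hB x = x" "c x = x" "hA x = x"
        using AB permutes_not_in[OF zp] permutes_not_in[OF cp] by (auto simp: hA_def hB_def)
      then show ?thesis by simp
    qed
  qed
  have P: "permutation z" "permutation c" "permutation hA" "permutation hB" "permutation (c \<circ> hB)"
    using permutes_imp_permutation[OF finite_set zp] permutes_imp_permutation[OF finite_set cp]
      permutes_imp_permutation[OF fin(1) hAp] permutes_imp_permutation[OF fin(2) hBp]
    by (auto intro: permutation_compose)
  have "sign z * (sign c * sign hB) = sign hA * sign z"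
    using arg_cong[OF key, of sign] P by (simp only: sign_compose)
  then have "sign c * sign hB = sign hA" by (simp add: mult.commute[of _ "sign z"])
  then have "sign c = sign hA * sign hB"
    by (metis mult.assoc mult.right_neutral sign_idempotent)
  then have sc: "sign c = sign h0" unfolding h0eq using P by (simp only: sign_compose)
  have comm: "h0 \<circ> h = h \<circ> h0" by (rule disjoint_permutes_commute[OF h0(1) h(1) h(3)])
  have "h \<circ> z' = h0 \<circ> (h \<circ> z) \<circ> inv h0"
    unfolding conj[symmetric] using comm by (metis comp_assoc)
  moreover have "h0 permutes X" using h0(1) cs(3) by (rule permutes_subset)
  ultimately have "\<delta> (h \<circ> z') = of_int (sign h0) * \<delta> (h \<circ> z)"
    using tc unfolding twisted_class_def by metis
  then show ?thesis using sc by (simp add: z'_def z_def flip: mult.assoc of_int_mult)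
qed

text \<open>All nonzero terms agree, so with positive weights nothing cancels; the index
  \<open>j\<close> guarantees that \<open>d\<close> does occur. For \<open>d = 0\<close> any factor
  will do.\<close>

lemma sum_zero_or_const:
  fixes t :: "'i \<Rightarrow> real"
  assumes "finite I" "\<And>i. i \<in> I \<Longrightarrow> t i = 0 \<or> t i = d" "\<And>i. i \<in> I \<Longrightarrow> w i > 0" "j \<in> I" "t j = d"
  shows "\<exists>N>0. (\<Sum>i\<in>I. w i * t i) = N * d"
proof (cases "d = 0")
  case True
  then have "(\<Sum>i\<in>I. w i * t i) = 0" using assms(2) by (intro sum.neutral) auto
  then show ?thesis using True by (intro exI[of _ 1]) simp
next
  case False
  have "(\<Sum>i\<in>I. w i * t i) = (\<Sum>i\<in>I. if t i = d then w i else 0) * d"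
    unfolding sum_distrib_right by (intro sum.cong refl) (use assms(2) in auto)
  moreover have "(\<Sum>i\<in>I. if t i = d then w i else 0) > 0"
    by (rule sum_pos2[OF assms(1,4)]) (use assms(3-5) in \<open>auto simp: less_imp_le\<close>)
  ultimately show ?thesis by blast
qed

definition blocks_of :: "'a list list \<Rightarrow> ('a set \<times> 'a set) list" where
  "blocks_of L = map (\<lambda>cs. (odds cs, evens cs)) L"

lemma blocks_blocks_of:
  assumes "distinct (concat L)" "\<And>cs. cs \<in> set L \<Longrightarrow> odd (length cs)"
  shows "blocks (set (concat L)) (blocks_of L)"
  using assms
proof (induction L)
  case (Cons cs L)
  have d: "distinct cs" "odd (length cs)" using Cons.prems by auto
  have "set (concat (cs # L)) - odds cs - evens cs = set (concat L)"
    using Cons.prems(1) evens_odds[of cs] by auto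
  moreover have "blocks (set (concat L)) (blocks_of L)" using Cons by auto
  ultimately show ?case
    using evens_odds_disjoint[OF d(1)] card_evens_odds(2)[OF d] evens_odds[of cs] by (auto simp: blocks_of_def)
qed (simp add: blocks_of_def)

context sym_diagram
begin

definition krow :: "('a \<Rightarrow> nat) \<Rightarrow> ('a \<Rightarrow> nat) \<Rightarrow> real" where
  "krow v w = (if w \<in> W then K v w else 0)"

lemma twisted_class_char: "twisted_class X (twisted_char D X)"
  unfolding twisted_class_def using twisted_char_conj[OF ferrers_diagram_axioms] by blast

lemma sum_krow: "h permutes X \<Longrightarrow> (\<Sum>v\<in>W. krow v (v \<circ> h)) = ksgn * twisted_char D X h"
  unfolding twisted_char_def sum_distrib_left
  by (intro sum.cong refl) (simp add: krow_def words_comp K_sym[symmetric])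

text \<open>Expanding the operator of the first cycle \<open>z\<close> replaces it by
  \<open>z \<circ> r \<circ> c\<close>, and by \<open>block_term\<close> each signed term is 0 or
  the trace for \<open>z\<close> itself. The altered cycle is absorbed into \<open>h\<close>, which
  is why \<open>h\<close> is arbitrary on a set disjoint from the remaining cycles.\<close>

lemma hook_ops_trace:
  assumes "distinct (concat L)" "\<And>cs. cs \<in> set L \<Longrightarrow> odd (length cs)"
    "h permutes Z" "Z \<inter> set (concat L) = {}" "Z \<subseteq> X" "set (concat L) \<subseteq> X"
  shows "\<exists>N>0. (\<Sum>v\<in>W. hook_ops (blocks_of L) (krow v) (v \<circ> (h \<circ> cyc_prod L))) = N * (ksgn * twisted_char D X (h \<circ> cyc_prod L))"
  using assms
proof (induction L arbitrary: h Z)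
  case Nil
  have "h permutes X" using Nil.prems(3,5) by (rule permutes_subset)
  from sum_krow[OF this] show ?case
    by (intro exI[of _ 1]) (simp only: blocks_of_def list.map hook_ops.simps cyc_prod_simps comp_id mult_1 zero_less_one)
next
  case (Cons cs L)
  let ?z = "cycle_of_list cs" and ?q = "cyc_prod L"
  have cs: "distinct cs" "odd (length cs)" "set cs \<subseteq> X" "set cs \<inter> Z = {}" "set cs \<inter> set (concat L) = {}"
    using Cons.prems by auto
  have qp: "?q permutes set (concat L)" by (rule cyc_prod_permutes)
  let ?R = "{r. r permutes odds cs}" and ?C = "{c. c permutes evens cs}"
  have sub: "odds cs \<subseteq> set cs" "evens cs \<subseteq> set cs" using evens_odds[of cs] by auto
  have rcp: "r permutes set cs" "c permutes set cs" if "r \<in> ?R" "c \<in> ?C" for r c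
    using that sub permutes_subset by blast+
  have fin: "finite (?R \<times> ?C)"
    using sub finite_subset[OF _ finite_set] finite_permutations by (metis finite_cartesian_product)
  define t where "t = (\<lambda>(r, c). of_int (sign c) * (ksgn * twisted_char D X (h \<circ> ?q \<circ> (?z \<circ> r \<circ> c))))"
  define d where "d = ksgn * twisted_char D X (h \<circ> ?q \<circ> ?z)"
  have hq: "h \<circ> ?q permutes Z \<union> set (concat L)"
    by (rule permutes_compose) (use qp Cons.prems(3) permutes_subset in blast)+
  have t: "t i = 0 \<or> t i = d" if "i \<in> ?R \<times> ?C" for i
  proof -
    obtain r c where rc: "i = (r, c)" "r \<in> ?R" "c \<in> ?C" using \<open>i \<in> ?R \<times> ?C\<close> by auto
    show ?thesis
    proof (cases "twisted_char D X (h \<circ> ?q \<circ> (?z \<circ> r \<circ> c)) = 0")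
      case False
      have "of_int (sign c) * twisted_char D X (h \<circ> ?q \<circ> (?z \<circ> r \<circ> c)) = twisted_char D X (h \<circ> ?q \<circ> ?z)"
        by (rule block_term[OF twisted_class_char cs(1-3) hq _ _ _ _ False]) (use Cons.prems cs rc in auto)
      then show ?thesis by (simp add: t_def d_def rc)
    qed (simp add: t_def rc)
  qed
  \<comment> \<open>The positive factor from the induction hypothesis may depend on \<open>r\<close>
    and \<open>c\<close>.\<close>
  have "\<exists>N. \<forall>i\<in>?R \<times> ?C. N i > 0 \<and> (case i of (r, c) \<Rightarrow>
      (\<Sum>v\<in>W. hook_ops (blocks_of L) (krow v) (v \<circ> (h \<circ> ?z \<circ> r \<circ> c \<circ> ?q))) = N i * (ksgn * twisted_char D X (h \<circ> ?z \<circ> r \<circ> c \<circ> ?q)))"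
  proof (rule bchoice, rule ballI)
    fix i assume "i \<in> ?R \<times> ?C"
    then obtain r c where rc: "i = (r, c)" "r \<in> ?R" "c \<in> ?C" by auto
    have "h permutes Z \<union> set cs" "?z permutes Z \<union> set cs" "r permutes Z \<union> set cs" "c permutes Z \<union> set cs"
      using Cons.prems(3) cycle_permutes[of cs] rcp[OF rc(2,3)] permutes_subset by blast+
    then have "h \<circ> ?z \<circ> r \<circ> c permutes Z \<union> set cs" by (intro permutes_compose)
    then have "\<exists>N>0. (\<Sum>v\<in>W. hook_ops (blocks_of L) (krow v) (v \<circ> (h \<circ> ?z \<circ> r \<circ> c \<circ> ?q))) = N * (ksgn * twisted_char D X (h \<circ> ?z \<circ> r \<circ> c \<circ> ?q))"
      by (rule Cons.IH[rotated 2]) (use Cons.prems in auto)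
    then show "\<exists>N>0. case i of (r, c) \<Rightarrow>
      (\<Sum>v\<in>W. hook_ops (blocks_of L) (krow v) (v \<circ> (h \<circ> ?z \<circ> r \<circ> c \<circ> ?q))) = N * (ksgn * twisted_char D X (h \<circ> ?z \<circ> r \<circ> c \<circ> ?q))"
      by (simp add: rc)
  qed
  then obtain N where N: "\<And>i. i \<in> ?R \<times> ?C \<Longrightarrow> N i > 0"
    "\<And>r c. r \<in> ?R \<Longrightarrow> c \<in> ?C \<Longrightarrow> (\<Sum>v\<in>W. hook_ops (blocks_of L) (krow v) (v \<circ> (h \<circ> ?z \<circ> r \<circ> c \<circ> ?q)))
       = N (r, c) * (ksgn * twisted_char D X (h \<circ> ?z \<circ> r \<circ> c \<circ> ?q))"
    by fastforce
  have qz: "?z \<circ> ?q = ?q \<circ> ?z" by (rule disjoint_permutes_commute[OF cycle_permutes qp cs(5)])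
  have comm: "?q \<circ> r \<circ> c = r \<circ> c \<circ> ?q" if "r \<in> ?R" "c \<in> ?C" for r c
  proof -
    have "(r \<circ> c) \<circ> ?q = ?q \<circ> (r \<circ> c)"
      by (rule disjoint_permutes_commute[OF _ qp cs(5)]) (use rcp[OF that] permutes_compose in blast)
    then show ?thesis by (simp only: comp_assoc)
  qed
  have eq1: "v \<circ> (h \<circ> cyc_prod (cs # L)) \<circ> r \<circ> c = v \<circ> (h \<circ> ?z \<circ> r \<circ> c \<circ> ?q)"
    if "r \<in> ?R" "c \<in> ?C" for r c and v :: "'a \<Rightarrow> nat"
    using comm[OF that] by (simp only: cyc_prod_simps comp_assoc)
  have eq2: "h \<circ> ?z \<circ> r \<circ> c \<circ> ?q = h \<circ> ?q \<circ> (?z \<circ> r \<circ> c)" if "r \<in> ?R" "c \<in> ?C" for r c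
  proof -
    have "h \<circ> ?z \<circ> r \<circ> c \<circ> ?q = h \<circ> ?z \<circ> (r \<circ> c \<circ> ?q)" by (simp only: comp_assoc)
    also have "\<dots> = h \<circ> (?z \<circ> ?q) \<circ> r \<circ> c" unfolding comm[OF that, symmetric] by (simp only: comp_assoc)
    finally show ?thesis unfolding qz by (simp only: comp_assoc)
  qed
  have "(\<Sum>v\<in>W. hook_ops (blocks_of (cs # L)) (krow v) (v \<circ> (h \<circ> cyc_prod (cs # L))))
    = (\<Sum>v\<in>W. \<Sum>r\<in>?R. \<Sum>c\<in>?C. of_int (sign c) * hook_ops (blocks_of L) (krow v) (v \<circ> (h \<circ> cyc_prod (cs # L)) \<circ> r \<circ> c))"
    by (simp only: blocks_of_def list.map hook_ops.simps hook_op_def)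
  also have "\<dots> = (\<Sum>v\<in>W. \<Sum>r\<in>?R. \<Sum>c\<in>?C. of_int (sign c) * hook_ops (blocks_of L) (krow v) (v \<circ> (h \<circ> ?z \<circ> r \<circ> c \<circ> ?q)))"
    by (intro sum.cong refl) (simp only: eq1)
  also have "\<dots> = (\<Sum>r\<in>?R. \<Sum>c\<in>?C. \<Sum>v\<in>W. of_int (sign c) * hook_ops (blocks_of L) (krow v) (v \<circ> (h \<circ> ?z \<circ> r \<circ> c \<circ> ?q)))"
    by (subst sum.swap, rule sum.cong[OF refl], rule sum.swap)
  also have "\<dots> = (\<Sum>r\<in>?R. \<Sum>c\<in>?C. N (r, c) * t (r, c))"
  proof (intro sum.cong refl)
    fix r c assume rc: "r \<in> ?R" "c \<in> ?C"
    show "(\<Sum>v\<in>W. of_int (sign c) * hook_ops (blocks_of L) (krow v) (v \<circ> (h \<circ> ?z \<circ> r \<circ> c \<circ> ?q))) = N (r, c) * t (r, c)"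
      unfolding sum_distrib_left[symmetric] N(2)[OF rc] unfolding eq2[OF rc] t_def by simp
  qed
  also have "\<dots> = (\<Sum>i\<in>?R \<times> ?C. N i * t i)" by (simp only: sum.cartesian_product case_prod_unfold prod.collapse)
  finally have sum: "(\<Sum>v\<in>W. hook_ops (blocks_of (cs # L)) (krow v) (v \<circ> (h \<circ> cyc_prod (cs # L)))) = (\<Sum>i\<in>?R \<times> ?C. N i * t i)" .
  have "\<exists>M>0. (\<Sum>i\<in>?R \<times> ?C. N i * t i) = M * d"
    \<comment> \<open>The pair \<open>(id, id)\<close> leaves the cycle unchanged and contributes
      \<open>d\<close>.\<close>
    by (rule sum_zero_or_const[OF fin t N(1), where j="(id, id)"]) (auto simp: permutes_id t_def d_def)
  moreover have "h \<circ> ?q \<circ> ?z = h \<circ> cyc_prod (cs # L)" using qz by (simp only: cyc_prod_simps comp_assoc)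
  ultimately show ?case unfolding sum d_def by (simp only:)
qed

text \<open>A nonzero trace exhibits a polytabloid that the operators of the cycles do not kill, and
  \<open>lex_bound\<close> applies to it, whatever the order of the cycles in
  \<open>L\<close>.\<close>

theorem twisted_char_lex:
  assumes L: "cycles_of X g L" and nz: "twisted_char D X g \<noteq> 0"
  defines "\<alpha> \<equiv> nth_or_0 (map (\<lambda>cs. Suc (length cs) div 2) L)"
  shows "(\<forall>p. \<alpha> p = arm D p) \<or> (\<exists>p. (\<forall>q<p. \<alpha> q = arm D q) \<and> \<alpha> p < arm D p)"
proof -
  have LX: "distinct (concat L)" "set (concat L) = X" "g = cyc_prod L" using L by (auto simp: cycles_of_def)
  have odd: "odd (length cs)" if "cs \<in> set L" for cs
    by (rule twisted_class_odd[OF twisted_class_char L permutes_id[of "{}"] _ _ _ _ that]) (use nz in auto)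
  have "\<exists>N>0. (\<Sum>v\<in>W. hook_ops (blocks_of L) (krow v) (v \<circ> (id \<circ> cyc_prod L))) = N * (ksgn * twisted_char D X (id \<circ> cyc_prod L))"
    by (rule hook_ops_trace[OF LX(1) odd permutes_id[of "{}"]]) (use LX in auto)
  then have "(\<Sum>v\<in>W. hook_ops (blocks_of L) (krow v) (v \<circ> g)) \<noteq> 0"
    using nz ksgn LX(3) by auto
  then obtain v where v: "v \<in> W" "hook_ops (blocks_of L) (krow v) (v \<circ> g) \<noteq> 0"
    by (rule sum.not_neutral_contains_not_neutral)
  have "highest_weight X (rows D) (krow v)"
    using highest_weight_kmat[OF X D, of v] v(1) unfolding krow_def by (simp add: cols_eq_rows)
  moreover have "blocks X (blocks_of L)" using blocks_blocks_of[OF LX(1) odd] LX(2) by simp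
  moreover have "map (card \<circ> snd) (blocks_of L) = map (\<lambda>cs. Suc (length cs) div 2) L"
  proof -
    have "(card \<circ> snd) (odds cs, evens cs) = Suc (length cs) div 2" if "cs \<in> set L" for cs
      using card_evens_odds(1)[OF _ odd[OF that]] LX(1) that by (simp only: comp_apply snd_conv distinct_concat_iff)
    then show ?thesis by (simp only: blocks_of_def map_map comp_def cong: map_cong)
  qed
  ultimately show ?thesis
    using lex_bound[OF X _ D sym _ v(2)] unfolding \<alpha>_def by simp
qed

end

text \<open>The cells are sorted by their smaller coordinate \<open>p\<close>; they form the hook at
  \<open>(p, p)\<close>, whose two legs are equal by symmetry. Beyond the Durfee size
  \<open>2 * arm D p - 1\<close> truncates to 0, so the sum may run to any \<open>N\<close> that
  covers all rows.\<close>

lemma card_ferrers_arm: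
  assumes D: "ferrers D" and sym: "\<And>i j. (i, j) \<in> D \<Longrightarrow> (j, i) \<in> D" and N: "rows D 0 \<le> N"
  shows "card D = (\<Sum>p<N. 2 * arm D p - 1)"
proof -
  define H where "H p = {x\<in>D. min (fst x) (snd x) = p}" for p
  have "D = (\<Union>p\<in>{..<N}. H p)"
  proof (intro equalityI subsetI)
    fix x assume x: "x \<in> D"
    have "(fst x, 0) \<in> D" using x D unfolding ferrers_def by (metis le0 order_refl prod.collapse)
    then have "fst x < N" using ferrers_rows[OF D, of 0 "fst x"] sym N by (meson less_le_trans)
    then have "min (fst x) (snd x) < N" by simp
    then show "x \<in> (\<Union>p\<in>{..<N}. H p)" using x by (simp add: H_def)
  qed (auto simp: H_def)
  then have "card D = card (\<Union>p\<in>{..<N}. H p)" by simp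
  also have "\<dots> = (\<Sum>p<N. card (H p))"
    by (rule card_UN_disjoint) (auto simp: H_def ferrers_finite[OF D])
  also have "\<dots> = (\<Sum>p<N. 2 * arm D p - 1)"
  proof (rule sum.cong[OF refl])
    fix p
    have "(i, j) \<in> H p \<longleftrightarrow> (i = p \<and> p \<le> j \<and> j < rows D p) \<or> (j = p \<and> Suc p \<le> i \<and> i < rows D p)" for i j
    proof -
      have "(i, j) \<in> D \<longleftrightarrow> j < rows D i" "(i, j) \<in> D \<longleftrightarrow> i < rows D j"
        using ferrers_rows[OF D] sym by blast+
      then show ?thesis by (auto simp: H_def min_def)
    qed
    then have H: "H p = Pair p ` {p..<rows D p} \<union> (\<lambda>i. (i, p)) ` {Suc p..<rows D p}"
      by (auto simp: image_iff)
    have "card (H p) = card (Pair p ` {p..<rows D p}) + card ((\<lambda>i. (i, p)) ` {Suc p..<rows D p})"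
      unfolding H by (rule card_Un_disjoint) auto
    also have "\<dots> = (rows D p - p) + (rows D p - Suc p)" by (simp add: card_image inj_on_def)
    finally show "card (H p) = 2 * arm D p - 1" by (simp add: arm_def)
  qed
  finally show ?thesis .
qed

lemma rows_0_le_card: "ferrers D \<Longrightarrow> rows D 0 \<le> card D"
  unfolding rows_def by (rule card_inj_on_le[of "Pair 0"]) (auto simp: ferrers_finite inj_on_def)

text \<open>The symmetric diagram with arms \<open>a\<close>.\<close>

definition hook_diagram :: "(nat \<Rightarrow> nat) \<Rightarrow> (nat \<times> nat) set" where
  "hook_diagram a = {(i, j). max i j < a (min i j) + min i j}"

context
  fixes a :: "nat \<Rightarrow> nat"
  assumes a: "\<And>p. a (Suc p) = 0 \<or> a (Suc p) < a p"
begin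

text \<open>Where \<open>a q\<close> is positive, \<open>a q + q\<close> is the length of row
  \<open>q\<close>; a strict decrease of \<open>a\<close> makes the rows decrease weakly.\<close>

lemma hook_mono: assumes "p \<le> q" "a q > 0" shows "a q + q \<le> a p + p"
  using assms
proof (induction q rule: dec_induct)
  case (step q)
  then show ?case using a[of q] by linarith
qed simp

lemma hook_diagram_sym: "(i, j) \<in> hook_diagram a \<Longrightarrow> (j, i) \<in> hook_diagram a"
  by (simp add: hook_diagram_def max.commute min.commute)

lemma hook_diagram_ferrers: "ferrers (hook_diagram a)"
  unfolding ferrers_def
proof (intro conjI allI impI)
  have pos: "a (min i j) > 0" if "max i j < a (min i j) + min i j" for i j :: nat using that by linarith
  have "hook_diagram a \<subseteq> {..<a 0} \<times> {..<a 0}"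
  proof
    fix x assume "x \<in> hook_diagram a"
    then have *: "max (fst x) (snd x) < a (min (fst x) (snd x)) + min (fst x) (snd x)"
      by (auto simp: hook_diagram_def)
    then have "max (fst x) (snd x) < a 0" using hook_mono[of 0, OF _ pos[OF *]] by simp
    then show "x \<in> {..<a 0} \<times> {..<a 0}" by (cases x) simp
  qed
  then show "finite (hook_diagram a)" by (rule finite_subset) simp
  fix i j i' j' assume "(i, j) \<in> hook_diagram a" "i' \<le> i" "j' \<le> j"
  then have *: "max i j < a (min i j) + min i j" "min i' j' \<le> min i j" "max i' j' \<le> max i j"
    by (auto simp: hook_diagram_def)
  from less_le_trans[OF le_less_trans[OF *(3,1)] hook_mono[OF *(2) pos[OF *(1)]]]
  show "(i', j') \<in> hook_diagram a" unfolding hook_diagram_def by blast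
qed

lemma arm_hook_diagram: "arm (hook_diagram a) p = a p"
proof (cases "a p = 0")
  case True
  have "\<not> p < rows (hook_diagram a) p"
    unfolding ferrers_rows[OF hook_diagram_ferrers, symmetric] using True by (simp add: hook_diagram_def)
  then show ?thesis using True by (simp add: arm_def)
next
  case False
  have iff: "j < rows (hook_diagram a) p \<longleftrightarrow> j < a p + p" for j
  proof (cases "p \<le> j")
    case True
    then show ?thesis
      unfolding ferrers_rows[OF hook_diagram_ferrers, symmetric] using \<open>a p \<noteq> 0\<close> by (auto simp: hook_diagram_def)
  next
    case False
    then have "p < a j + j" using hook_mono[of j p] \<open>a p \<noteq> 0\<close> by simp
    then show ?thesis
      unfolding ferrers_rows[OF hook_diagram_ferrers, symmetric] using False by (simp add: hook_diagram_def)
  qed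
  have "rows (hook_diagram a) p = a p + p"
    using iff[of "rows (hook_diagram a) p"] iff[of "a p + p"] by linarith
  then show ?thesis by (simp add: arm_def)
qed

end

text \<open>For odd length this is the arm, corner included, of the symmetric hook with as many
  cells as the cycle has letters.\<close>

definition half :: "'a list \<Rightarrow> nat" where "half cs = Suc (length cs) div 2"

lemma twisted_char_odd:
  assumes "sym_diagram D X" "cycles_of X g L" "twisted_char D X g \<noteq> 0"
  shows "distinct (map length L)" "cs \<in> set L \<Longrightarrow> odd (length cs)"
proof -
  interpret sym_diagram D X by fact
  show "distinct (map length L)" by (rule twisted_class_distinct[OF twisted_class_char assms(2,3)])
  show "odd (length cs)" if "cs \<in> set L"
    by (rule twisted_class_odd[OF twisted_class_char assms(2) permutes_id[of "{}"] _ _ _ _ that]) (use assms(3) in auto)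
qed

lemma half_eq_length:
  assumes "\<And>cs. cs \<in> set L \<Longrightarrow> odd (length cs)"
  shows "map length L = map (\<lambda>m. 2 * m - 1) (map half L)" "0 \<notin> set (map half L)"
proof -
  have "length cs = 2 * half cs - 1 \<and> half cs \<noteq> 0" if "cs \<in> set L" for cs
    using assms[OF that] by (auto simp: half_def elim!: oddE)
  then show "map length L = map (\<lambda>m. 2 * m - 1) (map half L)" "0 \<notin> set (map half L)"
    by (force simp: image_iff)+
qed

lemma nth_or_0_inj:
  assumes "nth_or_0 l = nth_or_0 l'" "0 \<notin> set l" "0 \<notin> set l'" shows "l = l'"
proof -
  have iff: "p < length m \<longleftrightarrow> nth_or_0 m p \<noteq> 0" if "0 \<notin> set m" for m p
    using that nth_mem[of p m] unfolding nth_or_0_def by metis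
  have iff2: "p < length l \<longleftrightarrow> p < length l'" for p using iff assms by simp
  have len: "length l = length l'" using iff2[of "length l"] iff2[of "length l'"] by linarith
  show ?thesis
  proof (rule nth_equalityI[OF len])
    fix i assume "i < length l"
    then show "l ! i = l' ! i" using fun_cong[OF assms(1), of i] len by (simp add: nth_or_0_def)
  qed
qed

lemma ex_sorted_cycles:
  assumes "g permutes X" "finite X"
  obtains L where "cycles_of X g L" "sorted_wrt (\<lambda>a b. length b \<le> length a) L"
proof -
  obtain L where L: "cycles_of X g L" by (rule ex_cycles_of[OF assms])
  let ?L = "rev (sort_key length L)"
  have "cycles_of X g ?L" by (rule cycles_of_mset[OF L]) simp
  moreover have "sorted_wrt (\<lambda>a b. length a \<le> length b) (sort_key length L)"
    using sorted_sort_key[of length L] by (simp add: sorted_map)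
  then have "sorted_wrt (\<lambda>a b. length b \<le> length a) ?L" by (simp add: sorted_wrt_rev)
  ultimately show thesis by (rule that)
qed

lemma lexn_less_thanI:
  assumes "length xs = n" "length ys = n" "p < n" "take p xs = take p ys" "xs ! p < ys ! p"
  shows "(xs, ys) \<in> lexn less_than n"
proof -
  have "xs = take p xs @ xs ! p # drop (Suc p) xs" using assms(1,3) by (intro id_take_nth_drop) simp
  moreover have "ys = take p xs @ ys ! p # drop (Suc p) ys"
    unfolding assms(4) using assms(2,3) by (intro id_take_nth_drop) simp
  moreover have "(xs ! p, ys ! p) \<in> less_than" using assms(5) by simp
  ultimately show ?thesis unfolding lexn_conv using assms(1,2) by blast
qed

text \<open>Induction on the lexicographic order of the arms: if the cycle type of \<open>g\<close> is strictly smaller than the one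
  belonging to \<open>D\<close>, then it belongs to a diagram \<open>D'\<close> for which the claim is known, and the orthogonality of the
  two twisted characters leaves only the class of \<open>g\<close>, so the twisted character of \<open>D\<close> vanishes there.\<close>

theorem twisted_char_support:
  assumes "sym_diagram D X" "cycles_of X g L" "sorted_wrt (\<lambda>a b. length b \<le> length a) L" "twisted_char D X g \<noteq> 0"
  shows "nth_or_0 (map half L) = arm D"
proof -
  \<comment> \<open>Comparing the arms up to index \<open>card X\<close> suffices, because a
    positive arm at \<open>p\<close> needs \<open>p < rows D 0 \<le> card X\<close>.\<close>
  define r where "r = inv_image (lexn less_than (Suc (card X))) (\<lambda>D. map (arm D) [0..<Suc (card X)])"
  have "wf r" unfolding r_def by (intro wf_inv_image wf_lexn wf_less_than)
  then show ?thesis using assms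
  proof (induction D arbitrary: g L rule: wf_induct_rule)
    case (less D)
    interpret sym_diagram D X by fact
    let ?a = "nth_or_0 (map half L)"
    have "(\<forall>p. ?a p = arm D p) \<or> (\<exists>p. (\<forall>q<p. ?a q = arm D q) \<and> ?a p < arm D p)"
      using twisted_char_lex[OF less.prems(2,4)] by (simp add: half_def[abs_def])
    then show ?case
    proof (elim disjE exE conjE)
      fix p assume p: "\<forall>q<p. ?a q = arm D q" "?a p < arm D p"
      note od = twisted_char_odd[OF less.prems(1,2,4)]
      have step: "?a (Suc q) = 0 \<or> ?a (Suc q) < ?a q" for q
      proof (cases "Suc q < length L")
        case True
        have "length (L ! Suc q) \<le> length (L ! q)"
          using less.prems(3) True by (simp add: sorted_wrt_iff_nth_less)
        moreover have "length (L ! Suc q) \<noteq> length (L ! q)"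
          using od(1) True by (auto simp: distinct_conv_nth)
        moreover have "odd (length (L ! Suc q))" "odd (length (L ! q))" using od(2) True by auto
        ultimately have "half (L ! Suc q) < half (L ! q)" by (auto simp: half_def elim!: oddE)
        then show ?thesis using True by (simp add: nth_or_0_def)
      qed (simp add: nth_or_0_def)
      \<comment> \<open>The cycle lengths are distinct, odd and in decreasing order, so their halves
        decrease strictly and are the arms of a symmetric diagram.\<close>
      define D' where "D' = hook_diagram ?a"
      have D': "ferrers D'" "\<And>i j. (i, j) \<in> D' \<Longrightarrow> (j, i) \<in> D'" "arm D' = ?a"
        unfolding D'_def using hook_diagram_ferrers[of ?a, OF step] hook_diagram_sym[of ?a, OF step] arm_hook_diagram[of ?a, OF step]
        by blast+
      have "card D' = (\<Sum>q<rows D' 0 + length L. 2 * ?a q - 1)"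
        using card_ferrers_arm[OF D'(1,2), of "rows D' 0 + length L"] D'(3) by simp
      also have "\<dots> = (\<Sum>q<length L. 2 * ?a q - 1)"
        by (rule sum.mono_neutral_right) (auto simp: nth_or_0_def)
      also have "\<dots> = (\<Sum>q<length L. length (L ! q))"
      proof (rule sum.cong[OF refl])
        fix q assume "q \<in> {..<length L}"
        then show "2 * ?a q - 1 = length (L ! q)"
          using arg_cong[OF half_eq_length(1)[of L, OF od(2)], where f="\<lambda>l. l ! q"] by (simp add: nth_or_0_def)
      qed
      also have "\<dots> = length (concat L)" by (simp add: length_concat sum_list_sum_nth atLeast0LessThan)
      also have "\<dots> = card X" using less.prems(2) by (metis cycles_of_def distinct_card)
      finally have "sym_diagram D' X" by unfold_locales (use D' X in auto)
      moreover have "(D', D) \<in> r"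
      proof -
        have "p < rows D p" using p(2) by (auto simp: arm_def)
        then have "(p, 0) \<in> D" using ferrers_rows[OF D, of p 0] by simp
        then have "p < rows D 0" using sym ferrers_rows[OF D, of 0 p] by blast
        then have pl: "p < Suc (card X)" using rows_0_le_card[OF D] card by simp
        let ?x = "map (arm D') [0..<Suc (card X)]" and ?y = "map (arm D) [0..<Suc (card X)]"
        have "take p ?x = take p ?y"
          using p(1) pl D'(3) by (intro nth_equalityI) (auto simp del: upt_Suc)
        moreover have "?x ! p < ?y ! p" using pl D'(3) p(2) by (simp del: upt_Suc)
        ultimately have "(?x, ?y) \<in> lexn less_than (Suc (card X))"
          by (intro lexn_less_thanI[OF _ _ pl]) simp_all
        then show ?thesis by (simp only: r_def in_inv_image)
      qed
      ultimately have IH: "nth_or_0 (map half M) = ?a"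
        if "cycles_of X x M" "sorted_wrt (\<lambda>a b. length b \<le> length a) M" "twisted_char D' X x \<noteq> 0" for x M
        using less.IH[of D' x M] that D'(3) by simp
      interpret D': sym_diagram D' X by fact
      \<comment> \<open>By the induction hypothesis the twisted character of \<open>D'\<close> is
        supported on the conjugacy class of \<open>g\<close>.\<close>
      have conj: "\<exists>h. h permutes X \<and> x = h \<circ> g \<circ> inv h" if x: "x permutes X" "twisted_char D' X x \<noteq> 0" for x
      proof -
        obtain M where M: "cycles_of X x M" "sorted_wrt (\<lambda>a b. length b \<le> length a) M"
          by (rule ex_sorted_cycles[OF x(1) X])
        note od' = twisted_char_odd[OF D'.sym_diagram_axioms M(1) x(2)]
        have "map half L = map half M"
          using nth_or_0_inj[of "map half L" "map half M"] IH[OF M x(2)] half_eq_length(2)[of L, OF od(2)] half_eq_length(2)[of M, OF od'(2)]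
          by simp
        then have "map length L = map length M"
          using half_eq_length(1)[of L, OF od(2)] half_eq_length(1)[of M, OF od'(2)] by simp
        then have "mset (map length L) = mset (map length M)" by simp
        then obtain h where "h permutes X" "x = h \<circ> g \<circ> inv h" by (rule same_lengths_conj[OF less.prems(2) M(1)])
        then show ?thesis by blast
      qed
      have g: "g permutes X" using less.prems(2) cyc_prod_permutes by (metis cycles_of_def)
      \<comment> \<open>The two signs from conjugation cancel, so the product is constant on this
        class.\<close>
      have "twisted_char D X x * twisted_char D' X x = (if twisted_char D' X x \<noteq> 0 then twisted_char D X g * twisted_char D' X g else 0)" if x: "x permutes X" for x
      proof (cases "twisted_char D' X x = 0")
        case False
        then obtain h where h: "h permutes X" "x = h \<circ> g \<circ> inv h" using conj[OF x] by blast
        have "twisted_char D X x * twisted_char D' X x = (of_int (sign h) * of_int (sign h)) * (twisted_char D X g * twisted_char D' X g)"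
          unfolding h(2) twisted_char_conj[OF ferrers_diagram_axioms h(1)] twisted_char_conj[OF D'.ferrers_diagram_axioms h(1)]
          by (simp only: mult_ac)
        then show ?thesis using False unfolding sign_idempotent of_int_mult[symmetric] by simp
      qed simp
      then have "(\<Sum>x | x permutes X. twisted_char D X x * twisted_char D' X x)
          = (\<Sum>x | x permutes X. if twisted_char D' X x \<noteq> 0 then twisted_char D X g * twisted_char D' X g else 0)"
        by (intro sum.cong) auto
      moreover have "D \<noteq> D'" using p(2) D'(3) by auto
      ultimately have z: "(\<Sum>x | x permutes X. if twisted_char D' X x \<noteq> 0 then twisted_char D X g * twisted_char D' X g else 0) = 0"
        using sum_twisted_char[OF sym_diagram_axioms D'.sym_diagram_axioms] by simp
      \<comment> \<open>The norm is not 0, so the twisted character of \<open>D'\<close> does not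
        vanish at \<open>g\<close>; orthogonality then makes that of \<open>D\<close> vanish
        there.\<close>
      have "(\<Sum>x | x permutes X. twisted_char D' X x * twisted_char D' X x) \<noteq> 0"
        using sum_twisted_char[OF D'.sym_diagram_axioms D'.sym_diagram_axioms] D'.kconst_pos by simp
      then obtain x where x: "x \<in> {x. x permutes X}" "twisted_char D' X x * twisted_char D' X x \<noteq> 0"
        by (rule sum.not_neutral_contains_not_neutral)
      then obtain h where h: "h permutes X" "x = h \<circ> g \<circ> inv h" using conj[of x] by auto
      have g': "twisted_char D' X g \<noteq> 0"
        using x(2) unfolding h(2) twisted_char_conj[OF D'.ferrers_diagram_axioms h(1)] by auto
      have "finite {x. x permutes X}" using X by (rule finite_permutations)
      then have "real (card {x. x permutes X \<and> twisted_char D' X x \<noteq> 0}) * (twisted_char D X g * twisted_char D' X g) = 0"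
        using z by (simp add: sum.If_cases Int_def)
      moreover have "card {x. x permutes X \<and> twisted_char D' X x \<noteq> 0} \<noteq> 0"
        using \<open>finite {x. x permutes X}\<close> x by auto
      ultimately have "twisted_char D X g = 0" using g' by simp
      then show ?thesis using less.prems(4) by simp
    qed auto
  qed
qed

section \<open>Kronecker coefficients\<close>

lemma irr_char_chi:
  assumes "\<alpha> \<turnstile> n" "\<pi> permutes {..<n}"
  shows "irr_char \<alpha> \<pi> = complex_of_real (chi (diagram \<alpha>) {..<n} \<pi>)"
proof -
  interpret partition_specht \<alpha> n by unfold_locales (rule assms(1))
  show ?thesis using irr_char_eq_chi[of \<pi>] assms(2) by (simp add: D_def X_def)
qed

lemma finite_partitions: "finite {\<nu>. \<nu> \<turnstile> n}"
proof (rule finite_subset)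
  show "{\<nu>. \<nu> \<turnstile> n} \<subseteq> {xs. set xs \<subseteq> {..n} \<and> length xs \<le> n}"
  proof clarify
    fix \<nu> assume \<nu>: "\<nu> \<turnstile> n"
    then have s: "sum_list \<nu> = n" "0 \<notin> set \<nu>" by (auto simp: is_partition_def)
    have "set \<nu> \<subseteq> {..n}" using s(1) member_le_sum_list[of _ \<nu>] by auto
    moreover have "length \<nu> \<le> sum_list \<nu>" using s(2)
      by (induction \<nu>) (auto simp: Suc_le_eq)
    ultimately show "set \<nu> \<subseteq> {..n} \<and> length \<nu> \<le> n" using s(1) by simp
  qed
  show "finite {xs. set xs \<subseteq> {..n} \<and> length xs \<le> n}" by (rule finite_lists_length_le) simp
qed

text \<open>Sorting the cycle lengths gives a partition, which provides the count that
  \<open>chi_complete\<close> asks for.\<close>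

lemma card_cycle_types:
  "card (cycle_type n ` {g. g permutes {..<n}}) \<le> card (diagram ` {\<nu>. \<nu> \<turnstile> n})"
proof -
  have "inj_on diagram {\<nu>. \<nu> \<turnstile> n}" by (rule inj_onI) (use diagram_inj in blast)
  then have c: "card (diagram ` {\<nu>. \<nu> \<turnstile> n}) = card {\<nu>. \<nu> \<turnstile> n}" by (rule card_image)
  have "cycle_type n ` {g. g permutes {..<n}} \<subseteq> mset ` {\<nu>. \<nu> \<turnstile> n}"
  proof clarify
    fix g assume "g permutes {..<n}"
    then obtain L where L: "cycles_of {..<n} g L" by (rule ex_cycles_of[OF _ finite_lessThan])
    define \<nu> where "\<nu> = rev (sort (map length L))"
    have "sum_list \<nu> = sum_mset (mset \<nu>)" by (simp add: sum_mset_sum_list)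
    also have "\<dots> = sum_list (map length L)" by (simp add: \<nu>_def sum_mset_sum_list flip: mset_map)
    also have "\<dots> = length (concat L)" by (simp add: length_concat)
    also have "\<dots> = n" using L distinct_card[of "concat L"] by (auto simp: cycles_of_def)
    finally have "sum_list \<nu> = n" .
    moreover have "sorted_wrt (\<ge>) \<nu>" by (simp add: \<nu>_def sorted_wrt_rev)
    moreover have "0 \<notin> set \<nu>" using L by (auto simp: \<nu>_def cycles_of_def)
    ultimately have "\<nu> \<turnstile> n" by (simp add: is_partition_def)
    moreover have "cycle_type n g = mset \<nu>" using cycle_type_eq[OF L] by (simp add: \<nu>_def)
    ultimately show "cycle_type n g \<in> mset ` {\<nu>. \<nu> \<turnstile> n}" by blast
  qed
  then have "card (cycle_type n ` {g. g permutes {..<n}}) \<le> card (mset ` {\<nu>. \<nu> \<turnstile> n})"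
    by (rule card_mono[OF finite_imageI[OF finite_partitions]])
  also have "\<dots> \<le> card {\<nu>. \<nu> \<turnstile> n}" by (rule card_image_le[OF finite_partitions])
  finally show ?thesis using c by simp
qed

text \<open>The multiplicity is a definite description. \<open>chi_complete\<close> and
  \<open>chi_triple_nat\<close> provide an expansion with natural coefficients, and orthogonality
  makes it unique.\<close>

theorem kronecker_eq:
  assumes "\<alpha> \<turnstile> n" "\<beta> \<turnstile> n" "\<gamma> \<turnstile> n"
  shows "real (kronecker n \<alpha> \<beta> \<gamma>) = (\<Sum>g | g permutes {..<n}.
    chi (diagram \<alpha>) {..<n} g * chi (diagram \<beta>) {..<n} g * chi (diagram \<gamma>) {..<n} g) / fact n"
proof -
  let ?X = "{..<n}" and ?P = "{\<nu>. \<nu> \<turnstile> n}"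
  define \<chi> where "\<chi> \<nu> = chi (diagram \<nu>) ?X" for \<nu>
  define \<psi> where "\<psi> g = \<chi> \<alpha> g * \<chi> \<beta> g" for g
  have fd: "ferrers_diagram (diagram \<nu>) ?X" if "\<nu> \<turnstile> n" for \<nu> using that by (rule ferrers_diagram_diagram)
  have inj: "inj_on diagram ?P" by (rule inj_onI) (use diagram_inj in blast)
  have orth: "(\<Sum>g | g permutes ?X. \<chi> \<nu> g * \<chi> \<kappa> g) = (if \<nu> = \<kappa> then fact n else 0)"
    if "\<nu> \<turnstile> n" "\<kappa> \<turnstile> n" for \<nu> \<kappa>
  proof -
    have "card (diagram \<nu>) = n" "card (diagram \<kappa>) = n" using that by (simp_all add: card_diagram is_partition_def)
    moreover have "diagram \<nu> = diagram \<kappa> \<longleftrightarrow> \<nu> = \<kappa>" using diagram_inj that by blast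
    ultimately show ?thesis using sum_chi_chi[OF fd[OF that(1)] fd[OF that(2)]] by (simp add: \<chi>_def)
  qed
  define m0 where "m0 \<nu> = (\<Sum>g | g permutes ?X. \<chi> \<nu> g * \<psi> g) / fact n" for \<nu>
  have "\<exists>k. m0 \<nu> = real k" if "\<nu> \<turnstile> n" for \<nu>
    using chi_triple_nat[OF fd[OF that] fd[OF assms(1)] fd[OF assms(2)]] by (simp add: m0_def \<chi>_def \<psi>_def mult_ac)
  then obtain m1 where m1: "\<And>\<nu>. \<nu> \<turnstile> n \<Longrightarrow> m0 \<nu> = real (m1 \<nu>)" by metis
  define m where "m \<nu> = (if \<nu> \<turnstile> n then m1 \<nu> else 0)" for \<nu>
  have expand: "\<psi> g = (\<Sum>\<nu>\<in>?P. real (m \<nu>) * \<chi> \<nu> g)" if g: "g permutes ?X" for g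
  proof -
    have "\<psi> g = (\<Sum>D\<in>diagram ` ?P. (\<Sum>h | h permutes ?X. chi D ?X h * \<psi> h) / fact (card ?X) * chi D ?X g)"
    proof (rule chi_complete[where ct="cycle_type n"])
      show "finite (diagram ` ?P)" by (intro finite_imageI finite_partitions)
      show "ferrers_diagram D ?X" if "D \<in> diagram ` ?P" for D using that fd by auto
      show "\<exists>k. k permutes ?X \<and> h = k \<circ> g \<circ> inv k"
        if "g permutes ?X" "h permutes ?X" "cycle_type n g = cycle_type n h" for g h
        using same_cycle_type_conj[OF that] .
      show "\<psi> g = \<psi> h" if gh: "g permutes ?X" "h permutes ?X" "cycle_type n g = cycle_type n h" for g h
      proof -
        obtain k where k: "k permutes ?X" "h = k \<circ> g \<circ> inv k" using same_cycle_type_conj[OF gh] by blast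
        show ?thesis
          unfolding \<psi>_def \<chi>_def k(2) chi_conj[OF fd[OF assms(1)] k(1)] chi_conj[OF fd[OF assms(2)] k(1)] ..
      qed
    qed (use g card_cycle_types in auto)
    also have "\<dots> = (\<Sum>\<nu>\<in>?P. m0 \<nu> * \<chi> \<nu> g)"
      by (simp add: sum.reindex[OF inj] m0_def \<chi>_def)
    also have "\<dots> = (\<Sum>\<nu>\<in>?P. real (m \<nu>) * \<chi> \<nu> g)"
      by (intro sum.cong refl) (simp add: m1 m_def)
    finally show ?thesis .
  qed
  have irr: "irr_char \<nu> g = complex_of_real (\<chi> \<nu> g)" if "\<nu> \<turnstile> n" "g permutes ?X" for \<nu> g
    using irr_char_chi[OF that] by (simp add: \<chi>_def)
  have irr\<psi>: "irr_char \<alpha> g * irr_char \<beta> g = complex_of_real (\<psi> g)" if "g permutes ?X" for g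
    using irr assms that by (simp add: \<psi>_def)
  have sum_irr: "(\<Sum>\<nu>\<in>?P. of_nat (k \<nu>) * irr_char \<nu> g) = complex_of_real (\<Sum>\<nu>\<in>?P. real (k \<nu>) * \<chi> \<nu> g)"
    if "g permutes ?X" for k g
    using irr that by simp
  have uniq: "k = m" if k0: "\<forall>\<nu>. \<not> \<nu> \<turnstile> n \<longrightarrow> k \<nu> = 0"
    and k: "\<forall>g. g permutes ?X \<longrightarrow> irr_char \<alpha> g * irr_char \<beta> g = (\<Sum>\<nu>\<in>?P. of_nat (k \<nu>) * irr_char \<nu> g)"
    for k :: "nat list \<Rightarrow> nat"
  proof
    fix \<kappa>
    show "k \<kappa> = m \<kappa>"
    proof (cases "\<kappa> \<turnstile> n")
      case True
      have k': "\<psi> g = (\<Sum>\<nu>\<in>?P. real (k \<nu>) * \<chi> \<nu> g)" if "g permutes ?X" for g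
        using k that irr\<psi>[OF that] sum_irr[OF that] by (metis of_real_eq_iff)
      have "m0 \<kappa> * fact n = (\<Sum>g | g permutes ?X. \<chi> \<kappa> g * (\<Sum>\<nu>\<in>?P. real (k \<nu>) * \<chi> \<nu> g))"
        using k' by (simp add: m0_def)
      also have "\<dots> = (\<Sum>g | g permutes ?X. \<Sum>\<nu>\<in>?P. real (k \<nu>) * (\<chi> \<kappa> g * \<chi> \<nu> g))"
        by (simp add: sum_distrib_left mult_ac)
      also have "\<dots> = (\<Sum>\<nu>\<in>?P. real (k \<nu>) * (\<Sum>g | g permutes ?X. \<chi> \<kappa> g * \<chi> \<nu> g))"
        by (subst sum.swap) (simp add: sum_distrib_left)
      also have "\<dots> = (\<Sum>\<nu>\<in>?P. if \<nu> = \<kappa> then real (k \<nu>) * fact n else 0)"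
        by (intro sum.cong refl) (use orth True in auto)
      also have "\<dots> = real (k \<kappa>) * fact n" using True finite_partitions by simp
      finally have "m0 \<kappa> = real (k \<kappa>)" by simp
      then show ?thesis using m1[OF True] True by (simp add: m_def)
    qed (simp add: k0 m_def)
  qed
  have "kronecker n \<alpha> \<beta> \<gamma> = m \<gamma>"
    unfolding kronecker_def char_mult_def
  proof (rule fun_cong[of _ m], rule the_equality)
    show "(\<forall>\<nu>. \<not> \<nu> \<turnstile> n \<longrightarrow> m \<nu> = 0) \<and>
      (\<forall>\<pi>. \<pi> permutes ?X \<longrightarrow> irr_char \<alpha> \<pi> * irr_char \<beta> \<pi> = (\<Sum>\<nu>\<in>?P. of_nat (m \<nu>) * irr_char \<nu> \<pi>))"
      using expand irr\<psi> sum_irr by (simp add: m_def)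
  qed (use uniq in blast)
  then show ?thesis using m1[OF assms(3)] assms(3) by (simp add: m_def m0_def \<psi>_def \<chi>_def mult_ac)
qed

text \<open>The conjugate lists the column lengths, so for self-conjugate \<open>\<mu>\<close>
  column \<open>i\<close> is as long as row \<open>i\<close>. Parts are numbered from 1 and cells
  from 0, hence the shifts by \<open>Suc\<close>.\<close>

lemma conjugate_sym:
  assumes "\<mu> \<turnstile> n" "conjugate \<mu> = \<mu>" "(i, j) \<in> diagram \<mu>" shows "(j, i) \<in> diagram \<mu>"
proof -
  let ?D = "diagram \<mu>"
  have D: "ferrers ?D" using ferrers_diagram_diagram[OF assms(1)] by (simp add: ferrers_diagram_def)
  have part: "part \<mu> (Suc p) = rows ?D p" for p by (simp add: part_def diagram_rows)
  have "card {i. part \<mu> i \<ge> Suc p \<and> i \<ge> 1} = cols ?D p" for p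
  proof -
    have "{i. part \<mu> i \<ge> Suc p \<and> i \<ge> 1} = Suc ` {i. (i, p) \<in> ?D}"
    proof (intro equalityI subsetI)
      fix i assume i: "i \<in> {i. part \<mu> i \<ge> Suc p \<and> i \<ge> 1}"
      then obtain q where "i = Suc q" by (cases i) auto
      then show "i \<in> Suc ` {i. (i, p) \<in> ?D}" using i part[of q] ferrers_rows[OF D, of q p] by auto
    qed (use part ferrers_rows[OF D] in auto)
    then show ?thesis by (simp add: card_image cols_def)
  qed
  then have nth: "conjugate \<mu> ! p = cols ?D p" if "p < rows ?D 0" for p
    using that part[of 0] by (simp add: conjugate_def del: upt_Suc)
  have len: "length \<mu> = rows ?D 0"
    using arg_cong[OF assms(2), of length] part[of 0] by (simp add: conjugate_def del: upt_Suc)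
  have "i < length \<mu>" "j < \<mu> ! i" using assms(3) by (auto simp: diagram_def)
  then have "j < cols ?D i" using nth[of i] assms(2) len by simp
  then show ?thesis using ferrers_cols[OF D] by simp
qed

text \<open>With rows numbered from 0, \<open>2 * part \<mu> (p + 1) - (2 * p + 1)\<close> equals
  \<open>2 * (rows (diagram \<mu>) p - p) - 1\<close> below the Durfee size.\<close>

lemma principal_hooks_arm:
  assumes "\<mu> \<turnstile> n"
  shows "principal_hooks \<mu> = map (\<lambda>p. 2 * arm (diagram \<mu>) p - 1) [0..<durfee \<mu>]"
    "p < durfee \<mu> \<longleftrightarrow> arm (diagram \<mu>) p \<noteq> 0"
proof -
  let ?D = "diagram \<mu>" and ?S = "{r. part \<mu> r \<ge> r}"
  have D: "ferrers ?D" using ferrers_diagram_diagram[OF assms(1)] by (simp add: ferrers_diagram_def)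
  have part: "part \<mu> (Suc p) = rows ?D p" for p by (simp add: part_def diagram_rows)
  have S: "Suc p \<in> ?S \<longleftrightarrow> (p, p) \<in> ?D" for p using part[of p] ferrers_rows[OF D, of p p] by auto
  \<comment> \<open>The set is an initial segment, so its maximum decides membership.\<close>
  have down: "r' \<in> ?S" if r: "r \<in> ?S" "r' \<le> r" for r r'
  proof (cases r')
    case (Suc p')
    then obtain p where p: "r = Suc p" "p' \<le> p" using r(2) by (cases r) auto
    then have "(p', p') \<in> ?D" using r(1) S D unfolding ferrers_def by blast
    then show ?thesis using S Suc by blast
  qed simp
  have "?S \<subseteq> insert 0 (Suc ` fst ` ?D)"
  proof
    fix r assume "r \<in> ?S"
    then show "r \<in> insert 0 (Suc ` fst ` ?D)" using S[of "r - 1"] by (cases r) force+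
  qed
  then have fin: "finite ?S" by (rule finite_subset) (simp add: finite_diagram)
  have in0: "0 \<in> ?S" by simp
  have Max: "Max ?S \<in> ?S" using fin in0 by (intro Max_in) auto
  have iff: "r \<le> durfee \<mu> \<longleftrightarrow> r \<in> ?S" for r
    unfolding durfee_def using down[OF Max] Max_ge[OF fin] by blast
  show *: "p < durfee \<mu> \<longleftrightarrow> arm ?D p \<noteq> 0" for p
    using iff[of "Suc p"] S[of p] ferrers_rows[OF D, of p p] by (auto simp: arm_def Suc_le_eq)
  have "[1..<durfee \<mu> + 1] = map Suc [0..<durfee \<mu>]" by (simp add: map_Suc_upt)
  then show "principal_hooks \<mu> = map (\<lambda>p. 2 * arm ?D p - 1) [0..<durfee \<mu>]"
    unfolding principal_hooks_def using * part by (auto simp: arm_def)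
qed

lemma principal_hooks_partition:
  assumes "\<mu> \<turnstile> n" "conjugate \<mu> = \<mu>" shows "principal_hooks \<mu> \<turnstile> n"
proof -
  let ?D = "diagram \<mu>" and ?d = "durfee \<mu>"
  have D: "ferrers ?D" using ferrers_diagram_diagram[OF assms(1)] by (simp add: ferrers_diagram_def)
  note ph = principal_hooks_arm[OF assms(1)]
  have mono: "arm ?D q \<le> arm ?D p" if "p \<le> q" for p q
  proof -
    have "rows ?D q \<le> rows ?D p"
    proof (rule ccontr)
      assume "\<not> ?thesis"
      then have "(q, rows ?D p) \<in> ?D" using ferrers_rows[OF D] by simp
      then have "(p, rows ?D p) \<in> ?D" using D that unfolding ferrers_def by blast
      then show False using ferrers_rows[OF D] by simp
    qed
    then show ?thesis using that by (simp add: arm_def)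
  qed
  have "sorted_wrt (\<ge>) (principal_hooks \<mu>)"
    unfolding ph(1) sorted_wrt_iff_nth_less using mono by (auto intro!: diff_le_mono)
  moreover have "0 \<notin> set (principal_hooks \<mu>)"
  proof
    assume "0 \<in> set (principal_hooks \<mu>)"
    then obtain p where "p < ?d" "2 * arm ?D p - 1 = 0" unfolding ph(1) by auto
    then show False using ph(2)[of p] by simp
  qed
  moreover have "sum_list (principal_hooks \<mu>) = n"
  proof -
    have "sum_list (principal_hooks \<mu>) = (\<Sum>p<?d. 2 * arm ?D p - 1)"
      unfolding ph(1) by (simp add: interv_sum_list_conv_sum_set_nat atLeast0LessThan)
    also have "\<dots> = (\<Sum>p<?d + rows ?D 0. 2 * arm ?D p - 1)"
    proof (rule sum.mono_neutral_left)
      show "\<forall>p\<in>{..<?d + rows ?D 0} - {..<?d}. 2 * arm ?D p - 1 = 0"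
      proof
        fix p assume "p \<in> {..<?d + rows ?D 0} - {..<?d}"
        then show "2 * arm ?D p - 1 = 0" using ph(2)[of p] by simp
      qed
    qed auto
    also have "\<dots> = card ?D"
      by (rule card_ferrers_arm[symmetric, OF D conjugate_sym[OF assms]]) simp_all
    finally show ?thesis using assms(1) by (simp add: card_diagram is_partition_def)
  qed
  ultimately show ?thesis by (simp add: is_partition_def)
qed

theorem theorem1p2:
  fixes n :: nat and \<mu> :: "nat list"
  assumes "\<mu> \<turnstile> n" and "conjugate \<mu> = \<mu>"
  shows "principal_hooks \<mu> \<turnstile> n \<and>
    (\<forall>\<nu> \<pi>. \<nu> \<turnstile> n \<longrightarrow> \<pi> permutes {..<n} \<longrightarrow> cycle_type n \<pi> = mset (principal_hooks \<mu>) \<longrightarrow>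
      real (kronecker n \<nu> \<mu> \<mu>) \<ge> cmod (irr_char \<nu> \<pi>))"
proof (intro conjI allI impI)
  show "principal_hooks \<mu> \<turnstile> n" by (rule principal_hooks_partition[OF assms])
  fix \<nu> \<pi> assume \<nu>: "\<nu> \<turnstile> n" and \<pi>: "\<pi> permutes {..<n}" "cycle_type n \<pi> = mset (principal_hooks \<mu>)"
  let ?X = "{..<n}" and ?D = "diagram \<mu>" and ?E = "diagram \<nu>"
  interpret sym_diagram ?D ?X
    using ferrers_diagram_diagram[OF assms(1)] conjugate_sym[OF assms]
    by (simp add: sym_diagram_def sym_diagram_axioms_def)
  have E: "ferrers_diagram ?E ?X" by (rule ferrers_diagram_diagram[OF \<nu>])
  note ph = principal_hooks_arm[OF assms(1)]
  \<comment> \<open>Where the twisted character is nonzero, \<open>g\<close> has the cycle type of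
    the principal hooks and is conjugate to \<open>\<pi>\<close>. The weighted sum is therefore
    \<open>chi\<close> at \<open>\<pi>\<close> times the norm of the twisted character.\<close>
  have supp: "chi ?E ?X g = chi ?E ?X \<pi>" if g: "g permutes ?X" "twisted_char ?D ?X g \<noteq> 0" for g
  proof -
    obtain L where L: "cycles_of ?X g L" "sorted_wrt (\<lambda>a b. length b \<le> length a) L"
      by (rule ex_sorted_cycles[OF g(1) finite_lessThan])
    note od = twisted_char_odd[OF sym_diagram_axioms L(1) g(2)]
    have "nth_or_0 (map half L) = arm ?D" by (rule twisted_char_support[OF sym_diagram_axioms L g(2)])
    also have "\<dots> = nth_or_0 (map (arm ?D) [0..<durfee \<mu>])" 
    proof
      fix p
      show "arm ?D p = nth_or_0 (map (arm ?D) [0..<durfee \<mu>]) p"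
        using ph(2)[of p] by (cases "p < durfee \<mu>") (simp_all add: nth_or_0_def)
    qed
    finally have eq: "map half L = map (arm ?D) [0..<durfee \<mu>]"
    proof (rule nth_or_0_inj)
      show "0 \<notin> set (map (arm ?D) [0..<durfee \<mu>])"
      proof
        assume "0 \<in> set (map (arm ?D) [0..<durfee \<mu>])"
        then obtain p where "p < durfee \<mu>" "arm ?D p = 0" by auto
        then show False using ph(2)[of p] by simp
      qed
    qed (use half_eq_length(2)[of L, OF od(2)] in simp)
    have "map length L = map (\<lambda>m. 2 * m - 1) (map (arm ?D) [0..<durfee \<mu>])"
      using half_eq_length(1)[of L, OF od(2)] unfolding eq .
    then have "map length L = principal_hooks \<mu>" by (simp add: ph(1) comp_def)
    then have "cycle_type n g = cycle_type n \<pi>" using cycle_type_eq[OF L(1)] \<pi>(2) by simp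
    then obtain h where h: "h permutes ?X" "\<pi> = h \<circ> g \<circ> inv h"
      using same_cycle_type_conj[OF g(1) \<pi>(1)] by blast
    show ?thesis unfolding h(2) chi_conj[OF E h(1)] ..
  qed
  have "chi ?E ?X g * (twisted_char ?D ?X g)\<^sup>2 = chi ?E ?X \<pi> * (twisted_char ?D ?X g * twisted_char ?D ?X g)" if "g permutes ?X" for g
    using supp[OF that] by (cases "twisted_char ?D ?X g = 0") (simp_all add: power2_eq_square)
  then have "(\<Sum>g | g permutes ?X. chi ?E ?X g * (twisted_char ?D ?X g)\<^sup>2)
      = chi ?E ?X \<pi> * (\<Sum>g | g permutes ?X. twisted_char ?D ?X g * twisted_char ?D ?X g)"
    by (simp add: sum_distrib_left)
  also have "\<dots> = chi ?E ?X \<pi> * (fact n * kconst ?D ?X)"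
    using sum_twisted_char[OF sym_diagram_axioms sym_diagram_axioms] card by simp
  finally have "\<bar>chi ?E ?X \<pi> * (fact n * kconst ?D ?X)\<bar>
      \<le> kconst ?D ?X * (\<Sum>g | g permutes ?X. chi ?E ?X g * chi ?D ?X g * chi ?D ?X g)"
    using chi_twisted_char_bound[OF E sym_diagram_axioms] by simp
  also have "\<dots> = kconst ?D ?X * (fact n * real (kronecker n \<nu> \<mu> \<mu>))"
    by (simp add: kronecker_eq[OF \<nu> assms(1) assms(1)])
  finally have "\<bar>chi ?E ?X \<pi>\<bar> * (fact n * kconst ?D ?X) \<le> real (kronecker n \<nu> \<mu> \<mu>) * (fact n * kconst ?D ?X)"
    using kconst_pos by (simp add: abs_mult mult_ac)
  \<comment> \<open>The norm n! times \<open>kconst\<close> is a common positive factor of both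
    sides.\<close>
  then have "\<bar>chi ?E ?X \<pi>\<bar> \<le> real (kronecker n \<nu> \<mu> \<mu>)"
    using kconst_pos by (simp add: mult_le_cancel_right)
  then show "real (kronecker n \<nu> \<mu> \<mu>) \<ge> cmod (irr_char \<nu> \<pi>)"
    by (simp add: irr_char_chi[OF \<nu> \<pi>(1)])
qed

end
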